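(* Let $n\geq 2$, let $A\subset\mathbb{R}^n$ be a Borel set, and let $0<u\leq\min\{\dim A,1\}$. Suppose that, for some $x\in\mathbb{R}^n$, there exists a non-degenerate curve $\gamma:[0,1]\to\mathbb{S}^{n-1}$ such that $$\dim\{t\in[0,1] : \gamma(t)\in\pi_x(A)\}>u.$$ Then there exists a subset $A_x\subset A$ such that $\dim A_x\geq u$ and $\dim\Pi_x^a(A)\geq u$ for all $a\in A_x$.
   Context: Here $\dim$ denotes Hausdorff dimension. For $A\subset\mathbb{R}^n$ and $a,x\in\mathbb{R}^n$, $$\Pi_x^a(A):=\{\alpha\in\mathbb{R} : (a-x)\cdot y=\alpha \text{ for some } y\in A\}.$$ The radial projection $\pi_x:\mathbb{R}^n\setminus\{x\}\to\mathbb{S}^{n-1}$ is $\pi_x(y):=\frac{y-x}{|y-x|}$, and by convention $\pi_x(A):=\pi_x(A\setminus\{x\})$. A non-degenerate curve is a smooth map $\gamma:[0,1]\to\mathbb{S}^{n-1}$ such that for every $t\in[0,1]$, $$\det[\gamma(t),\gamma^{(1)}(t),\dots,\gamma^{(n-1)}(t)]\neq 0,$$ where $\gamma^{(j)}$ denotes the $j$-th derivative. *)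

theory Defs
  imports "HOL-Analysis.Analysis"
begin

text \<open>
  The weight \<open>(diam U)\<^sup>s\<close> of a covering set, with \<open>0\<^sup>0 = 1\<close> for nonempty sets
  (\<open>powr\<close> would give \<open>0\<close>) and weight \<open>0\<close> for the empty set, which pads finite covers.
\<close>
definition diam_weight :: "real \<Rightarrow> 'a::metric_space set \<Rightarrow> ennreal" where
  "diam_weight s U =
     (if U = {} then 0 else if s = 0 then 1 else ennreal (diameter U powr s))"

text \<open>
  Boundedness is required because \<^const>\<open>diameter\<close> is unspecified on unbounded sets.
\<close>
definition hausdorff_premeasure :: "real \<Rightarrow> real \<Rightarrow> 'a::metric_space set \<Rightarrow> ennreal" where
  "hausdorff_premeasure s \<delta> A =
     Inf {(\<Sum>i. diam_weight s (U i)) | U :: nat \<Rightarrow> 'a set.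
            A \<subseteq> (\<Union>i. U i) \<and> (\<forall>i. bounded (U i) \<and> diameter (U i) \<le> \<delta>)}"

definition hausdorff_measure :: "real \<Rightarrow> 'a::metric_space set \<Rightarrow> ennreal" where
  "hausdorff_measure s A = (SUP \<delta>\<in>{0<..}. hausdorff_premeasure s \<delta> A)"

definition hausdorff_dim :: "'a::metric_space set \<Rightarrow> ennreal" where
  "hausdorff_dim A = Inf {ennreal s | s. 0 \<le> s \<and> hausdorff_measure s A = 0}"

definition Pi_proj :: "real ^ 'n \<Rightarrow> real ^ 'n \<Rightarrow> (real ^ 'n) set \<Rightarrow> real set" where
  "Pi_proj x a A = {\<alpha>. \<exists>y\<in>A. (a - x) \<bullet> y = \<alpha>}"

definition radial_proj :: "real ^ 'n \<Rightarrow> real ^ 'n \<Rightarrow> real ^ 'n" where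
  "radial_proj x y = (y - x) /\<^sub>R norm (y - x)"

definition radial_proj_set :: "real ^ 'n \<Rightarrow> (real ^ 'n) set \<Rightarrow> (real ^ 'n) set" where
  "radial_proj_set x A = radial_proj x ` (A - {x})"

text \<open>
  Derivatives on \<open>[0,1]\<close> are taken within \<open>[0,1]\<close>, hence one-sided at the endpoints;
  values of the curve outside \<open>[0,1]\<close> play no role.
\<close>
primrec curve_deriv :: "nat \<Rightarrow> (real \<Rightarrow> real ^ 'n) \<Rightarrow> real \<Rightarrow> real ^ 'n" where
  "curve_deriv 0 \<gamma> = \<gamma>"
| "curve_deriv (Suc k) \<gamma> = (\<lambda>t. vector_derivative (curve_deriv k \<gamma>) (at t within {0..1}))"

definition smooth_curve :: "(real \<Rightarrow> real ^ 'n) \<Rightarrow> bool" where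
  "smooth_curve \<gamma> \<longleftrightarrow> (\<forall>k. curve_deriv k \<gamma> differentiable_on {0..1})"

text \<open>
  \<open>to_nat_on UNIV\<close> is a bijection from the index type \<open>'n\<close> onto \<open>{..<CARD('n)}\<close>, so the
  columns of the matrix are the derivatives of orders \<open>0, \<dots>, CARD('n) - 1\<close>, each exactly
  once. A different enumeration changes only the sign of the determinant.
\<close>
definition nondegenerate_curve :: "(real \<Rightarrow> real ^ 'n) \<Rightarrow> bool" where
  "nondegenerate_curve \<gamma> \<longleftrightarrow>
     smooth_curve \<gamma> \<and>
     (\<forall>t\<in>{0..1}. \<gamma> t \<in> sphere 0 1) \<and>
     (\<forall>t\<in>{0..1}. det (\<chi> i j. curve_deriv (to_nat_on (UNIV :: 'n set) j) \<gamma> t $ i) \<noteq> 0)"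

end

theory Submission
  imports Defs
begin

text \<open>
  The deep restricted projection theorems are not needed, because \<open>A\<close> itself contains the points
  \<open>x + r *\<^sub>R \<gamma> s\<close> with \<open>s\<close> in a set of dimension greater than \<open>u\<close>. For points of the cone over a short
  arc the projections along \<open>\<gamma> t\<close> are transversal, and Kaufman's argument in the parameters
  \<open>(s, r)\<close> shows that the directions \<open>t\<close> with a projection of dimension less than \<open>u\<close> form a set
  of \<open>u\<close>-dimensional measure zero. Removing them leaves the required subset of \<open>A\<close>.

  No measures on \<open>A\<close> or on the exceptional set are constructed: additive weights on dyadic squares
  replace them, and finite trees suffice for the exceptional set, which need not be measurable.
  The parameter set is Borel, and Choquet's argument for dyadic contents provides a compact subset
  that carries such weights.
\<close>

section \<open>Contents on trees of labels\<close>

text \<open>Fix exponents v < \<beta> < u. If the projection at t maps the parameter set to a v-null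
  set, then at arbitrarily fine scales 2^-k the pairs of cells with images within O(2^-k) have
  product weight at least c * 2^(-\<beta> k). Averaged over t against a Frostman weight of exponent
  u, transversality allows this only for a set of t of content O((k + 1) * 2^((\<beta> - u) k)).
  These bounds are summable, so a Borel-Cantelli argument makes the exceptional set null. The gap
  between v and u pays for the factor k + 1 and for the unknown scale; hence every v < u is treated
  separately, along a sequence tending to u. Exceptional sets are shown to be null for the
  u-dimensional measure itself, so that removing countably many of them from a non-null set leaves a
  non-null set, which has dimension at least u.

  The Frostman weight in t may change with k, and this is why finite trees and arbitrary sets are
  enough there. The weight on the parameters has to serve all scales at once, and this is what calls
  for a compactness limit and for capacitability.\<close>

locale label_tree =
  fixes lab :: "nat \<Rightarrow> 'a \<Rightarrow> 'l" and par :: "'l \<Rightarrow> 'l" and w :: "'l \<Rightarrow> real"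
  assumes par_lab: "par (lab (Suc k) z) = lab k z"
    and level: "lab k z = lab j z' \<Longrightarrow> k = j"
    and w_nonneg: "0 \<le> w l"
begin

lemma lab_coarsen:
  assumes "lab k z = lab k z'" "j \<le> k"
  shows "lab j z = lab j z'"
  using assms(2,1)
proof (induction rule: inc_induct)
  case (step n)
  then show ?case by (metis par_lab)
qed simp

text \<open>Cells are represented by labels only, and a cover may mix levels and be infinite. By
  \<open>level\<close> a label belongs to a single level, so the resulting \<open>content\<close> is
  a net version of Hausdorff content, with no restriction on the size of the cells.\<close>

definition covers :: "'l set \<Rightarrow> 'a set \<Rightarrow> bool" where
  "covers U B \<longleftrightarrow> (\<forall>z\<in>B. \<exists>k. lab k z \<in> U)"

text \<open>An integral over counting measure rather than a series: subadditivity and, for the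
  increasing sets lemma, Fatou's lemma then apply without an enumeration of the labels.\<close>

definition cost :: "'l set \<Rightarrow> ennreal" where
  "cost U = (\<integral>\<^sup>+l. ennreal (w l) \<partial>count_space U)"

definition content :: "'a set \<Rightarrow> ennreal" where
  "content B = (INF U\<in>{U. covers U B}. cost U)"

lemma cost_indicator: "cost U = (\<integral>\<^sup>+l. ennreal (w l) * indicator U l \<partial>count_space UNIV)"
  unfolding cost_def by (simp add: nn_integral_count_space_indicator)

lemma cost_mono: "U \<subseteq> V \<Longrightarrow> cost U \<le> cost V"
  unfolding cost_indicator by (intro nn_integral_mono) (auto split: split_indicator)

lemma cost_disjoint_Un: "U \<inter> V = {} \<Longrightarrow> cost (U \<union> V) = cost U + cost V"
  unfolding cost_indicator
  by (subst nn_integral_add[symmetric]) (auto intro!: nn_integral_cong split: split_indicator)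

lemma cost_finite: "finite U \<Longrightarrow> cost U = ennreal (\<Sum>l\<in>U. w l)"
  unfolding cost_def by (simp add: nn_integral_count_space_finite sum_ennreal w_nonneg)

lemma cost_UN: "cost (\<Union>i::nat. U i) \<le> (\<Sum>i. cost (U i))"
proof -
  have "cost (\<Union>i. U i) \<le> (\<integral>\<^sup>+l. (\<Sum>i. ennreal (w l) * indicator (U i) l) \<partial>count_space UNIV)"
    unfolding cost_indicator
  proof (intro nn_integral_mono)
    fix l
    show "ennreal (w l) * indicator (\<Union>i. U i) l \<le> (\<Sum>i. ennreal (w l) * indicator (U i) l)"
    proof (cases "\<exists>i. l \<in> U i")
      case True
      then obtain i where "l \<in> U i" by blast
      then have "ennreal (w l) * indicator (\<Union>i. U i) l = (\<Sum>j\<in>{i}. ennreal (w l) * indicator (U j) l)"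
        by (auto split: split_indicator)
      also have "\<dots> \<le> (\<Sum>i. ennreal (w l) * indicator (U i) l)"
        by (intro sum_le_suminf) auto
      finally show ?thesis .
    qed auto
  qed
  also have "\<dots> = (\<Sum>i. cost (U i))"
    unfolding cost_indicator by (intro nn_integral_suminf) auto
  finally show ?thesis .
qed

lemma content_le: "covers U B \<Longrightarrow> content B \<le> cost U"
  unfolding content_def by (auto intro!: INF_lower)

lemma content_near:
  assumes "content B < c"
  obtains U where "covers U B" "cost U < c"
  using assms unfolding content_def by (auto simp: INF_less_iff)

lemma content_mono: "B \<subseteq> B' \<Longrightarrow> content B \<le> content B'"
  unfolding content_def covers_def by (intro INF_superset_mono) auto

lemma content_empty [simp]: "content {} = 0"
proof -
  have "content {} \<le> cost {}" by (rule content_le) (simp add: covers_def)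
  then show ?thesis by (simp add: cost_finite)
qed

lemma content_cell: "(\<And>z. z \<in> B \<Longrightarrow> lab k z = l) \<Longrightarrow> content B \<le> ennreal (w l)"
  using content_le[of "{l}" B] by (fastforce simp: covers_def cost_finite)

lemma content_UN: "content (\<Union>i::nat. B i) \<le> (\<Sum>i. content (B i))"
proof (cases "\<exists>i. content (B i) = top")
  case True
  then obtain i where "content (B i) = top" by blast
  then have "top = (\<Sum>j\<in>{i}. content (B j))" by simp
  also have "\<dots> \<le> (\<Sum>i. content (B i))" by (intro sum_le_suminf) auto
  finally show ?thesis by (simp add: top_unique)
next
  case False
  show ?thesis
  proof (rule ennreal_le_epsilon)
    fix e :: real assume e: "0 < e"
    have "\<exists>U. covers U (B i) \<and> cost U < content (B i) + ennreal (e * (1/2) ^ Suc i)" for i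
    proof (rule content_near[of "B i" "content (B i) + ennreal (e * (1/2) ^ Suc i)"])
      have "0 < ennreal (e * (1/2) ^ Suc i)" using e by (simp add: ennreal_zero_less_mult_iff)
      then show "content (B i) < content (B i) + ennreal (e * (1/2) ^ Suc i)"
        using False by (metis add.right_neutral ennreal_add_left_cancel_less infinity_ennreal_def)
    qed blast
    then obtain U where U: "\<And>i. covers (U i) (B i)"
      "\<And>i. cost (U i) < content (B i) + ennreal (e * (1/2) ^ Suc i)" by metis
    have "content (\<Union>i. B i) \<le> cost (\<Union>i. U i)"
      by (rule content_le) (use U(1) in \<open>fastforce simp: covers_def\<close>)
    also have "\<dots> \<le> (\<Sum>i. cost (U i))" by (rule cost_UN)
    also have "\<dots> \<le> (\<Sum>i. content (B i) + ennreal (e * (1/2) ^ Suc i))"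
      using U(2) by (intro suminf_le) (auto intro: less_imp_le)
    also have "\<dots> = (\<Sum>i. content (B i)) + (\<Sum>i. ennreal (e * (1/2) ^ Suc i))"
      by (intro suminf_add[symmetric]) auto
    also have "(\<Sum>i. ennreal (e * (1/2) ^ Suc i)) = ennreal e"
      using sums_mult[OF power_half_series, of e] e
      by (intro suminf_ennreal_eq) (auto simp: power_Suc)
    finally show "content (\<Union>i. B i) \<le> (\<Sum>i. content (B i)) + ennreal e" .
  qed
qed

lemma content_UN_finite:
  assumes "finite I"
  shows "content (\<Union>i\<in>I. B i) \<le> (\<Sum>i\<in>I. content (B i))"
  using assms
proof (induction)
  case (insert i I)
  have "content (B i \<union> (\<Union>i\<in>I. B i)) \<le> (\<Sum>j. content (if j = (0::nat) then B i else if j = 1 then (\<Union>i\<in>I. B i) else {}))"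
    by (rule order.trans[OF content_mono content_UN]) (auto split: if_splits)
  also have "\<dots> = (\<Sum>j\<in>{0,1}. content (if j = (0::nat) then B i else if j = 1 then (\<Union>i\<in>I. B i) else {}))"
    by (intro suminf_finite) auto
  also have "\<dots> = content (B i) + content (\<Union>i\<in>I. B i)" by simp
  finally show ?case using insert by (auto intro: order.trans add_left_mono)
qed simp

section \<open>Merging of covers and the increasing sets lemma\<close>

definition under :: "'l set \<Rightarrow> 'l \<Rightarrow> bool" where
  "under U l \<longleftrightarrow> (\<exists>z k j. l = lab k z \<and> j < k \<and> lab j z \<in> U)"

text \<open>\<open>under\<close> is strict, whereas \<open>fresh\<close> also drops the cells of
  \<open>V\<close> itself. A cell common to both covers is therefore counted at most once, on the
  side of \<open>V\<close>, and the two parts are disjoint.\<close>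

definition keep :: "'l set \<Rightarrow> 'l set \<Rightarrow> 'l set" where
  "keep V U = {l\<in>V. \<not> under U l}"

definition fresh :: "'l set \<Rightarrow> 'l set \<Rightarrow> 'l set" where
  "fresh V U = {l\<in>U. \<not> under V l \<and> l \<notin> V}"

lemma under_lab: "under U (lab k z) \<longleftrightarrow> (\<exists>j<k. lab j z \<in> U)"
  unfolding under_def by (metis lab_coarsen level less_imp_le)

text \<open>The discarded cells still cover \<open>B\<close>: of the two nested cells at a point of
  \<open>B\<close> the smaller one is discarded. As \<open>V\<close> is optimal for \<open>B\<close>
  up to \<open>d\<close>, the retained part of \<open>V\<close> costs at most \<open>d\<close> more
  than the discarded part of \<open>U\<close>, and adding \<open>fresh V U\<close> restores the cost
  of \<open>U\<close>. Finiteness is what permits the cancellation.\<close>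

lemma merge_step:
  assumes V: "covers V B" "cost V \<le> content B + d" and U: "covers U B'" "cost U \<le> content B' + e"
    and "B \<subseteq> B'" and fin: "content B + d < top"
  shows "cost (keep V U \<union> fresh V U) \<le> content B' + (d + e)"
proof -
  have V_split: "cost V = cost (V - keep V U) + cost (keep V U)"
    by (subst cost_disjoint_Un[symmetric]) (auto simp: keep_def intro: arg_cong[where f=cost])
  have U_split: "cost U = cost (U - fresh V U) + cost (fresh V U)"
    by (subst cost_disjoint_Un[symmetric]) (auto simp: fresh_def intro: arg_cong[where f=cost])
  have "covers ((V - keep V U) \<union> (U - fresh V U)) B"
    unfolding covers_def
  proof
    fix z assume z: "z \<in> B"
    from V(1) z obtain k where k: "lab k z \<in> V" by (auto simp: covers_def)
    from U(1) z \<open>B \<subseteq> B'\<close> obtain j where j: "lab j z \<in> U" by (auto simp: covers_def)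
    show "\<exists>k. lab k z \<in> V - keep V U \<union> (U - fresh V U)"
    proof (cases "j < k")
      case True
      then have "lab k z \<in> V - keep V U" using k j by (auto simp: keep_def under_lab)
      then show ?thesis by blast
    next
      case False
      then have "lab j z \<in> U - fresh V U"
        using k j by (auto simp: fresh_def under_lab not_less le_less)
      then show ?thesis by blast
    qed
  qed
  then have "content B \<le> cost ((V - keep V U) \<union> (U - fresh V U))" by (rule content_le)
  also have "\<dots> \<le> cost (V - keep V U) + cost (U - fresh V U)"
  proof -
    have "cost (X \<union> Y) \<le> cost X + cost Y" for X Y
      using cost_disjoint_Un[of X "Y - X"] cost_mono[of "Y - X" Y]
      by (auto intro: add_left_mono)
    then show ?thesis .
  qed
  finally have *: "content B \<le> cost (V - keep V U) + cost (U - fresh V U)" .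
  have "cost (V - keep V U) + cost (keep V U) \<le> content B + d"
    using V(2) V_split by simp
  also have "\<dots> \<le> cost (V - keep V U) + (cost (U - fresh V U) + d)"
    using * by (metis add.assoc add_right_mono)
  finally have **: "cost (V - keep V U) + cost (keep V U) \<le> cost (V - keep V U) + (cost (U - fresh V U) + d)" .
  have "cost (V - keep V U) \<noteq> top"
    using V(2) V_split fin by (metis add_top add.commute leD top.not_eq_extremum top_greatest order.trans ennreal_add_eq_top)
  with ** have "cost (keep V U) \<le> cost (U - fresh V U) + d"
    by (simp add: ennreal_add_left_cancel_le)
  then have "cost (keep V U) + cost (fresh V U) \<le> (cost (U - fresh V U) + d) + cost (fresh V U)"
    by (rule add_right_mono)
  also have "\<dots> = cost U + d" unfolding U_split by (simp add: ac_simps)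
  also have "\<dots> \<le> content B' + (d + e)" using U(2) by (metis add.assoc add.commute add_right_mono)
  finally show ?thesis
    by (subst cost_disjoint_Un) (auto simp: keep_def fresh_def)
qed

text \<open>Nothing lies above the coarsest cells at \<open>z\<close> in either cover, so the
  coarser of these two survives the merge. Along a sequence of merges the coarsest level at a fixed
  point can therefore only decrease.\<close>

lemma merge_least:
  assumes "\<exists>k. lab k z \<in> V" "\<exists>j. lab j z \<in> U"
  shows "lab (min (LEAST k. lab k z \<in> V) (LEAST j. lab j z \<in> U)) z \<in> keep V U \<union> fresh V U"
proof -
  define k where "k = (LEAST k. lab k z \<in> V)"
  define j where "j = (LEAST j. lab j z \<in> U)"
  have "lab k z \<in> V" "lab j z \<in> U"
    unfolding k_def j_def using assms by (metis (mono_tags, lifting) LeastI)+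
  moreover have "\<And>i. i < k \<Longrightarrow> lab i z \<notin> V" "\<And>i. i < j \<Longrightarrow> lab i z \<notin> U"
    unfolding k_def j_def using not_less_Least by metis+
  ultimately have "lab (min k j) z \<in> keep V U \<union> fresh V U"
    by (cases "j < k") (auto simp: keep_def fresh_def under_lab min_def)
  then show ?thesis unfolding k_def j_def .
qed

primrec merge :: "(nat \<Rightarrow> 'l set) \<Rightarrow> nat \<Rightarrow> 'l set" where
  "merge U 0 = U 0"
| "merge U (Suc n) = keep (merge U n) (U (Suc n)) \<union> fresh (merge U n) (U (Suc n))"

text \<open>
  The increasing sets lemma. Merging nearly optimal covers of the sets by keeping the larger of
  two nested cells loses nothing up to the errors, because the replaced cells were nearly optimal
  for the smaller set.
\<close>
lemma content_incseq_le:
  assumes inc: "\<And>n. A n \<subseteq> A (Suc n)" and c: "\<And>n. content (A n) \<le> ennreal c"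
  shows "content (\<Union>n. A n) \<le> ennreal c"
proof (rule ennreal_le_epsilon)
  fix e :: real assume e: "0 < e"
  define \<epsilon> where "\<epsilon> n = ennreal (e * (1/2) ^ Suc n)" for n
  have eps_pos: "0 < \<epsilon> n" for n using e by (simp add: \<epsilon>_def ennreal_zero_less_mult_iff)
  have "\<exists>U. covers U (A n) \<and> cost U \<le> content (A n) + \<epsilon> n" for n
  proof (rule content_near[of "A n" "content (A n) + \<epsilon> n"])
    have "content (A n) \<noteq> top" using c[of n] by (metis ennreal_less_top leD top.not_eq_extremum)
    then show "content (A n) < content (A n) + \<epsilon> n"
      using eps_pos[of n] by (metis add.right_neutral ennreal_add_left_cancel_less infinity_ennreal_def)
  qed (auto intro: less_imp_le)
  then obtain U where U: "\<And>n. covers (U n) (A n)" "\<And>n. cost (U n) \<le> content (A n) + \<epsilon> n"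
    by metis
  have sum_eps: "(\<Sum>i\<le>n. \<epsilon> i) \<le> ennreal e" for n
  proof -
    have "(\<Sum>i\<le>n. \<epsilon> i) \<le> (\<Sum>i. \<epsilon> i)" by (intro sum_le_suminf) auto
    also have "\<dots> = ennreal e" unfolding \<epsilon>_def
      using sums_mult[OF power_half_series, of e] e
      by (intro suminf_ennreal_eq) (auto simp: power_Suc)
    finally show ?thesis .
  qed
  have merge_covers: "covers (merge U n) (A n)" for n
  proof (induction n)
    case (Suc n)
    show ?case unfolding covers_def
    proof
      fix z assume z: "z \<in> A (Suc n)"
      obtain j where j: "lab j z \<in> U (Suc n)" using U(1)[of "Suc n"] z by (auto simp: covers_def)
      show "\<exists>k. lab k z \<in> merge U (Suc n)"
      proof (cases "\<exists>k. lab k z \<in> merge U n")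
        case True
        then have "lab (min (LEAST k. lab k z \<in> merge U n) (LEAST k. lab k z \<in> U (Suc n))) z \<in> merge U (Suc n)"
          unfolding merge.simps using j
          by (intro merge_least) blast+
        then show ?thesis by blast
      next
        case False
        then have "lab j z \<in> merge U (Suc n)" using j by (auto simp: fresh_def under_lab)
        then show ?thesis by blast
      qed
    qed
  qed (use U in simp)
  have merge_cost: "cost (merge U n) \<le> content (A n) + (\<Sum>i\<le>n. \<epsilon> i)" for n
  proof (induction n)
    case (Suc n)
    have "content (A n) + (\<Sum>i\<le>n. \<epsilon> i) \<le> ennreal c + ennreal e"
      using c[of n] sum_eps[of n] by (rule add_mono)
    also have "\<dots> < top" by simp
    finally have "content (A n) + (\<Sum>i\<le>n. \<epsilon> i) < top" .
    from merge_step[OF merge_covers Suc U(1)[of "Suc n"] U(2) inc this]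
    show ?case by simp
  qed (use U(2)[of 0] in simp)
  \<comment> \<open>The cells that stay in the merged covers from some index on. The indicator of
    \<open>W\<close> is at most the lim inf of theirs, so Fatou's lemma bounds its cost.\<close>
  define W where "W = {l. \<exists>n0. \<forall>n\<ge>n0. l \<in> merge U n}"
  have "covers W (\<Union>n. A n)"
    unfolding covers_def
  proof
    fix z assume "z \<in> (\<Union>n. A n)"
    then obtain n0 where n0: "z \<in> A n0" by blast
    have zA: "z \<in> A n" if "n \<ge> n0" for n
      using lift_Suc_mono_le[of A n0 n] inc n0 that by blast
    define K where "K n = (LEAST k. lab k z \<in> merge U n)" for n
    have K: "lab (K n) z \<in> merge U n" if "n \<ge> n0" for n
      unfolding K_def using merge_covers[of n] zA[OF that] by (intro LeastI_ex[of "\<lambda>k. lab k z \<in> merge U n"]) (simp add: covers_def)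
    have K_dec: "K (Suc n) \<le> K n" if n: "n \<ge> n0" for n
    proof -
      obtain j where j: "lab j z \<in> U (Suc n)"
        using U(1)[of "Suc n"] zA[of "Suc n"] n by (auto simp: covers_def)
      have "lab (min (K n) (LEAST k. lab k z \<in> U (Suc n))) z \<in> merge U (Suc n)"
        unfolding merge.simps K_def using j K[OF n]
        by (intro merge_least) blast+
      then have "K (Suc n) \<le> min (K n) (LEAST k. lab k z \<in> U (Suc n))"
        unfolding K_def[of "Suc n"] by (rule Least_le)
      then show ?thesis by simp
    qed
    \<comment> \<open>A nonincreasing sequence of levels becomes constant. From then on the coarsest
      cell at \<open>z\<close> is always the same label, which is thus in \<open>W\<close>.\<close>
    have "\<exists>N\<ge>n0. \<forall>n\<ge>n0. K N \<le> K n"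
      using arg_min_nat_lemma[of "\<lambda>n. n \<ge> n0" n0 K] by blast
    then obtain N where N: "N \<ge> n0" "\<And>n. n \<ge> n0 \<Longrightarrow> K N \<le> K n" by blast
    have "K n = K N" if "n \<ge> N" for n
      using that
    proof (induction rule: dec_induct)
      case (step m)
      then show ?case using K_dec[of m] N(2)[of "Suc m"] N(1) by simp
    qed simp
    then have "\<forall>n\<ge>N. lab (K N) z \<in> merge U n" using K N(1) by (metis order.trans)
    then have "lab (K N) z \<in> W" unfolding W_def by blast
    then show "\<exists>k. lab k z \<in> W" by blast
  qed
  then have "content (\<Union>n. A n) \<le> cost W" by (rule content_le)
  also have "\<dots> \<le> (\<integral>\<^sup>+l. liminf (\<lambda>n. ennreal (w l) * indicator (merge U n) l) \<partial>count_space UNIV)"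
    unfolding cost_indicator
  proof (intro nn_integral_mono)
    fix l
    show "ennreal (w l) * indicator W l \<le> liminf (\<lambda>n. ennreal (w l) * indicator (merge U n) l)"
    proof (cases "l \<in> W")
      case True
      then have "\<forall>\<^sub>F n in sequentially. ennreal (w l) \<le> ennreal (w l) * indicator (merge U n) l"
        unfolding W_def by (auto elim!: eventually_mono simp: eventually_at_top_linorder[symmetric])
      then show ?thesis using True by (auto intro: Liminf_bounded)
    qed simp
  qed
  also have "\<dots> \<le> liminf (\<lambda>n. cost (merge U n))"
    unfolding cost_indicator by (intro nn_integral_liminf) auto
  also have "\<dots> \<le> ennreal c + ennreal e"
  proof (rule order.trans[OF Liminf_mono Liminf_const[THEN eq_refl]])
    show "\<forall>\<^sub>F n in sequentially. cost (merge U n) \<le> ennreal c + ennreal e"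
      using merge_cost c sum_eps by (intro always_eventually allI) (meson add_mono order.trans)
  qed simp
  finally show "content (\<Union>n. A n) \<le> ennreal c + ennreal e" .
qed

end

section \<open>Frostman weights on trees\<close>

context label_tree
begin

text \<open>The argument \<open>d\<close> is the height above the finest level \<open>N\<close>: the
  label \<open>l\<close> is meant at level \<open>N - d\<close>, and in the recursive equation the
  children have level \<open>N - d\<close>.\<close>

primrec cap :: "'a set \<Rightarrow> 'a set \<Rightarrow> nat \<Rightarrow> nat \<Rightarrow> 'l \<Rightarrow> real" where
  "cap Z B N 0 l = (if \<exists>z\<in>B. lab N z = l then w l else 0)"
| "cap Z B N (Suc d) l = min (w l) (\<Sum>q | q \<in> lab (N - d) ` Z \<and> par q = l. cap Z B N d q)"

text \<open>Mass is pushed down from the roots, each cell dividing its share among its children in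
  proportion to their capacities. If these sum to 0, division yields 0, which is right because the
  parent then carries no mass.\<close>

primrec cap_flow :: "'a set \<Rightarrow> 'a set \<Rightarrow> nat \<Rightarrow> nat \<Rightarrow> 'l \<Rightarrow> real" where
  "cap_flow Z B N 0 l = cap Z B N N l"
| "cap_flow Z B N (Suc k) l = cap_flow Z B N k (par l) * cap Z B N (N - Suc k) l /
     (\<Sum>q | q \<in> lab (Suc k) ` Z \<and> par q = par l. cap Z B N (N - Suc k) q)"

lemma cap_nonneg: "0 \<le> cap Z B N d l"
  by (induction d arbitrary: l) (auto simp: w_nonneg intro!: sum_nonneg)

lemma cap_le: "cap Z B N d l \<le> w l"
  by (cases d) (auto simp: w_nonneg)

lemma cap_pos:
  assumes "0 < cap Z B N d l" "d \<le> N"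
  shows "\<exists>z\<in>B. lab (N - d) z = l"
  using assms
proof (induction d arbitrary: l)
  case 0
  then show ?case by (auto split: if_splits)
next
  case (Suc d)
  then have "0 < (\<Sum>q | q \<in> lab (N - d) ` Z \<and> par q = l. cap Z B N d q)" by simp
  then have "\<exists>q\<in>{q. q \<in> lab (N - d) ` Z \<and> par q = l}. 0 < cap Z B N d q"
    by (rule contrapos_pp) (auto simp: not_less intro!: sum_nonpos)
  then obtain q where q: "q \<in> lab (N - d) ` Z" "par q = l" "cap Z B N d q > 0" by blast
  with Suc obtain z where "z \<in> B" "lab (N - d) z = q" by auto
  moreover have "N - d = Suc (N - Suc d)" using Suc.prems by simp
  ultimately show ?case using q(2) par_lab by metis
qed

text \<open>Content satisfies the recursion of \<open>cap\<close> as an inequality: it is at most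
  the weight of the cell, which covers by itself, and at most the sum over the children.\<close>

lemma content_le_cap:
  assumes fin: "\<And>k. finite (lab k ` Z)" and "B \<subseteq> Z" "d \<le> N"
  shows "content {z\<in>B. lab (N - d) z = l} \<le> ennreal (cap Z B N d l)"
  using assms(3)
proof (induction d arbitrary: l)
  case 0
  show ?case
  proof (cases "\<exists>z\<in>B. lab N z = l")
    case True
    then show ?thesis by (auto intro: content_cell)
  next
    case False
    then have "{z\<in>B. lab (N - 0) z = l} = {}" by auto
    then show ?thesis by (simp only: content_empty) simp
  qed
next
  case (Suc d)
  have eq: "N - d = Suc (N - Suc d)" using Suc.prems by simp
  let ?Q = "{q \<in> lab (N - d) ` Z. par q = l}"
  have "{z\<in>B. lab (N - Suc d) z = l} \<subseteq> (\<Union>q\<in>?Q. {z\<in>B. lab (N - d) z = q})"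
    using \<open>B \<subseteq> Z\<close> by (auto simp: eq par_lab)
  then have "content {z\<in>B. lab (N - Suc d) z = l} \<le> content (\<Union>q\<in>?Q. {z\<in>B. lab (N - d) z = q})"
    by (rule content_mono)
  also have "\<dots> \<le> (\<Sum>q\<in>?Q. content {z\<in>B. lab (N - d) z = q})"
    using fin by (intro content_UN_finite) auto
  also have "\<dots> \<le> (\<Sum>q\<in>?Q. ennreal (cap Z B N d q))"
    using Suc by (intro sum_mono) auto
  also have "\<dots> = ennreal (\<Sum>q\<in>?Q. cap Z B N d q)" by (intro sum_ennreal cap_nonneg)
  finally show ?case
    using content_cell[of "{z\<in>B. lab (N - Suc d) z = l}" "N - Suc d" l]
    by (simp add: min_def)
qed

text \<open>The invariant is a bound by \<open>cap\<close> and not just by \<open>w\<close>: only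
  then does the mass of a parent fit into the joint capacity of its children, which keeps the
  proportional shares within their own capacities.\<close>

lemma cap_flow_bounds:
  assumes fin: "\<And>k. finite (lab k ` Z)" and "k \<le> N" "l \<in> lab k ` Z"
  shows "0 \<le> cap_flow Z B N k l \<and> cap_flow Z B N k l \<le> cap Z B N (N - k) l"
  using assms(2,3)
proof (induction k arbitrary: l)
  case 0
  then show ?case by (simp add: cap_nonneg)
next
  case (Suc k)
  let ?S = "\<Sum>q | q \<in> lab (Suc k) ` Z \<and> par q = par l. cap Z B N (N - Suc k) q"
  have "par l \<in> lab k ` Z" using Suc.prems by (auto simp: par_lab)
  with Suc have IH: "0 \<le> cap_flow Z B N k (par l)" "cap_flow Z B N k (par l) \<le> cap Z B N (N - k) (par l)"
    by auto
  have "N - k = Suc (N - Suc k)" "N - (N - Suc k) = Suc k" using Suc.prems by auto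
  then have "cap Z B N (N - k) (par l) \<le> ?S" by simp
  with IH have le: "cap_flow Z B N k (par l) \<le> ?S" by simp
  have S: "0 \<le> ?S" by (intro sum_nonneg cap_nonneg)
  have "cap_flow Z B N k (par l) * cap Z B N (N - Suc k) l \<le> ?S * cap Z B N (N - Suc k) l"
    using le by (intro mult_right_mono cap_nonneg)
  then have "cap_flow Z B N (Suc k) l \<le> cap Z B N (N - Suc k) l"
    using S cap_nonneg[of Z B N "N - Suc k" l]
    by (cases "?S = 0") (auto simp: divide_le_eq mult.commute)
  then show ?case using IH S by (auto intro!: divide_nonneg_nonneg mult_nonneg_nonneg cap_nonneg)
qed

lemma cap_flow_additive:
  assumes fin: "\<And>k. finite (lab k ` Z)" and "k < N" "l \<in> lab k ` Z"
  shows "cap_flow Z B N k l = (\<Sum>q | q \<in> lab (Suc k) ` Z \<and> par q = l. cap_flow Z B N (Suc k) q)"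
proof -
  let ?Q = "{q. q \<in> lab (Suc k) ` Z \<and> par q = l}"
  let ?S = "\<Sum>q\<in>?Q. cap Z B N (N - Suc k) q"
  have "N - k = Suc (N - Suc k)" "N - (N - Suc k) = Suc k" using assms by auto
  then have "cap Z B N (N - k) l \<le> ?S" by simp
  with cap_flow_bounds[OF fin _ assms(3), of N B] assms(2)
  have le: "0 \<le> cap_flow Z B N k l" "cap_flow Z B N k l \<le> ?S" by auto
  have "(\<Sum>q\<in>?Q. cap_flow Z B N (Suc k) q)
      = (\<Sum>q\<in>?Q. cap_flow Z B N k l * cap Z B N (N - Suc k) q / ?S)"
    by (intro sum.cong) auto
  also have "\<dots> = cap_flow Z B N k l * ?S / ?S"
    by (simp add: sum_divide_distrib sum_distrib_left)
  also have "\<dots> = cap_flow Z B N k l" using le by (cases "?S = 0") auto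
  finally show ?thesis by simp
qed

text \<open>The recursion behind max-flow min-cut: \<open>cap\<close> is the largest mass that fits below a cell.\<close>
lemma finite_frostman:
  assumes fin: "\<And>k. finite (lab k ` Z)" and "B \<subseteq> Z"
  obtains m :: "nat \<Rightarrow> 'l \<Rightarrow> real" where
    "\<And>k l. 0 \<le> m k l" "\<And>k l. m k l \<le> w l"
    "\<And>k l. k < N \<Longrightarrow> l \<in> lab k ` Z \<Longrightarrow> m k l = (\<Sum>q | q \<in> lab (Suc k) ` Z \<and> par q = l. m (Suc k) q)"
    "\<And>k l. 0 < m k l \<Longrightarrow> \<exists>z\<in>B. lab k z = l"
    "content B \<le> ennreal (\<Sum>l\<in>lab 0 ` Z. m 0 l)"
proof
  define m where "m k l = (if k \<le> N \<and> l \<in> lab k ` Z then cap_flow Z B N k l else 0)" for k l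
  note bnd = cap_flow_bounds[OF fin]
  show "0 \<le> m k l" for k l using bnd by (auto simp: m_def)
  show "m k l \<le> w l" for k l
    using bnd cap_le w_nonneg unfolding m_def by (smt (verit))
  show "m k l = (\<Sum>q | q \<in> lab (Suc k) ` Z \<and> par q = l. m (Suc k) q)"
    if "k < N" "l \<in> lab k ` Z" for k l
  proof -
    have "m k l = cap_flow Z B N k l" using that by (auto simp: m_def)
    also have "\<dots> = (\<Sum>q | q \<in> lab (Suc k) ` Z \<and> par q = l. m (Suc k) q)"
      unfolding cap_flow_additive[OF fin that] using that(1) by (intro sum.cong) (auto simp: m_def)
    finally show ?thesis .
  qed
  show "\<exists>z\<in>B. lab k z = l" if "0 < m k l" for k l
  proof -
    have k: "k \<le> N" "l \<in> lab k ` Z" using that by (auto simp: m_def split: if_splits)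
    then have "0 < cap Z B N (N - k) l" using that bnd[OF k, of B] by (auto simp: m_def)
    from cap_pos[OF this] k(1) show ?thesis by simp
  qed
  have "content B \<le> content (\<Union>l\<in>lab 0 ` Z. {z\<in>B. lab 0 z = l})"
    using \<open>B \<subseteq> Z\<close> by (intro content_mono) auto
  also have "\<dots> \<le> (\<Sum>l\<in>lab 0 ` Z. content {z\<in>B. lab 0 z = l})"
    by (rule content_UN_finite[OF fin])
  also have "\<dots> \<le> (\<Sum>l\<in>lab 0 ` Z. ennreal (cap Z B N N l))"
    using content_le_cap[OF fin \<open>B \<subseteq> Z\<close>, of N N] by (intro sum_mono) simp
  also have "\<dots> = ennreal (\<Sum>l\<in>lab 0 ` Z. cap Z B N N l)" by (intro sum_ennreal cap_nonneg)
  also have "\<dots> = ennreal (\<Sum>l\<in>lab 0 ` Z. m 0 l)" by (auto simp: m_def intro!: arg_cong[where f=ennreal] sum.cong)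
  finally show "content B \<le> ennreal (\<Sum>l\<in>lab 0 ` Z. m 0 l)" .
qed

end

section \<open>Weights on infinite trees by compactness\<close>

lemma compact_nested_Int_nonempty:
  fixes S :: "nat \<Rightarrow> 'a::topological_space set"
  assumes "compact X" "\<And>n. closed (S n)" "\<And>n. X \<inter> S n \<noteq> {}" "\<And>n. S (Suc n) \<subseteq> S n"
  shows "X \<inter> (\<Inter>n. S n) \<noteq> {}"
proof (rule compact_imp_fip_image)
  have dec: "S n \<subseteq> S m" if "m \<le> n" for m n
    using that lift_Suc_antimono_le[of S m n] assms(4) by blast
  show "X \<inter> (\<Inter>i\<in>I. S i) \<noteq> {}" if "finite I" for I
  proof -
    have "S (Max (insert 0 I)) \<subseteq> S i" if "i \<in> I" for i
      using that \<open>finite I\<close> by (intro dec Max_ge) auto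
    then have "X \<inter> S (Max (insert 0 I)) \<subseteq> X \<inter> (\<Inter>i\<in>I. S i)" by blast
    then show ?thesis using assms(3) by blast
  qed
qed (use assms in auto)

lemma closed_Collect_ball:
  assumes "\<And>x. x \<in> A \<Longrightarrow> closed {y. P x y}"
  shows "closed {y. \<forall>x\<in>A. P x y}"
  unfolding Collect_ball_eq using assms by (rule closed_INT[OF ballI])

locale fine_label_tree = label_tree lab par w
  for lab :: "nat \<Rightarrow> 'a::metric_space \<Rightarrow> 'l" and par w +
  fixes Z :: "'a set"
  assumes compact_Z: "compact Z" and finite_lab: "finite (lab k ` Z)"
begin

text \<open>Cells such as half-open squares are not closed, so a weight obtained as a limit can
  charge a cell that meets the limit set only in its closure.\<close>

definition closed_cell :: "nat \<Rightarrow> 'l \<Rightarrow> 'a set" where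
  "closed_cell k l = closure {z\<in>Z. lab k z = l}"

definition additive :: "(nat \<Rightarrow> 'l \<Rightarrow> real) \<Rightarrow> nat \<Rightarrow> bool" where
  "additive m k \<longleftrightarrow> (\<forall>l\<in>lab k ` Z. m k l = (\<Sum>q | q \<in> lab (Suc k) ` Z \<and> par q = l. m (Suc k) q))"

text \<open>Weights bounded by \<open>w\<close> form a compact product of intervals. Additivity
  below level \<open>n\<close>, vanishing away from \<open>K n\<close> and total mass at least
  \<open>c\<close> are closed conditions that grow stricter with \<open>n\<close>, and finite trees
  satisfy each stage; a common point of all stages is the required weight.\<close>

lemma limit_frostman:
  assumes K: "\<And>n. closed (K n)" "\<And>n. K n \<subseteq> Z" "\<And>n. K (Suc n) \<subseteq> K n"
    and c: "\<And>n. ennreal c \<le> content (K n)"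
  obtains m :: "nat \<Rightarrow> 'l \<Rightarrow> real" where
    "\<And>k l. 0 \<le> m k l" "\<And>k l. m k l \<le> w l" "\<And>k. additive m k"
    "\<And>k l. 0 < m k l \<Longrightarrow> closed_cell k l \<inter> (\<Inter>n. K n) \<noteq> {}"
    "c \<le> (\<Sum>l\<in>lab 0 ` Z. m 0 l)"
proof -
  define X :: "(nat \<times> 'l \<Rightarrow> real) set" where "X = PiE UNIV (\<lambda>(k, l). {0..w l})"
  define S where "S n = {m :: nat \<times> 'l \<Rightarrow> real.
      (\<forall>k\<in>{..<n}. \<forall>l\<in>lab k ` Z. m (k, l) = (\<Sum>q | q \<in> lab (Suc k) ` Z \<and> par q = l. m (Suc k, q)))
      \<and> (\<forall>x\<in>{(k, l). closed_cell k l \<inter> K n = {}}. m x = 0)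
      \<and> c \<le> (\<Sum>l\<in>lab 0 ` Z. m (0, l))}" for n
  have "X \<inter> (\<Inter>n. S n) \<noteq> {}"
  proof (rule compact_nested_Int_nonempty)
    have "compactin (product_topology (\<lambda>i. euclidean) UNIV) X"
      unfolding X_def compactin_PiE by auto
    then show "compact X" by (simp add: euclidean_product_topology)
    show "closed (S n)" for n
      unfolding S_def
      by (intro closed_Collect_conj closed_Collect_ball closed_Collect_eq closed_Collect_le
            continuous_intros continuous_on_product_coordinates)
    show "X \<inter> S n \<noteq> {}" for n
    proof -
      obtain m :: "nat \<Rightarrow> 'l \<Rightarrow> real" where m: "\<And>k l. 0 \<le> m k l" "\<And>k l. m k l \<le> w l"
        "\<And>k l. k < n \<Longrightarrow> l \<in> lab k ` Z \<Longrightarrow> m k l = (\<Sum>q | q \<in> lab (Suc k) ` Z \<and> par q = l. m (Suc k) q)"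
        "\<And>k l. 0 < m k l \<Longrightarrow> \<exists>z\<in>K n. lab k z = l"
        "content (K n) \<le> ennreal (\<Sum>l\<in>lab 0 ` Z. m 0 l)"
        by (rule finite_frostman[OF finite_lab K(2)]) blast
      have "m k l = 0" if "closed_cell k l \<inter> K n = {}" for k l
      proof (rule ccontr)
        assume "m k l \<noteq> 0"
        then obtain z where z: "z \<in> K n" "lab k z = l" using m(1,4)[of k l] by (auto simp: order.strict_iff_order)
        moreover have "z \<in> closed_cell k l"
          unfolding closed_cell_def using z K(2) by (intro closure_subset[THEN subsetD]) auto
        ultimately show False using that by blast
      qed
      moreover have "c \<le> (\<Sum>l\<in>lab 0 ` Z. m 0 l)"
        using order.trans[OF c m(5)] m(1) by (simp add: ennreal_le_iff sum_nonneg)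
      ultimately have "(\<lambda>(k, l). m k l) \<in> X \<inter> S n" using m(1-3) by (auto simp: X_def S_def)
      then show ?thesis by blast
    qed
    show "S (Suc n) \<subseteq> S n" for n using K(3)[of n] by (fastforce simp: S_def)
  qed
  then obtain f where f: "f \<in> X" "\<And>n. f \<in> S n" by blast
  show thesis
  proof
    show "0 \<le> f (k, l)" "f (k, l) \<le> w l" for k l using f(1) by (auto simp: X_def PiE_iff)
    show "additive (\<lambda>k l. f (k, l)) k" for k
      using f(2)[of "Suc k"] unfolding additive_def S_def by auto
    show "c \<le> (\<Sum>l\<in>lab 0 ` Z. f (0, l))" using f(2)[of 0] by (auto simp: S_def)
    show "closed_cell k l \<inter> (\<Inter>n. K n) \<noteq> {}" if "0 < f (k, l)" for k l
    proof -
      \<comment> \<open>So far the closed cell meets every single \<open>K n\<close>; compactness of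
        \<open>Z\<close> yields one point that lies in all of them.\<close>
      have "Z \<inter> (\<Inter>n. closed_cell k l \<inter> K n) \<noteq> {}"
      proof (rule compact_nested_Int_nonempty[OF compact_Z])
        show "closed (closed_cell k l \<inter> K n)" for n using K(1) by (auto simp: closed_cell_def)
        have "closed_cell k l \<inter> K n \<noteq> {}" for n using f(2)[of n] that by (auto simp: S_def)
        then show "Z \<inter> (closed_cell k l \<inter> K n) \<noteq> {}" for n using K(2) by blast
        show "closed_cell k l \<inter> K (Suc n) \<subseteq> closed_cell k l \<inter> K n" for n using K(3) by blast
      qed
      then show ?thesis by blast
    qed
  qed
qed

end

section \<open>Suslin sets and capacitability\<close>

text \<open>The Suslin operation over closed sets. Its index, a finite sequence of length
  \<open>k\<close>, is encoded by an infinite sequence of which only the first \<open>k\<close>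
  values matter.\<close>

definition suslin_scheme :: "(nat \<Rightarrow> (nat \<Rightarrow> nat) \<Rightarrow> 'a::topological_space set) \<Rightarrow> bool" where
  "suslin_scheme F \<longleftrightarrow>
     (\<forall>k f. closed (F k f)) \<and> (\<forall>k f g. (\<forall>j<k. f j = g j) \<longrightarrow> F k f = F k g)"

definition suslin :: "'a::topological_space set \<Rightarrow> bool" where
  "suslin B \<longleftrightarrow> (\<exists>F. suslin_scheme F \<and> B = {y. \<exists>f. \<forall>k. y \<in> F k f})"

lemma suslin_schemeD:
  assumes "suslin_scheme F"
  shows "closed (F k f)" "(\<And>j. j < k \<Longrightarrow> f j = g j) \<Longrightarrow> F k f = F k g"
  using assms unfolding suslin_scheme_def by blast+

lemma closed_imp_suslin: "closed B \<Longrightarrow> suslin B"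
  unfolding suslin_def suslin_scheme_def by (intro exI[of _ "\<lambda>k f. B"]) auto

lemma suslin_UN:
  assumes "\<And>i::nat. suslin (B i)"
  shows "suslin (\<Union>i. B i)"
proof -
  from assms obtain F where scheme: "\<And>i. suslin_scheme (F i)"
    and B: "\<And>i. B i = {y. \<exists>f. \<forall>k. y \<in> F i k f}"
    unfolding suslin_def by metis
  note F = suslin_schemeD[OF scheme] B
  \<comment> \<open>The first digit names one of the sets and the remaining digits form a code
    there. At level 0 no digit may be used, hence \<open>UNIV\<close>.\<close>
  define G where "G k f = (case k of 0 \<Rightarrow> UNIV | Suc m \<Rightarrow> F (f 0) m (\<lambda>j. f (Suc j)))"
    for k and f :: "nat \<Rightarrow> nat"
  have "closed (G k f)" for k f using F(1) by (auto simp: G_def split: nat.split)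
  moreover have "G k f = G k g" if "\<forall>j<k. f j = g j" for k f g
  proof (cases k)
    case (Suc m)
    then have "f 0 = g 0" "F (f 0) m (\<lambda>j. f (Suc j)) = F (f 0) m (\<lambda>j. g (Suc j))"
      using that by (auto intro!: F(2))
    then show ?thesis by (simp add: G_def Suc)
  qed (simp add: G_def)
  moreover have "(\<Union>i. B i) = {y. \<exists>f. \<forall>k. y \<in> G k f}"
  proof (intro set_eqI iffI)
    fix y assume "y \<in> (\<Union>i. B i)"
    then obtain i f where "\<forall>k. y \<in> F i k f" using F(3) by blast
    then have "\<forall>k. y \<in> G k (case_nat i f)" by (auto simp: G_def split: nat.split)
    then show "y \<in> {y. \<exists>f. \<forall>k. y \<in> G k f}" by blast
  next
    fix y assume "y \<in> {y. \<exists>f. \<forall>k. y \<in> G k f}"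
    then obtain f where "y \<in> G (Suc k) f" for k by blast
    then show "y \<in> (\<Union>i. B i)" using F(3) by (auto simp: G_def)
  qed
  ultimately show ?thesis unfolding suslin_def suslin_scheme_def by (intro exI[of _ G]) auto
qed

text \<open>A single sequence codes countably many ones through \<^const>\<open>prod_encode\<close>.\<close>
lemma suslin_INT:
  assumes "\<And>i::nat. suslin (B i)"
  shows "suslin (\<Inter>i. B i)"
proof -
  from assms obtain F where scheme: "\<And>i. suslin_scheme (F i)"
    and B: "\<And>i. B i = {y. \<exists>f. \<forall>k. y \<in> F i k f}"
    unfolding suslin_def by metis
  note F = suslin_schemeD[OF scheme] B
  \<comment> \<open>The conditions \<open>(i, m)\<close> that can be decided from the first
    \<open>k\<close> digits of the joint code. Each condition enters at some finite
    \<open>k\<close>, so none is lost in the end.\<close>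
  define I where "I k = {(i, m). \<forall>j<m. prod_encode (i, j) < k}" for k
  define G where "G k f = (\<Inter>(i, m)\<in>I k. F i m (\<lambda>j. f (prod_encode (i, j))))"
    for k and f :: "nat \<Rightarrow> nat"
  have "closed (G k f)" for k f using F(1) by (auto simp: G_def)
  moreover have "G k f = G k g" if "\<forall>j<k. f j = g j" for k f g
    unfolding G_def by (intro INF_cong refl) (auto simp: I_def that intro!: F(2))
  moreover have "(\<Inter>i. B i) = {y. \<exists>f. \<forall>k. y \<in> G k f}"
  proof (intro set_eqI iffI)
    fix y assume "y \<in> (\<Inter>i. B i)"
    then have "\<forall>i. \<exists>f. \<forall>k. y \<in> F i k f" using F(3) by blast
    then obtain h where h: "\<And>i k. y \<in> F i k (h i)" by metis
    have "\<forall>k. y \<in> G k (\<lambda>n. h (fst (prod_decode n)) (snd (prod_decode n)))"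
      using h by (auto simp: G_def)
    then show "y \<in> {y. \<exists>f. \<forall>k. y \<in> G k f}" by blast
  next
    fix y assume "y \<in> {y. \<exists>f. \<forall>k. y \<in> G k f}"
    then obtain f where f: "\<And>k. y \<in> G k f" by blast
    have "y \<in> F i m (\<lambda>j. f (prod_encode (i, j)))" for i m
    proof -
      have "prod_encode (i, j) < (\<Sum>j<m. Suc (prod_encode (i, j)))" if "j < m" for j
        using member_le_sum[of j "{..<m}" "\<lambda>j. Suc (prod_encode (i, j))"] that by simp
      then have "(i, m) \<in> I (\<Sum>j<m. Suc (prod_encode (i, j)))" by (simp add: I_def)
      then show ?thesis using f by (auto simp: G_def)
    qed
    then show "y \<in> (\<Inter>i. B i)" using F(3) by blast
  qed
  ultimately show ?thesis unfolding suslin_def suslin_scheme_def by (intro exI[of _ G]) auto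
qed

lemma open_imp_suslin:
  fixes S :: "'a::metric_space set"
  assumes "open S" shows "suslin S"
proof -
  have "fsigma_in euclidean S"
    using assms by (simp add: open_imp_fsigma_in metrizable_space_euclidean)
  then obtain C :: "nat \<Rightarrow> 'a set" where "\<And>n. closed (C n)" "\<Union> (range C) = S"
    unfolding fsigma_in_ascending by auto
  then show ?thesis using suslin_UN[of C] closed_imp_suslin by metis
qed

text \<open>Suslin sets need not have Suslin complements, so the induction carries every set
  together with its complement; the base case then uses that open sets are countable unions of
  closed ones.\<close>

lemma borel_imp_suslin:
  fixes B :: "'a::metric_space set"
  assumes "B \<in> sets borel" shows "suslin B"
proof -
  have "B \<in> sigma_sets UNIV (Collect closed)"
    using assms by (simp add: borel_eq_closed)
  then have "suslin B \<and> suslin (- B)"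
  proof (induction)
    case (Basic A)
    then show ?case by (auto intro: closed_imp_suslin open_imp_suslin)
  next
    case (Compl A)
    then show ?case by (simp add: Compl_eq_Diff_UNIV[symmetric])
  next
    case (Union A)
    then show ?case using suslin_UN[of A] suslin_INT[of "\<lambda>i. - A i"] by simp
  qed (auto intro: closed_imp_suslin)
  then show ?thesis ..
qed

section \<open>Capacitability of Suslin sets\<close>

lemma open_cylinder:
  fixes S :: "(nat \<Rightarrow> nat) set"
  assumes "\<And>f g. (\<And>j. j < k \<Longrightarrow> f j = g j) \<Longrightarrow> f \<in> S \<Longrightarrow> g \<in> S"
  shows "open S"
proof (subst open_subopen, intro ballI)
  fix f assume f: "f \<in> S"
  let ?T = "PiE UNIV (\<lambda>j. if j < k then {f j} else UNIV)"
  have "open ?T" by (rule open_PiE) (auto intro: finite_subset[of _ "{..<k}"] split: if_splits simp: open_discrete)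
  moreover have "?T \<subseteq> S"
  proof
    fix g assume "g \<in> ?T"
    then have "g j \<in> (if j < k then {f j} else UNIV)" for j by (rule PiE_mem) simp
    then have "\<And>j. j < k \<Longrightarrow> g j = f j" by (metis singletonD)
    with f show "g \<in> S" by (intro assms[of f g]) auto
  qed
  ultimately show "\<exists>T. open T \<and> f \<in> T \<and> T \<subseteq> S" by (intro exI[of _ ?T]) auto
qed

context fine_label_tree
begin

text \<open>
  Choquet's argument: bounding the digits of the coding sequence one at a time costs arbitrarily
  little content by the increasing sets lemma, and the sequences with bounded digits are compact.
\<close>
lemma content_inner_regular:
  assumes B: "suslin B" "B \<subseteq> Z" and c: "ennreal c < content B"
  obtains K :: "nat \<Rightarrow> 'a set" where
    "\<And>n. closed (K n)" "\<And>n. K n \<subseteq> Z" "\<And>n. K (Suc n) \<subseteq> K n"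
    "\<And>n. ennreal c \<le> content (K n)" "(\<Inter>n. K n) \<subseteq> B"
proof -
  obtain F :: "nat \<Rightarrow> (nat \<Rightarrow> nat) \<Rightarrow> 'a set" where scheme: "suslin_scheme F"
    and BF: "B = {y. \<exists>f. \<forall>k. y \<in> F k f}"
    using B(1) unfolding suslin_def by blast
  note F = suslin_schemeD[OF scheme] BF
  \<comment> \<open>The list bounds an initial segment of the code and leaves all later digits free,
    so \<open>R bs\<close> is the increasing union of the sets \<open>R (bs @ [b])\<close>.\<close>
  define R where "R bs = {y\<in>B. \<exists>f. (\<forall>j<length bs. f j \<le> bs ! j) \<and> (\<forall>k. y \<in> F k f)}" for bs
  have step: "\<exists>b. ennreal c < content (R (bs @ [b]))" if "ennreal c < content (R bs)" for bs
  proof (rule ccontr)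
    assume "\<nexists>b. ennreal c < content (R (bs @ [b]))"
    then have "content (R (bs @ [b])) \<le> ennreal c" for b by (simp add: not_less)
    moreover have "R (bs @ [b]) \<subseteq> R (bs @ [Suc b])" for b
    proof
      fix y assume "y \<in> R (bs @ [b])"
      then obtain f where f: "y \<in> B" "\<forall>j<Suc (length bs). f j \<le> (bs @ [b]) ! j" "\<forall>k. y \<in> F k f"
        by (auto simp: R_def)
      have "f j \<le> (bs @ [Suc b]) ! j" if "j < Suc (length bs)" for j
        using f(2)[rule_format, OF that] by (cases "j < length bs") (use that in \<open>auto simp: nth_append less_Suc_eq\<close>)
      then show "y \<in> R (bs @ [Suc b])" using f(1,3) unfolding R_def by auto
    qed
    ultimately have "content (\<Union>b. R (bs @ [b])) \<le> ennreal c"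
      by (intro content_incseq_le)
    moreover have "R bs \<subseteq> (\<Union>b. R (bs @ [b]))"
    proof
      fix y assume "y \<in> R bs"
      then obtain f where f: "y \<in> B" "\<forall>j<length bs. f j \<le> bs ! j" "\<forall>k. y \<in> F k f"
        by (auto simp: R_def)
      then have "y \<in> R (bs @ [f (length bs)])"
        by (auto simp: R_def nth_append less_Suc_eq intro!: exI[of _ f])
      then show "y \<in> (\<Union>b. R (bs @ [b]))" by blast
    qed
    ultimately show False using that content_mono by (meson leD order.trans)
  qed
  have "\<exists>s. \<forall>k. (length (s k) = k \<and> ennreal c < content (R (s k))) \<and> (\<exists>b. s (Suc k) = s k @ [b])"
  proof (rule dependent_nat_choice)
    have "R [] = B" using F(3) by (auto simp: R_def)
    then show "\<exists>x. length x = 0 \<and> ennreal c < content (R x)" using c by simp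
    show "\<exists>y. (length y = Suc n \<and> ennreal c < content (R y)) \<and> (\<exists>b. y = x @ [b])"
      if "length x = n \<and> ennreal c < content (R x)" for x n
      using step[of x] that by (metis length_append_singleton)
  qed
  then obtain s where s: "\<And>k. length (s k) = k" "\<And>k. ennreal c < content (R (s k))"
    "\<And>k. \<exists>b. s (Suc k) = s k @ [b]" by blast
  define n where "n j = s (Suc j) ! j" for j
  have s_nth: "s k ! j = n j" if "j < k" for j k
    using that
  proof (induction k)
    case (Suc k)
    then show ?case using s(3)[of k] s(1)[of k] by (auto simp: n_def nth_append less_Suc_eq)
  qed simp
  \<comment> \<open>Membership tests only finitely many stages of the scheme and only digits below
    \<open>k\<close>, of which there are finitely many bounded choices. So \<open>K k\<close> is a
    finite union of closed sets, in contrast to \<open>R (s k)\<close>, which it contains.\<close>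
  define K where "K k = {y\<in>Z. \<exists>f. (\<forall>j<k. f j \<le> n j) \<and> (\<forall>i\<le>k. y \<in> F i f)}" for k
  show thesis
  proof
    show "closed (K k)" for k
    proof -
      have "K k = Z \<inter> (\<Union>f\<in>PiE {..<k} (\<lambda>j. {..n j}). \<Inter>i\<in>{..k}. F i f)" (is "_ = ?K'")
      proof (intro set_eqI iffI)
        fix y assume "y \<in> K k"
        then obtain f where f: "y \<in> Z" "\<forall>j<k. f j \<le> n j" "\<forall>i\<le>k. y \<in> F i f" by (auto simp: K_def)
        have "F i (restrict f {..<k}) = F i f" if "i \<le> k" for i
          using that by (intro F(2)) auto
        with f show "y \<in> ?K'" by (auto intro!: bexI[of _ "restrict f {..<k}"] split: if_splits)
      next
        fix y assume "y \<in> ?K'"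
        then show "y \<in> K k" by (auto simp: K_def PiE_iff)
      qed
      moreover have "closed ?K'"
        using F(1) compact_Z by (intro closed_Int closed_UN closed_INT finite_PiE) (auto simp: compact_imp_closed)
      ultimately show ?thesis by simp
    qed
    show "K k \<subseteq> Z" for k by (auto simp: K_def)
    show "K (Suc k) \<subseteq> K k" for k unfolding K_def by (auto simp: less_Suc_eq le_Suc_eq)
    have "R (s k) \<subseteq> K k" for k
    proof
      fix y assume "y \<in> R (s k)"
      then obtain f where f: "y \<in> B" "\<forall>j<k. f j \<le> s k ! j" "\<forall>i. y \<in> F i f"
        by (auto simp: R_def s(1))
      then have "y \<in> Z" "\<forall>j<k. f j \<le> n j" using B(2) s_nth by auto
      with f(3) show "y \<in> K k" unfolding K_def by blast
    qed
    then show "ennreal c \<le> content (K k)" for k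
      using s(2)[of k] content_mono[of "R (s k)" "K k"] by (meson less_imp_le order.trans)
    show "(\<Inter>k. K k) \<subseteq> B"
    proof
      fix y assume y: "y \<in> (\<Inter>k. K k)"
      define S where "S k = {f. \<forall>i\<le>k. y \<in> F i f}" for k
      \<comment> \<open>A point of every \<open>K k\<close> comes with a code that may depend on
        \<open>k\<close>. The sequences bounded by \<open>n\<close> form a compact space, which
        supplies one code for all \<open>k\<close>.\<close>
      have "PiE UNIV (\<lambda>j. {..n j}) \<inter> (\<Inter>k. S k) \<noteq> {}"
      proof (rule compact_nested_Int_nonempty)
        have "compactin (product_topology (\<lambda>i. euclidean) UNIV) (PiE UNIV (\<lambda>j. {..n j}))"
          unfolding compactin_PiE by (auto intro: finite_imp_compact)
        then show "compact (PiE UNIV (\<lambda>j. {..n j}))" by (simp add: euclidean_product_topology)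
        show "closed (S k)" for k
          unfolding closed_def
        proof (rule open_cylinder)
          fix f g assume *: "\<And>j. j < k \<Longrightarrow> f j = g j" and "f \<in> - S k"
          then show "g \<in> - S k" using F(2)[of _ f g] by (auto simp: S_def)
        qed
        show "PiE UNIV (\<lambda>j. {..n j}) \<inter> S k \<noteq> {}" for k
        proof -
          from y have "y \<in> K k" by blast
          then obtain f where f: "\<forall>j<k. f j \<le> n j" "\<forall>i\<le>k. y \<in> F i f" unfolding K_def by blast
          \<comment> \<open>Digits from \<open>k\<close> on are not constrained by the code at hand;
            the value 0 respects every bound and does not affect the stages up to
            \<open>k\<close>.\<close>
          let ?g = "\<lambda>j. if j < k then f j else 0"
          have "F i ?g = F i f" if "i \<le> k" for i using that by (intro F(2)) auto
          with f have "?g \<in> PiE UNIV (\<lambda>j. {..n j}) \<inter> S k" by (auto simp: S_def)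
          then show ?thesis by blast
        qed
        show "S (Suc k) \<subseteq> S k" for k by (auto simp: S_def)
      qed
      then show "y \<in> B" using F(3) by (auto simp: S_def)
    qed
  qed
qed

lemma suslin_frostman:
  assumes "suslin B" "B \<subseteq> Z" "0 < content B"
  obtains m :: "nat \<Rightarrow> 'l \<Rightarrow> real" and K where
    "\<And>k l. 0 \<le> m k l" "\<And>k l. m k l \<le> w l" "\<And>k. additive m k"
    "\<And>k l. 0 < m k l \<Longrightarrow> closed_cell k l \<inter> K \<noteq> {}" "compact K" "K \<subseteq> B"
    "0 < (\<Sum>l\<in>lab 0 ` Z. m 0 l)"
proof -
  obtain c where c: "0 < c" "c < content B" using dense[OF assms(3)] by blast
  then obtain r where r: "c = ennreal r" "0 < r"
    by (cases c) (auto simp: ennreal_less_zero_iff)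
  obtain K where K: "\<And>n. closed (K n)" "\<And>n. K n \<subseteq> Z" "\<And>n. K (Suc n) \<subseteq> K n"
    "\<And>n. ennreal r \<le> content (K n)" "(\<Inter>n. K n) \<subseteq> B"
    using content_inner_regular[OF assms(1,2), of r] c r by metis
  obtain m where m: "\<And>k l. 0 \<le> m k l" "\<And>k l. m k l \<le> w l" "\<And>k. additive m k"
    "\<And>k l. 0 < m k l \<Longrightarrow> closed_cell k l \<inter> (\<Inter>n. K n) \<noteq> {}"
    "r \<le> (\<Sum>l\<in>lab 0 ` Z. m 0 l)"
    using limit_frostman[of K r] K by metis
  have "compact (\<Inter>n. K n)"
  proof -
    have "compact (Z \<inter> (\<Inter>n. K n))"
      using K(1) by (intro compact_Int_closed compact_Z) auto
    moreover have "Z \<inter> (\<Inter>n. K n) = (\<Inter>n. K n)" using K(2) by auto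
    ultimately show ?thesis by simp
  qed
  then show thesis using that m K(5) r(2) by (metis less_le_trans)
qed

end

section \<open>Dyadic squares and the energy estimate\<close>

context fine_label_tree
begin

lemma funpow_par_lab: "l \<le> k \<Longrightarrow> (par ^^ (k - l)) (lab k z) = lab l z"
proof (induction k rule: dec_induct)
  case (step k)
  then show ?case by (simp add: Suc_diff_le funpow_swap1 par_lab del: funpow.simps) (simp add: funpow_swap1 par_lab)
qed simp

lemma additive_sum:
  assumes add: "\<And>i. l \<le> i \<Longrightarrow> i < k \<Longrightarrow> additive m i" and "l \<le> k" and C: "C \<subseteq> lab l ` Z"
  shows "(\<Sum>a\<in>C. m l a) = (\<Sum>q | q \<in> lab k ` Z \<and> (par ^^ (k - l)) q \<in> C. m k q)"
  using assms(2,1)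
proof (induction k rule: dec_induct)
  case base
  have "{q. q \<in> lab l ` Z \<and> q \<in> C} = C" using C by auto
  then show ?case by simp
next
  case (step k)
  define D where "D = {q. q \<in> lab k ` Z \<and> (par ^^ (k - l)) q \<in> C}"
  define E where "E = {q. q \<in> lab (Suc k) ` Z \<and> (par ^^ (Suc k - l)) q \<in> C}"
  have E_eq: "E = {q. q \<in> lab (Suc k) ` Z \<and> par q \<in> D}"
    using step.hyps by (auto simp: E_def D_def Suc_diff_le funpow_swap1 par_lab)
  have fin: "finite D" "finite E"
    by (auto simp: D_def E_def intro: finite_subset[OF _ finite_lab[of k]] finite_subset[OF _ finite_lab[of "Suc k"]])
  have "(\<Sum>a\<in>C. m l a) = (\<Sum>p\<in>D. m k p)" using step unfolding D_def by simp
  also have "\<dots> = (\<Sum>p\<in>D. \<Sum>q | q \<in> E \<and> par q = p. m (Suc k) q)"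
  proof (rule sum.cong[OF refl])
    fix p assume p: "p \<in> D"
    then have "m k p = (\<Sum>q | q \<in> lab (Suc k) ` Z \<and> par q = p. m (Suc k) q)"
      using step.prems[of k] step.hyps by (auto simp: additive_def D_def)
    also have "{q. q \<in> lab (Suc k) ` Z \<and> par q = p} = {q. q \<in> E \<and> par q = p}"
      using p by (auto simp: E_eq)
    finally show "m k p = (\<Sum>q | q \<in> E \<and> par q = p. m (Suc k) q)" .
  qed
  also have "\<dots> = (\<Sum>q\<in>E. m (Suc k) q)"
    using sum.group[of E D par "m (Suc k)"] fin by (auto simp: E_eq)
  finally show ?case unfolding E_def .
qed

lemma additive_total:
  assumes "\<And>i. i < k \<Longrightarrow> additive m i"
  shows "(\<Sum>q\<in>lab k ` Z. m k q) = (\<Sum>a\<in>lab 0 ` Z. m 0 a)"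
proof -
  have "{q. q \<in> lab k ` Z \<and> (par ^^ (k - 0)) q \<in> lab 0 ` Z} = lab k ` Z"
    using funpow_par_lab[of 0 k] by auto
  then show ?thesis using additive_sum[of 0 k m "lab 0 ` Z"] assms by simp
qed

lemma closed_cell_funpow:
  assumes "l \<le> k" "q \<in> lab k ` Z"
  shows "closed_cell k q \<subseteq> closed_cell l ((par ^^ (k - l)) q)"
  unfolding closed_cell_def using funpow_par_lab[OF assms(1)] by (intro closure_mono) auto

end

text \<open>The level is a component of the label, so that squares of different sizes never share
  one.\<close>

definition dyadic_label :: "nat \<Rightarrow> real \<times> real \<Rightarrow> nat \<times> int \<times> int" where
  "dyadic_label k z = (k, \<lfloor>2 ^ k * fst z\<rfloor>, \<lfloor>2 ^ k * snd z\<rfloor>)"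

definition dyadic_parent :: "nat \<times> int \<times> int \<Rightarrow> nat \<times> int \<times> int" where
  "dyadic_parent l = (fst l - 1, fst (snd l) div 2, snd (snd l) div 2)"

definition dyadic_weight :: "real \<Rightarrow> nat \<times> int \<times> int \<Rightarrow> real" where
  "dyadic_weight u l = 2 powr (- u * real (fst l))"

lemma floor_double_div_2: "\<lfloor>2 * x\<rfloor> div 2 = \<lfloor>x :: real\<rfloor>"
  using floor_divide_real_eq_div[of 2 "2 * x"] by simp

text \<open>The bound on \<open>b\<close> places [0,1] x {0} inside the square. Sets of directions
  \<open>t\<close> are then measured in the same tree as the cone parameters, through the points
  \<open>(t, 0)\<close>.\<close>

locale dyadic_square =
  fixes u b :: real
  assumes u_pos: "0 < u" and b_ge_1: "1 \<le> b"

sublocale dyadic_square \<subseteq> fine_label_tree dyadic_label dyadic_parent "dyadic_weight u" "{0..b} \<times> {0..b}"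
proof
  show "dyadic_parent (dyadic_label (Suc k) z) = dyadic_label k z" for k z
    using floor_double_div_2[of "2 ^ k * fst z"] floor_double_div_2[of "2 ^ k * snd z"]
    by (simp add: dyadic_label_def dyadic_parent_def mult.assoc)
  show "compact ({0..b} \<times> {0..b})" by (intro compact_Times) auto
  show "finite (dyadic_label k ` ({0..b} \<times> {0..b}))" for k
  proof (rule finite_subset)
    show "dyadic_label k ` ({0..b} \<times> {0..b}) \<subseteq> {k} \<times> {0..\<lfloor>2 ^ k * b\<rfloor>} \<times> {0..\<lfloor>2 ^ k * b\<rfloor>}"
      by (auto simp: dyadic_label_def intro!: floor_mono)
  qed auto
qed (auto simp: dyadic_label_def dyadic_weight_def)

lemma scale_abs_diff: "2 ^ k * \<bar>x - y\<bar> = \<bar>2 ^ k * x - 2 ^ k * (y :: real)\<bar>"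
  by (simp add: abs_mult flip: right_diff_distrib)

lemma dist_prod_le: "dist z z' \<le> \<bar>fst z - fst z'\<bar> + \<bar>snd z - snd (z' :: real \<times> real)\<bar>"
  by (cases z; cases z') (auto simp: dist_Pair_Pair dist_real_def intro!: sqrt_sum_squares_le_sum_abs)

lemma floor_range_card: "finite {i::int. x - 2 \<le> of_int i \<and> of_int i \<le> x + 1} \<and>
    card {i::int. x - 2 \<le> of_int i \<and> of_int i \<le> (x::real) + 1} \<le> 4"
proof -
  have sub: "{i::int. x - 2 \<le> of_int i \<and> of_int i \<le> x + 1} \<subseteq> {\<lfloor>x\<rfloor> - 2..\<lfloor>x\<rfloor> + 1}"
    by (auto simp: le_floor_iff floor_le_iff) linarith+
  then show ?thesis using card_mono[OF _ sub] by (auto intro: finite_subset)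
qed

context dyadic_square
begin

abbreviation labels :: "nat \<Rightarrow> (nat \<times> int \<times> int) set" where
  "labels k \<equiv> dyadic_label k ` ({0..b} \<times> {0..b})"

lemma closed_cell_bounds:
  assumes "z \<in> closed_cell k (k', i, j)"
  shows "of_int i \<le> 2 ^ k * fst z" "2 ^ k * fst z \<le> of_int i + 1"
    "of_int j \<le> 2 ^ k * snd z" "2 ^ k * snd z \<le> of_int j + 1"
proof -
  let ?R = "{z. of_int i \<le> 2 ^ k * fst z \<and> 2 ^ k * fst z \<le> of_int i + 1 \<and>
    of_int j \<le> 2 ^ k * snd z \<and> 2 ^ k * snd z \<le> (of_int j + 1 :: real)} :: (real \<times> real) set"
  have "closed ?R"
    by (intro closed_Collect_conj closed_Collect_le continuous_intros)
  then have "closed_cell k (k', i, j) \<subseteq> ?R"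
    unfolding closed_cell_def
    by (intro closure_minimal) (auto simp: dyadic_label_def intro: less_imp_le)
  with assms show "of_int i \<le> 2 ^ k * fst z" "2 ^ k * fst z \<le> of_int i + 1"
    "of_int j \<le> 2 ^ k * snd z" "2 ^ k * snd z \<le> of_int j + 1" by auto
qed

lemma dist_closed_cell:
  assumes "z \<in> closed_cell k l" "z' \<in> closed_cell k l"
  shows "2 ^ k * dist z z' \<le> 2"
proof -
  obtain k' i j where l: "l = (k', i, j)" by (cases l)
  note * = closed_cell_bounds[OF assms(1)[unfolded l]] closed_cell_bounds[OF assms(2)[unfolded l]]
  have "2 ^ k * dist z z' \<le> 2 ^ k * (\<bar>fst z - fst z'\<bar> + \<bar>snd z - snd z'\<bar>)"
    by (intro mult_left_mono dist_prod_le) auto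
  also have "\<dots> = \<bar>2 ^ k * fst z - 2 ^ k * fst z'\<bar> + \<bar>2 ^ k * snd z - 2 ^ k * snd z'\<bar>"
    by (simp only: distrib_left scale_abs_diff)
  also have "\<dots> \<le> 1 + 1" using * by (intro add_mono) linarith+
  finally show ?thesis by simp
qed

text \<open>The ball condition of a Frostman measure. A point within 2^-l of \<open>z0\<close> lies
  in a closed square of level \<open>l\<close> whose index ranges, in each coordinate, over an
  interval of length 3, hence over at most 4 values. The mass is thus that of at most 16
  ancestors.\<close>

lemma near_sum:
  assumes m: "\<And>k l. 0 \<le> m k l" "\<And>k l. m k l \<le> dyadic_weight u l"
    and add: "\<And>i. i < k \<Longrightarrow> additive m i" and "l \<le> k" and P: "P \<subseteq> labels k"
    and z: "\<And>q. q \<in> P \<Longrightarrow> z q \<in> closed_cell k q" "\<And>q. q \<in> P \<Longrightarrow> 2 ^ l * dist (z q) z0 \<le> 1"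
  shows "(\<Sum>q\<in>P. m k q) \<le> 16 * 2 powr (- u * real l)"
proof -
  let ?anc = "\<lambda>q. (dyadic_parent ^^ (k - l)) q"
  define C where "C = ?anc ` P"
  have fin: "finite P" using P finite_lab finite_subset by blast
  have anc_lab: "?anc q \<in> labels l" if "q \<in> labels k" for q
    using that funpow_par_lab[OF \<open>l \<le> k\<close>] by auto
  then have C_sub: "C \<subseteq> labels l" using P unfolding C_def by blast
  let ?X = "{i::int. 2 ^ l * fst z0 - 2 \<le> of_int i \<and> of_int i \<le> 2 ^ l * fst z0 + 1}"
  let ?Y = "{i::int. 2 ^ l * snd z0 - 2 \<le> of_int i \<and> of_int i \<le> 2 ^ l * snd z0 + 1}"
  have "C \<subseteq> {l} \<times> ?X \<times> ?Y"
  proof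
    fix a assume "a \<in> C"
    then obtain q where q: "q \<in> P" "a = ?anc q" by (auto simp: C_def)
    then have "fst a = l" using C_sub \<open>a \<in> C\<close> by (auto simp: dyadic_label_def)
    then obtain i j where a: "a = (l, i, j)" by (cases a) auto
    have "z q \<in> closed_cell l a"
      using z(1)[OF q(1)] closed_cell_funpow[OF \<open>l \<le> k\<close>, of q] P q by blast
    note * = closed_cell_bounds[OF this[unfolded a]]
    have "\<bar>fst (z q) - fst z0\<bar> \<le> dist (z q) z0" "\<bar>snd (z q) - snd z0\<bar> \<le> dist (z q) z0"
      using dist_fst_le[of "z q" z0] dist_snd_le[of "z q" z0] by (auto simp: dist_real_def)
    then have "2 ^ l * \<bar>fst (z q) - fst z0\<bar> \<le> 1" "2 ^ l * \<bar>snd (z q) - snd z0\<bar> \<le> 1"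
      using z(2)[OF q(1)] by (auto intro: order.trans[OF mult_left_mono])
    moreover have "2 ^ l * \<bar>fst (z q) - fst z0\<bar> = \<bar>2 ^ l * fst (z q) - 2 ^ l * fst z0\<bar>"
      "2 ^ l * \<bar>snd (z q) - snd z0\<bar> = \<bar>2 ^ l * snd (z q) - 2 ^ l * snd z0\<bar>"
      by (rule scale_abs_diff)+
    ultimately show "a \<in> {l} \<times> ?X \<times> ?Y" using * unfolding a by auto
  qed
  then have "card C \<le> card ({l} \<times> ?X \<times> ?Y)"
    using floor_range_card by (intro card_mono) auto
  also have "\<dots> \<le> 4 * 4"
    unfolding card_cartesian_product using floor_range_card by (simp add: mult_le_mono[of _ 4 _ 4, simplified])
  finally have card: "card C \<le> 16" by simp
  have "(\<Sum>q\<in>P. m k q) \<le> (\<Sum>q | q \<in> labels k \<and> ?anc q \<in> C. m k q)"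
    using P m finite_lab[of k] by (intro sum_mono2) (auto simp: C_def)
  also have "\<dots> = (\<Sum>a\<in>C. m l a)"
    using add \<open>l \<le> k\<close> C_sub by (intro additive_sum[symmetric]) auto
  also have "\<dots> \<le> (\<Sum>a\<in>C. 2 powr (- u * real l))"
    using C_sub by (intro sum_mono order.trans[OF m(2)]) (auto simp: dyadic_weight_def dyadic_label_def)
  also have "\<dots> \<le> 16 * 2 powr (- u * real l)"
    using card by (simp add: mult_right_mono)
  finally show ?thesis .
qed

definition total_bound :: real where "total_bound = real (card (labels 0))"

lemma total_le:
  assumes "\<And>k l. m k l \<le> dyadic_weight u l" "\<And>i. i < k \<Longrightarrow> additive m i"
  shows "(\<Sum>q\<in>labels k. m k q) \<le> total_bound"
proof -
  have "(\<Sum>q\<in>labels k. m k q) = (\<Sum>q\<in>labels 0. m 0 q)" using assms(2) by (rule additive_total)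
  also have "\<dots> \<le> (\<Sum>q\<in>labels 0. 1)"
    by (intro sum_mono order.trans[OF assms(1)]) (auto simp: dyadic_weight_def dyadic_label_def)
  finally show ?thesis by (simp add: total_bound_def)
qed

definition close_pairs ::
  "(nat \<Rightarrow> nat \<times> int \<times> int \<Rightarrow> real) \<Rightarrow> (nat \<Rightarrow> nat \<times> int \<times> int \<Rightarrow> real \<times> real) \<Rightarrow>
   (real \<times> real \<Rightarrow> real) \<Rightarrow> real \<Rightarrow> nat \<Rightarrow> ((nat \<times> int \<times> int) \<times> (nat \<times> int \<times> int)) set" where
  "close_pairs m z h \<Lambda> k = {(p, q). p \<in> labels k \<and> q \<in> labels k \<and> 0 < m k p \<and> 0 < m k q \<and>
     2 ^ k * \<bar>h (z k p) - h (z k q)\<bar> \<le> \<Lambda>}"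

text \<open>With \<open>z k p\<close> a sample point of the closed cell \<open>p\<close>, this is a
  discrete version of the product measure of the pairs whose images under \<open>h\<close> differ by
  at most \<Lambda> * 2^-k.\<close>

definition correlation ::
  "(nat \<Rightarrow> nat \<times> int \<times> int \<Rightarrow> real) \<Rightarrow> (nat \<Rightarrow> nat \<times> int \<times> int \<Rightarrow> real \<times> real) \<Rightarrow>
   (real \<times> real \<Rightarrow> real) \<Rightarrow> real \<Rightarrow> nat \<Rightarrow> real" where
  "correlation m z h \<Lambda> k = (\<Sum>(p, q)\<in>close_pairs m z h \<Lambda> k. m k p * m k q)"

text \<open>
  Transversality confines the parameters \<open>t\<close> at which a given pair of cells is close to a single
  short interval, whose mass is bounded for a Frostman weight on \<open>S\<close>.
\<close>
lemma energy_bound: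
  fixes m :: "nat \<Rightarrow> nat \<times> int \<times> int \<Rightarrow> real"
  assumes m: "\<And>k l. 0 \<le> m k l" "\<And>k l. m k l \<le> dyadic_weight u l" "\<And>k. additive m k"
    and z: "\<And>k p. 0 < m k p \<Longrightarrow> z k p \<in> closed_cell k p \<inter> K"
    and I: "I \<subseteq> {0..1}"
    and trans: "\<And>t t' y y'. t \<in> I \<Longrightarrow> t' \<in> I \<Longrightarrow> y \<in> K \<Longrightarrow> y' \<in> K \<Longrightarrow>
      \<bar>t - t'\<bar> * dist y y' \<le> C * max \<bar>g t y - g t y'\<bar> \<bar>g t' y - g t' y'\<bar>"
    and C: "0 \<le> C" "0 \<le> \<Lambda>"
  obtains D where "0 \<le> D" "\<And>k S c. S \<subseteq> I \<Longrightarrow> 0 < c \<Longrightarrow>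
      (\<And>t. t \<in> S \<Longrightarrow> c \<le> correlation m z (g t) \<Lambda> k) \<Longrightarrow>
      content (S \<times> {0}) \<le> ennreal (D * (real k + 1) * 2 powr (- u * real k) / c)"
proof -
  \<comment> \<open>The constants of transversality are absorbed into a shift by \<open>a\<close>
    levels, which costs the factor 2 powr (u * a) in \<open>A\<close>.\<close>
  obtain a :: nat where a: "2 * C * \<Lambda> \<le> 2 ^ a"
    using real_arch_pow[of 2 "2 * C * \<Lambda>"] by (auto intro: less_imp_le)
  define A where "A = 16 * 2 powr (u * real a)"
  define D where "D = total_bound * A * (16 + total_bound)"
  have tb: "0 \<le> total_bound" by (simp add: total_bound_def)
  have A: "0 \<le> A" by (simp add: A_def)
  show thesis
  proof
    show "0 \<le> D" using tb A by (simp add: D_def)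
    fix k S c
    assume S: "S \<subseteq> I" and c: "0 < c" and corr: "\<And>t. t \<in> S \<Longrightarrow> c \<le> correlation m z (g t) \<Lambda> k"
    have "S \<times> {0} \<subseteq> {0..b} \<times> {0..b}" using S I b_ge_1 by auto
    \<comment> \<open>A weight of depth \<open>k\<close> for this particular \<open>S\<close>. Its
      total mass dominates the content of \<open>S\<close>, so it remains to bound the mass.\<close>
    then obtain \<nu> where \<nu>:
      "\<And>k l. 0 \<le> \<nu> k l" "\<And>k l. \<nu> k l \<le> dyadic_weight u l"
      "\<And>i l. i < k \<Longrightarrow> l \<in> labels i \<Longrightarrow> \<nu> i l = (\<Sum>q | q \<in> labels (Suc i) \<and> dyadic_parent q = l. \<nu> (Suc i) q)"
      "\<And>k l. 0 < \<nu> k l \<Longrightarrow> \<exists>z\<in>S \<times> {0}. dyadic_label k z = l"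
      "content (S \<times> {0}) \<le> ennreal (\<Sum>l\<in>labels 0. \<nu> 0 l)"
      by (rule finite_frostman[OF finite_lab, of "S \<times> {0}" k]) blast
    have \<nu>_add: "additive \<nu> i" if "i < k" for i using \<nu>(3)[OF that] by (simp add: additive_def)
    define L where "L = {l \<in> labels k. 0 < \<nu> k l}"
    have "\<forall>l\<in>L. \<exists>t\<in>S. dyadic_label k (t, 0) = l" using \<nu>(4) by (fastforce simp: L_def)
    then obtain t where t: "\<And>l. l \<in> L \<Longrightarrow> t l \<in> S" "\<And>l. l \<in> L \<Longrightarrow> dyadic_label k (t l, 0) = l"
      by metis
    have tI: "t l \<in> I" "t l \<in> {0..1}" if "l \<in> L" for l using t(1)[OF that] S I by auto
    have t_cell: "(t l, 0) \<in> closed_cell k l" if "l \<in> L" for l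
      unfolding closed_cell_def using tI[OF that] t(2)[OF that] b_ge_1
      by (intro closure_subset[THEN subsetD]) auto
    have finL: "finite L" using finite_lab by (simp add: L_def)
    define P where "P = {p \<in> labels k. 0 < m k p}"
    have finP: "finite P" using finite_lab by (simp add: P_def)
    have zP: "z k p \<in> closed_cell k p" "z k p \<in> K" if "p \<in> P" for p
      using that z[of k p] by (auto simp: P_def)
    define T where "T p q = {l\<in>L. 2 ^ k * \<bar>g (t l) (z k p) - g (t l) (z k q)\<bar> \<le> \<Lambda>}" for p q
    let ?e = "2 powr (- u * real k)"

    \<comment> \<open>If the sample points of \<open>p\<close> and \<open>q\<close> are more than
      2^-(j+1) apart, transversality puts all parameters of \<open>T p q\<close> within 2^-(k-a-j)
      of each other, and the ball condition applies at level \<open>k - (a + j)\<close>. Once this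
      truncated difference is 0, as for \<open>j = k\<close>, the diameter of [0,1]
      suffices.\<close>
    have T_shell: "(\<Sum>l\<in>T p q. \<nu> k l) \<le> A * 2 powr (u * real j) * ?e"
      if pq: "p \<in> P" "q \<in> P" and "j \<le> k" and far: "j = k \<or> 1 < 2 ^ Suc j * dist (z k p) (z k q)" for p q j
    proof (cases "T p q = {}")
      case False
      then obtain l0 where l0: "l0 \<in> T p q" by blast
      have "(\<Sum>l\<in>T p q. \<nu> k l) \<le> 16 * 2 powr (- u * real (k - (a + j)))"
      proof (rule near_sum[OF \<nu>(1,2) \<nu>_add])
        show "T p q \<subseteq> labels k" by (auto simp: T_def L_def)
        show "(t l, 0) \<in> closed_cell k l" if "l \<in> T p q" for l using that t_cell by (auto simp: T_def)
        show "2 ^ (k - (a + j)) * dist (t l, 0) (t l0, 0) \<le> 1" if l: "l \<in> T p q" for l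
        proof (cases "k \<le> a + j")
          case True
          then show ?thesis using l l0 tI[of l] tI[of l0]
            by (auto simp: T_def dist_Pair_Pair dist_real_def)
        next
          case False
          then have far: "1 < 2 ^ Suc j * dist (z k p) (z k q)" using far by auto
          let ?d = "dist (z k p) (z k q)"
          have "l \<in> L" "l0 \<in> L" using l l0 by (auto simp: T_def)
          then have "\<bar>t l - t l0\<bar> * ?d \<le> C * max \<bar>g (t l) (z k p) - g (t l) (z k q)\<bar> \<bar>g (t l0) (z k p) - g (t l0) (z k q)\<bar>"
            using tI zP pq by (intro trans) blast+
          then have "2 ^ k * (\<bar>t l - t l0\<bar> * ?d) \<le> 2 ^ k * (C * max \<bar>g (t l) (z k p) - g (t l) (z k q)\<bar> \<bar>g (t l0) (z k p) - g (t l0) (z k q)\<bar>)"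
            by (intro mult_left_mono) auto
          also have "\<dots> = C * (2 ^ k * max \<bar>g (t l) (z k p) - g (t l) (z k q)\<bar> \<bar>g (t l0) (z k p) - g (t l0) (z k q)\<bar>)"
            by simp
          also have "\<dots> \<le> C * \<Lambda>"
            using l l0 C by (intro mult_left_mono) (auto simp: T_def max_def)
          finally have *: "2 ^ k * (\<bar>t l - t l0\<bar> * ?d) \<le> C * \<Lambda>" .
          have "2 ^ k * \<bar>t l - t l0\<bar> * 1 \<le> 2 ^ k * \<bar>t l - t l0\<bar> * (2 ^ Suc j * ?d)"
            using far by (intro mult_left_mono) auto
          also have "\<dots> = 2 * 2 ^ j * (2 ^ k * (\<bar>t l - t l0\<bar> * ?d))" by (simp add: mult_ac)
          also have "\<dots> \<le> 2 * 2 ^ j * (C * \<Lambda>)" using * by (intro mult_left_mono) auto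
          also have "\<dots> = 2 ^ j * (2 * C * \<Lambda>)" by simp
          also have "\<dots> \<le> 2 ^ j * 2 ^ a" using a by (intro mult_left_mono) auto
          finally have "2 ^ k * \<bar>t l - t l0\<bar> \<le> 2 ^ (a + j)" by (simp add: power_add mult_ac)
          moreover have "(2::real) ^ k = 2 ^ (a + j) * 2 ^ (k - (a + j))"
            using False by (simp flip: power_add)
          ultimately have "2 ^ (a + j) * (2 ^ (k - (a + j)) * \<bar>t l - t l0\<bar>) \<le> 2 ^ (a + j) * 1"
            by (simp add: mult.assoc)
          then have "2 ^ (k - (a + j)) * \<bar>t l - t l0\<bar> \<le> 1"
            by (rule mult_left_le_imp_le) simp
          then show ?thesis by (simp add: dist_Pair_Pair dist_real_def)
        qed
      qed auto
      also have "\<dots> \<le> 16 * 2 powr (u * real a + u * real j - u * real k)"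
      proof -
        have "real k - real a - real j \<le> real (k - (a + j))" by linarith
        then have "u * (real k - real a - real j) \<le> u * real (k - (a + j))"
          using u_pos by (intro mult_left_mono) auto
        then show ?thesis by (simp add: algebra_simps)
      qed
      also have "\<dots> = A * 2 powr (u * real j) * ?e"
        by (simp add: A_def algebra_simps flip: powr_add)
      finally show ?thesis .
    qed (use A in simp)
    \<comment> \<open>Level 0 admits every pair, so a largest admissible \<open>j\<close> exists.
      Bounding the one relevant term by the sum over all near levels removes the dependence of
      \<open>j\<close> on the pair.\<close>
    define near where "near j p q \<longleftrightarrow> j = 0 \<or> 2 ^ j * dist (z k p) (z k q) \<le> 1" for j p q
    have T_sum: "(\<Sum>l\<in>T p q. \<nu> k l) \<le> (\<Sum>j\<le>k. if near j p q then A * 2 powr (u * real j) * ?e else 0)"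
      if pq: "p \<in> P" "q \<in> P" for p q
    proof -
      define j where "j = (GREATEST j. j \<le> k \<and> near j p q)"
      have j: "j \<le> k \<and> near j p q"
        unfolding j_def by (rule GreatestI_nat[of _ 0 k]) (auto simp: near_def)
      have "j = k \<or> \<not> near (Suc j) p q"
        using Greatest_le_nat[of "\<lambda>j. j \<le> k \<and> near j p q" "Suc j" k] j unfolding j_def[symmetric]
        by auto
      then have "(\<Sum>l\<in>T p q. \<nu> k l) \<le> A * 2 powr (u * real j) * ?e"
        using j pq by (intro T_shell) (auto simp: near_def)
      also have "\<dots> = (if near j p q then A * 2 powr (u * real j) * ?e else 0)" using j by simp
      also have "\<dots> \<le> (\<Sum>j\<le>k. if near j p q then A * 2 powr (u * real j) * ?e else 0)"
        using j A by (intro member_le_sum) auto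
      finally show ?thesis .
    qed
    \<comment> \<open>The constant serves both cases: 16 is the ball condition for positive
      \<open>j\<close>, and \<open>total_bound\<close> handles \<open>j = 0\<close>, where every
      cell is near.\<close>
    have near_m: "(\<Sum>q | q \<in> P \<and> near j p q. m k q) \<le> (16 + total_bound) * 2 powr (- u * real j)"
      if "p \<in> P" "j \<le> k" for p j
    proof (cases "j = 0")
      case True
      have "(\<Sum>q | q \<in> P \<and> near j p q. m k q) \<le> (\<Sum>q\<in>labels k. m k q)"
        using finite_lab m(1) by (intro sum_mono2) (auto simp: P_def)
      also have "\<dots> \<le> total_bound" using m by (intro total_le) auto
      finally show ?thesis using True by simp
    next
      case False
      have "(\<Sum>q | q \<in> P \<and> near j p q. m k q) \<le> 16 * 2 powr (- u * real j)"
        using that False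
        by (intro near_sum[OF m(1,2), where z = "z k" and ?z0.0 = "z k p"])
          (auto simp: m(3) zP P_def near_def dist_commute)
      also have "\<dots> \<le> (16 + total_bound) * 2 powr (- u * real j)"
        using tb by (intro mult_right_mono) auto
      finally show ?thesis .
    qed
    \<comment> \<open>Double counting of triples (t, p, q). After the exchange of sums the growth 2
      powr (u * j) in the mass of parameters cancels against the decay of the mass of near cells, so
      each of the \<open>k + 1\<close> scales contributes equally.\<close>
    have "c * (\<Sum>l\<in>L. \<nu> k l) \<le> (\<Sum>l\<in>L. \<nu> k l * correlation m z (g (t l)) \<Lambda> k)"
      unfolding sum_distrib_left using corr t(1) \<nu>(1)
      by (intro sum_mono) (auto simp: mult.commute[of c] intro!: mult_left_mono)
    also have "\<dots> = (\<Sum>l\<in>L. \<Sum>p\<in>P. \<Sum>q\<in>P. if l \<in> T p q then \<nu> k l * (m k p * m k q) else 0)"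
    proof (rule sum.cong[OF refl])
      fix l assume l: "l \<in> L"
      have "close_pairs m z (g (t l)) \<Lambda> k = {x \<in> P \<times> P. l \<in> T (fst x) (snd x)}"
        using l by (auto simp: close_pairs_def P_def T_def)
      then have "correlation m z (g (t l)) \<Lambda> k = (\<Sum>x\<in>P \<times> P. if l \<in> T (fst x) (snd x) then m k (fst x) * m k (snd x) else 0)"
        using finP by (simp add: correlation_def sum.inter_filter case_prod_unfold)
      also have "\<dots> = (\<Sum>p\<in>P. \<Sum>q\<in>P. if l \<in> T p q then m k p * m k q else 0)"
        by (simp add: sum.cartesian_product case_prod_unfold)
      finally show "\<nu> k l * correlation m z (g (t l)) \<Lambda> k
          = (\<Sum>p\<in>P. \<Sum>q\<in>P. if l \<in> T p q then \<nu> k l * (m k p * m k q) else 0)"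
        by (simp add: sum_distrib_left if_distrib cong: if_cong)
    qed
    also have "\<dots> = (\<Sum>p\<in>P. \<Sum>q\<in>P. \<Sum>l\<in>L. if l \<in> T p q then \<nu> k l * (m k p * m k q) else 0)"
      by (subst sum.swap, rule sum.cong[OF refl], rule sum.swap)
    also have "\<dots> = (\<Sum>p\<in>P. \<Sum>q\<in>P. m k p * m k q * (\<Sum>l\<in>T p q. \<nu> k l))"
    proof (intro sum.cong refl)
      fix p q
      have "{l\<in>L. l \<in> T p q} = T p q" by (auto simp: T_def)
      then show "(\<Sum>l\<in>L. if l \<in> T p q then \<nu> k l * (m k p * m k q) else 0) = m k p * m k q * (\<Sum>l\<in>T p q. \<nu> k l)"
        using finL by (simp add: sum_distrib_left mult_ac flip: sum.inter_filter)
    qed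
    also have "\<dots> \<le> (\<Sum>p\<in>P. \<Sum>q\<in>P. m k p * m k q * (\<Sum>j\<le>k. if near j p q then A * 2 powr (u * real j) * ?e else 0))"
      using T_sum m(1) by (intro sum_mono mult_left_mono) auto
    also have "\<dots> = (\<Sum>p\<in>P. m k p * (\<Sum>j\<le>k. A * 2 powr (u * real j) * ?e * (\<Sum>q | q \<in> P \<and> near j p q. m k q)))"
    proof (intro sum.cong refl)
      fix p
      have "(\<Sum>q\<in>P. m k p * m k q * (\<Sum>j\<le>k. if near j p q then A * 2 powr (u * real j) * ?e else 0))
          = m k p * (\<Sum>q\<in>P. \<Sum>j\<le>k. if near j p q then A * 2 powr (u * real j) * ?e * m k q else 0)"
        unfolding sum_distrib_left by (intro sum.cong refl) (simp add: mult_ac)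
      also have "(\<Sum>q\<in>P. \<Sum>j\<le>k. if near j p q then A * 2 powr (u * real j) * ?e * m k q else 0)
          = (\<Sum>j\<le>k. \<Sum>q\<in>P. if near j p q then A * 2 powr (u * real j) * ?e * m k q else 0)"
        by (rule sum.swap)
      also have "\<dots> = (\<Sum>j\<le>k. A * 2 powr (u * real j) * ?e * (\<Sum>q | q \<in> P \<and> near j p q. m k q))"
        using finP by (auto simp: sum_distrib_left sum.inter_filter intro!: sum.cong)
      finally show "(\<Sum>q\<in>P. m k p * m k q * (\<Sum>j\<le>k. if near j p q then A * 2 powr (u * real j) * ?e else 0))
        = m k p * (\<Sum>j\<le>k. A * 2 powr (u * real j) * ?e * (\<Sum>q | q \<in> P \<and> near j p q. m k q))" .
    qed
    also have "\<dots> \<le> (\<Sum>p\<in>P. m k p * (\<Sum>j\<le>k. A * 2 powr (u * real j) * ?e * ((16 + total_bound) * 2 powr (- u * real j))))"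
      using near_m A m(1) by (intro sum_mono mult_left_mono) auto
    also have "\<dots> = (\<Sum>p\<in>P. m k p * ((real k + 1) * (A * (16 + total_bound) * ?e)))"
    proof -
      have "2 powr (u * real j) * 2 powr (- u * real j) = 1" for j by (simp flip: powr_add)
      moreover have "A * x * ?e * ((16 + total_bound) * y) = A * (16 + total_bound) * ?e * (x * y)" for x y
        by (simp add: mult_ac)
      ultimately have "A * 2 powr (u * real j) * ?e * ((16 + total_bound) * 2 powr (- u * real j)) = A * (16 + total_bound) * ?e" for j
        by (metis mult_1_right)
      then have "(\<Sum>j\<le>k. A * 2 powr (u * real j) * ?e * ((16 + total_bound) * 2 powr (- u * real j)))
          = (\<Sum>j\<le>k. A * (16 + total_bound) * ?e)"
        by (intro sum.cong refl) blast
      then show ?thesis by (simp add: add.commute)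
    qed
    also have "\<dots> = (\<Sum>p\<in>P. m k p) * ((real k + 1) * (A * (16 + total_bound) * ?e))"
      by (simp add: sum_distrib_right)
    also have "\<dots> \<le> total_bound * ((real k + 1) * (A * (16 + total_bound) * ?e))"
    proof (intro mult_right_mono)
      have "(\<Sum>p\<in>P. m k p) \<le> (\<Sum>q\<in>labels k. m k q)"
        using finite_lab m(1) by (intro sum_mono2) (auto simp: P_def)
      also have "\<dots> \<le> total_bound" using m by (intro total_le) auto
      finally show "(\<Sum>p\<in>P. m k p) \<le> total_bound" .
    qed (use A tb in auto)
    finally have "(\<Sum>l\<in>L. \<nu> k l) \<le> D * (real k + 1) * ?e / c"
      using c by (simp add: D_def pos_le_divide_eq mult_ac)
    moreover have "(\<Sum>l\<in>labels 0. \<nu> 0 l) = (\<Sum>l\<in>L. \<nu> k l)"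
    proof -
      have "(\<Sum>l\<in>labels 0. \<nu> 0 l) = (\<Sum>l\<in>labels k. \<nu> k l)"
        using additive_total[of k \<nu>] \<nu>_add by simp
      also have "\<dots> = (\<Sum>l\<in>L. \<nu> k l)"
        using \<nu>(1) finite_lab by (intro sum.mono_neutral_right) (auto simp: L_def order.strict_iff_order)
      finally show ?thesis .
    qed
    ultimately show "content (S \<times> {0}) \<le> ennreal (D * (real k + 1) * ?e / c)"
      using \<nu>(5) by (metis ennreal_leI order.trans)
  qed
qed

end

section \<open>Lower bound for correlations\<close>

lemma hausdorff_premeasure_mono: "A \<subseteq> B \<Longrightarrow> hausdorff_premeasure s \<delta> A \<le> hausdorff_premeasure s \<delta> B"
  unfolding hausdorff_premeasure_def by (intro Inf_superset_mono) blast

lemma hausdorff_measure_null_iff: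
  "hausdorff_measure s A = 0 \<longleftrightarrow> (\<forall>\<delta>>0. hausdorff_premeasure s \<delta> A = 0)"
  unfolding hausdorff_measure_def by (auto simp: SUP_eq_iff bot_ennreal[symmetric])

lemma hausdorff_null_subset: "hausdorff_measure s B = 0 \<Longrightarrow> A \<subseteq> B \<Longrightarrow> hausdorff_measure s A = 0"
  unfolding hausdorff_measure_null_iff using hausdorff_premeasure_mono by (metis le_zero_eq)

lemma hausdorff_premeasure_cover:
  assumes "hausdorff_premeasure s \<delta> A < c"
  obtains U :: "nat \<Rightarrow> 'a::metric_space set" where "A \<subseteq> (\<Union>i. U i)"
    "\<And>i. bounded (U i)" "\<And>i. diameter (U i) \<le> \<delta>" "(\<Sum>i. diam_weight s (U i)) < c"
  using assms unfolding hausdorff_premeasure_def Inf_less_iff by blast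

lemma hausdorff_premeasure_le:
  assumes "A \<subseteq> (\<Union>i. U i)" "\<And>i. bounded (U i)" "\<And>i. diameter (U i) \<le> \<delta>"
  shows "hausdorff_premeasure s \<delta> A \<le> (\<Sum>i. diam_weight s (U i))"
  unfolding hausdorff_premeasure_def using assms by (intro Inf_lower) blast

lemma hausdorff_nullI:
  assumes "\<And>\<delta> e. 0 < \<delta> \<Longrightarrow> 0 < e \<Longrightarrow> \<exists>U :: nat \<Rightarrow> 'a::metric_space set. A \<subseteq> (\<Union>i. U i) \<and>
    (\<forall>i. bounded (U i) \<and> diameter (U i) \<le> \<delta>) \<and> (\<Sum>i. diam_weight s (U i)) \<le> ennreal e"
  shows "hausdorff_measure s A = 0"
  unfolding hausdorff_measure_null_iff
proof (intro allI impI)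
  fix \<delta> :: real assume "0 < \<delta>"
  have *: "hausdorff_premeasure s \<delta> A \<le> ennreal e" if e: "0 < e" for e
  proof -
    from assms[OF \<open>0 < \<delta>\<close> e] obtain U :: "nat \<Rightarrow> 'a set" where U: "A \<subseteq> (\<Union>i. U i)"
      "\<forall>i. bounded (U i) \<and> diameter (U i) \<le> \<delta>" "(\<Sum>i. diam_weight s (U i)) \<le> ennreal e"
      by (elim exE conjE)
    show ?thesis by (rule order.trans[OF hausdorff_premeasure_le U(3)]) (use U in auto)
  qed
  have "hausdorff_premeasure s \<delta> A \<le> 0"
    by (rule ennreal_le_epsilon) (simp add: *)
  then show "hausdorff_premeasure s \<delta> A = 0" by simp
qed

lemma diam_weight_pos: "s \<noteq> 0 \<Longrightarrow> diam_weight s U = ennreal (diameter U powr s)"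
  by (simp add: diam_weight_def)

text \<open>For positive \<open>d\<close> take the largest \<open>k\<close> with 2^k * d \<le> 1;
  then 2^-k < 2 * d. For \<open>d = 0\<close> there is no largest one, and \<open>e\<close> replaces
  the missing bound by a large \<open>k\<close>.\<close>

lemma real_le_power_of_2:
  fixes d e v :: real
  assumes "0 \<le> d" "2 ^ k0 * d \<le> 1" "0 < e" "0 < v"
  shows "\<exists>k\<ge>k0. 2 ^ k * d \<le> 1 \<and> 2 powr (- v * real k) \<le> 2 powr v * d powr v + e"
proof (cases "d = 0")
  case True
  have "((\<lambda>k. (2 powr (- v)) ^ k) \<longlongrightarrow> 0) sequentially"
    using powr_less_mono[of "- v" 0 2] assms by (intro LIMSEQ_power_zero) simp
  then have "\<forall>\<^sub>F k in sequentially. (2 powr (- v)) ^ k < e"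
    using assms(3) by (rule order_tendstoD)
  then obtain n where n: "\<And>k. k \<ge> n \<Longrightarrow> (2 powr (- v)) ^ k < e"
    by (auto simp: eventually_sequentially)
  have "2 powr (- v * real k) = (2 powr (- v)) ^ k" for k
    by (simp add: powr_powr flip: powr_realpow)
  then show ?thesis using n[of "max n k0"] True by (intro exI[of _ "max n k0"]) auto
next
  case False
  then have d: "0 < d" using assms by simp
  obtain n where n: "1 / d < 2 ^ n" using real_arch_pow[of 2 "1 / d"] by auto
  define k where "k = (GREATEST k. 2 ^ k * d \<le> 1)"
  have bound: "j \<le> n" if "2 ^ j * d \<le> 1" for j
  proof (rule ccontr)
    assume "\<not> j \<le> n"
    then have "(2::real) ^ n \<le> 2 ^ j" by (intro power_increasing) auto
    moreover have "2 ^ j \<le> 1 / d" using that d by (simp add: pos_le_divide_eq)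
    ultimately show False using n by linarith
  qed
  have k: "2 ^ k * d \<le> 1"
    unfolding k_def using bound assms(2) by (rule GreatestI_nat[rotated]) auto
  have "k0 \<le> k" unfolding k_def using bound assms(2) by (intro Greatest_le_nat) auto
  have "\<not> 2 ^ Suc k * d \<le> 1"
    using Greatest_le_nat[of "\<lambda>k. 2 ^ k * d \<le> 1" "Suc k" n] bound unfolding k_def[symmetric] by auto
  then have "1 / 2 ^ k < 2 * d" by (simp add: pos_divide_less_eq mult_ac)
  moreover have "2 powr (- real k) = 1 / 2 ^ k" by (simp add: powr_minus powr_realpow divide_inverse)
  ultimately have "(2 powr (- real k)) powr v \<le> (2 * d) powr v"
    using assms by (intro powr_mono2) auto
  then have "2 powr (- v * real k) \<le> 2 powr v * d powr v"
    using d by (simp add: powr_powr powr_mult mult.commute)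
  then show ?thesis using k \<open>k0 \<le> k\<close> assms(3) by (intro exI[of _ k]) auto
qed

text \<open>A cover of total weight below 1 is rounded to powers of two. Rounding costs the factor 2
  powr v, and the errors (1/2)^i, which admit sets of diameter 0, add up to at most 2.\<close>

lemma hausdorff_null_dyadic_cover:
  fixes A :: "'a::metric_space set"
  assumes "hausdorff_measure v A = 0" "0 < v"
  shows "\<exists>(U :: nat \<Rightarrow> 'a set) \<kappa>. A \<subseteq> (\<Union>i. U i) \<and> (\<forall>i. k0 \<le> \<kappa> i) \<and>
    (\<forall>i. \<forall>a\<in>U i. \<forall>b\<in>U i. 2 ^ \<kappa> i * dist a b \<le> 1) \<and>
    (\<forall>n. (\<Sum>i<n. 2 powr (- v * real (\<kappa> i))) \<le> 2 powr v + 2)"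
proof -
  have "hausdorff_premeasure v (1 / 2 ^ k0) A < 1"
    using assms(1) by (simp add: hausdorff_measure_null_iff)
  then obtain U :: "nat \<Rightarrow> 'a set" where U: "A \<subseteq> (\<Union>i. U i)" "\<And>i. bounded (U i)"
    "\<And>i. diameter (U i) \<le> 1 / 2 ^ k0" "(\<Sum>i. diam_weight v (U i)) < 1"
    by (rule hausdorff_premeasure_cover) blast
  have "\<exists>k\<ge>k0. 2 ^ k * diameter (U i) \<le> 1 \<and>
      2 powr (- v * real k) \<le> 2 powr v * diameter (U i) powr v + (1/2) ^ i" for i
    using U(3)[of i] diameter_ge_0[OF U(2)[of i]] assms(2)
    by (intro real_le_power_of_2) (auto simp: pos_le_divide_eq mult.commute)
  then obtain \<kappa> where \<kappa>: "\<And>i. k0 \<le> \<kappa> i" "\<And>i. 2 ^ \<kappa> i * diameter (U i) \<le> 1"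
    "\<And>i. 2 powr (- v * real (\<kappa> i)) \<le> 2 powr v * diameter (U i) powr v + (1/2) ^ i"
    by metis
  show ?thesis
  proof (intro exI conjI allI ballI)
    show "2 ^ \<kappa> i * dist a b \<le> 1" if "a \<in> U i" "b \<in> U i" for i a b
    proof -
      have "2 ^ \<kappa> i * dist a b \<le> 2 ^ \<kappa> i * diameter (U i)"
        using diameter_bounded_bound[OF U(2) that] by (intro mult_left_mono) auto
      then show ?thesis using \<kappa>(2)[of i] by linarith
    qed
    fix n
    have "ennreal (\<Sum>i<n. diameter (U i) powr v) = (\<Sum>i<n. diam_weight v (U i))"
      using assms(2) by (simp add: diam_weight_pos)
    also have "\<dots> \<le> (\<Sum>i. diam_weight v (U i))" by (intro sum_le_suminf) auto
    also have "\<dots> \<le> ennreal 1" using U(4) by simp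
    finally have 1: "(\<Sum>i<n. diameter (U i) powr v) \<le> 1" by (subst (asm) ennreal_le_iff) auto
    have 2: "(\<Sum>i<n. (1/2::real) ^ i) \<le> 2"
    proof -
      have "(\<Sum>i<n. (1/2::real) ^ i) = 2 * (1 - (1/2) ^ n)"
        unfolding sum_gp_strict by simp
      then show ?thesis by simp
    qed
    have "(\<Sum>i<n. 2 powr (- v * real (\<kappa> i))) \<le> 2 powr v * (\<Sum>i<n. diameter (U i) powr v) + (\<Sum>i<n. (1/2) ^ i)"
      unfolding sum_distrib_left sum.distrib[symmetric] by (intro sum_mono \<kappa>(3))
    also have "\<dots> \<le> 2 powr v * 1 + 2" using 1 2 by (intro add_mono mult_left_mono) auto
    finally show "(\<Sum>i<n. 2 powr (- v * real (\<kappa> i))) \<le> 2 powr v + 2" by simp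
  qed (use U \<kappa> in auto)
qed

lemma le_half_plus_square:
  fixes x w :: real
  assumes "0 < w"
  shows "x \<le> w / 2 + x\<^sup>2 / (2 * w)"
proof -
  have "2 * w * x \<le> w\<^sup>2 + x\<^sup>2" using sum_squares_bound[of w x] by simp
  then have "2 * w * x / (2 * w) \<le> (w\<^sup>2 + x\<^sup>2) / (2 * w)"
    using assms by (intro divide_right_mono) auto
  then show ?thesis using assms by (simp add: add_divide_distrib power2_eq_square)
qed

context dyadic_square
begin

text \<open>
  An image of measure zero has covers by few short intervals. At some scale these carry
  so much mass that, by AM-GM, many pairs of cells have close images.
\<close>
lemma correlation_lower_bound:
  fixes m :: "nat \<Rightarrow> nat \<times> int \<times> int \<Rightarrow> real"
  assumes m: "\<And>k l. 0 \<le> m k l" "\<And>k. additive m k" "0 < (\<Sum>l\<in>labels 0. m 0 l)"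
    and z: "\<And>k p. 0 < m k p \<Longrightarrow> z k p \<in> closed_cell k p \<inter> K"
    and K: "compact K" "0 < v" "v < \<beta>" and Lip_nonneg: "0 \<le> Lip"
  obtains c where "0 < c" "\<And>h k0. (\<And>y y'. y \<in> K \<Longrightarrow> y' \<in> K \<Longrightarrow> \<bar>h y - h y'\<bar> \<le> Lip * dist y y') \<Longrightarrow>
      hausdorff_measure v (h ` K) = 0 \<Longrightarrow>
      \<exists>k\<ge>k0. c * 2 powr (- \<beta> * real k) \<le> correlation m z h (4 * Lip + 3) k"
proof -
  \<comment> \<open>In the final estimate \<open>a = M / C\<close> makes the linear terms of AM-GM
    add up to at most \<open>M / 2\<close>, and \<open>c\<close> makes the quadratic ones at most
    \<open>M / 4\<close>, which contradicts total mass \<open>M\<close>. The ratio \<rho> is below 1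
    since v < \<beta>, so the sum over scales is at most \<open>S\<close>.\<close>
  define M where "M = (\<Sum>l\<in>labels 0. m 0 l)"
  define C where "C = 2 powr v + (2::real)"
  define \<rho> where "\<rho> = 2 powr (v - \<beta>)"
  define S where "S = 1 / (1 - \<rho>)"
  define a where "a = M / C"
  define c where "c = a * M / (2 * S)"
  have \<rho>: "0 < \<rho>" "\<rho> < 1" using powr_less_mono[of "v - \<beta>" 0 2] K by (auto simp: \<rho>_def)
  have pos: "0 < M" "0 < C" "0 < S" "0 < a" "0 < c"
    using m(3) \<rho> by (auto simp: M_def C_def S_def a_def c_def add_pos_pos)
  have geometric: "(\<Sum>k\<in>F. \<rho> ^ k) \<le> S" if "finite F" for F
    using sum_le_suminf[OF summable_geometric that, of \<rho>] suminf_geometric[of \<rho>] \<rho>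
    by (simp add: S_def)
  show thesis
  proof
    show "0 < c" by fact
    fix h k0
    assume Lip: "\<And>y y'. y \<in> K \<Longrightarrow> y' \<in> K \<Longrightarrow> \<bar>h y - h y'\<bar> \<le> Lip * dist y y'"
      and null: "hausdorff_measure v (h ` K) = 0"
    show "\<exists>k\<ge>k0. c * 2 powr (- \<beta> * real k) \<le> correlation m z h (4 * Lip + 3) k"
    proof (rule ccontr)
      assume "\<not> ?thesis"
      then have small: "correlation m z h (4 * Lip + 3) k < c * 2 powr (- \<beta> * real k)" if "k0 \<le> k" for k
        using that by force
      from hausdorff_null_dyadic_cover[OF null \<open>0 < v\<close>, of k0] obtain U and \<kappa> :: "nat \<Rightarrow> nat" where *:
        "h ` K \<subseteq> (\<Union>i. U i)" "\<forall>i. k0 \<le> \<kappa> i"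
        "\<forall>i. \<forall>a\<in>U i. \<forall>b\<in>U i. 2 ^ \<kappa> i * dist a b \<le> 1"
        "\<forall>n. (\<Sum>i<n. 2 powr (- v * real (\<kappa> i))) \<le> 2 powr v + 2"
        by (elim exE conjE)
      note U = *(1) *(2)[rule_format] *(3)[rule_format] *(4)[rule_format]
      \<comment> \<open>Open enlargements allow a finite subcover of the compact image; each still
        has diameter at most 3 in units of 2^-(\<kappa> i).\<close>
      define V where "V i = (\<Union>a\<in>U i. ball a (1 / 2 ^ \<kappa> i))" for i
      have V_diam: "2 ^ \<kappa> i * \<bar>x - y\<bar> \<le> 3" if xy: "x \<in> V i" "y \<in> V i" for i x y
      proof -
        obtain a b where ab: "a \<in> U i" "b \<in> U i" "dist a x < 1 / 2 ^ \<kappa> i" "dist b y < 1 / 2 ^ \<kappa> i"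
          using xy by (auto simp: V_def)
        have "\<bar>x - y\<bar> \<le> dist a x + dist a b + dist b y" by (auto simp: dist_real_def)
        then have "2 ^ \<kappa> i * \<bar>x - y\<bar> \<le> 2 ^ \<kappa> i * dist a x + 2 ^ \<kappa> i * dist a b + 2 ^ \<kappa> i * dist b y"
          by (simp flip: distrib_left)
        also have "\<dots> \<le> 1 + 1 + 1" using ab U(3)[OF ab(1,2)]
          by (intro add_mono) (auto simp: pos_less_divide_eq mult.commute intro: less_imp_le)
        finally show ?thesis by simp
      qed
      have compact: "compact (h ` K)"
      proof (rule compact_continuous_image[OF _ K(1)])
        show "continuous_on K h"
          by (rule lipschitz_on_continuous_on[of Lip], rule lipschitz_onI)
            (auto simp: dist_real_def Lip Lip_nonneg)
      qed
      have cover: "h ` K \<subseteq> (\<Union>i\<in>UNIV. V i)"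
      proof
        fix x assume "x \<in> h ` K"
        then obtain i where "x \<in> U i" using U(1) by blast
        then have "x \<in> V i" by (auto simp: V_def intro!: bexI[of _ x])
        then show "x \<in> (\<Union>i\<in>UNIV. V i)" by blast
      qed
      have "open (V i)" for i by (auto simp: V_def)
      then obtain J where J: "finite J" "h ` K \<subseteq> (\<Union>i\<in>J. V i)"
        using compactE_image[OF compact _ cover] by metis
      from J(1) obtain n where "J \<subseteq> {..<n}" unfolding finite_nat_iff_bounded ..
      then have "(\<Union>i\<in>J. V i) \<subseteq> (\<Union>i<n. V i)" by (rule UN_mono) simp
      with J(2) have n: "h ` K \<subseteq> (\<Union>i<n. V i)" by (rule order.trans)
      \<comment> \<open>A common level at least as fine as all scales of the finite cover. By
        additivity the masses of coarser cells can be compared there.\<close>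
      define N where "N = (\<Sum>i<n. \<kappa> i)"
      have \<kappa>_le: "\<kappa> i \<le> N" if "i < n" for i
        unfolding N_def using that by (intro member_le_sum) auto
      define G where "G i = {p \<in> labels (\<kappa> i). 0 < m (\<kappa> i) p \<and> (\<exists>y\<in>closed_cell (\<kappa> i) p \<inter> K. h y \<in> V i)}" for i
      \<comment> \<open>Among indices of the same scale a cell is kept only at its first occurrence.
        The squares \<open>G' i \<times> G' i\<close> of one scale are then disjoint, and their
        weights add up within a single correlation.\<close>
      define G' where "G' i = {p \<in> G i. \<forall>j<i. \<kappa> j = \<kappa> i \<longrightarrow> p \<notin> G j}" for i
      define X where "X i = (\<Sum>p\<in>G' i. m (\<kappa> i) p)" for i
      let ?anc = "\<lambda>k p. (dyadic_parent ^^ (N - k)) p"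
      \<comment> \<open>A cell of level \<open>N\<close> with positive mass has its sample point in
        \<open>K\<close>, and the image of this point lies in some \<open>V i\<close>. The ancestor
        of level \<open>\<kappa> i\<close> is in \<open>G i\<close>, hence in \<open>G' j\<close>
        for the first index \<open>j\<close> of that scale that has it.\<close>
      have mass: "M \<le> (\<Sum>i<n. X i)"
      proof -
        have "M = (\<Sum>p\<in>labels N. m N p)" using additive_total[of N m] m(2) by (simp add: M_def)
        also have "\<dots> \<le> (\<Sum>p\<in>labels N. \<Sum>i<n. if ?anc (\<kappa> i) p \<in> G' i then m N p else 0)"
        proof (rule sum_mono)
          fix p assume p: "p \<in> labels N"
          show "m N p \<le> (\<Sum>i<n. if ?anc (\<kappa> i) p \<in> G' i then m N p else 0)"
          proof (cases "0 < m N p")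
            case True
            obtain y where y: "y \<in> closed_cell N p" "y \<in> K" using z[OF True] by blast
            then obtain i where i: "i < n" "h y \<in> V i" using n by blast
            have anc: "?anc k p \<in> labels k" "0 < m k (?anc k p)" "y \<in> closed_cell k (?anc k p)" if "k \<le> N" for k
            proof -
              show lab: "?anc k p \<in> labels k" using p funpow_par_lab[OF that] by auto
              show "y \<in> closed_cell k (?anc k p)" using closed_cell_funpow[OF that p] y by blast
              have "m N p \<le> (\<Sum>q | q \<in> labels N \<and> ?anc k q \<in> {?anc k p}. m N q)"
                using m(1) finite_lab p by (intro member_le_sum) auto
              also have "\<dots> = m k (?anc k p)"
                using additive_sum[of k N m "{?anc k p}"] m(2) that lab by simp
              finally show "0 < m k (?anc k p)" using True by simp
            qed
            define P where "P j \<longleftrightarrow> \<kappa> j = \<kappa> i \<and> ?anc (\<kappa> i) p \<in> G j" for j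
            have "P i" using anc[OF \<kappa>_le[OF i(1)]] i(2) y(2) by (auto simp: P_def G_def)
            define j where "j = (LEAST j. P j)"
            have j: "P j" "j \<le> i" "\<And>j'. j' < j \<Longrightarrow> \<not> P j'"
              unfolding j_def using \<open>P i\<close> by (auto intro: LeastI Least_le dest: not_less_Least)
            then have "?anc (\<kappa> j) p \<in> G' j" by (auto simp: P_def G'_def)
            then have "m N p = (if ?anc (\<kappa> j) p \<in> G' j then m N p else 0)" by simp
            also have "\<dots> \<le> (\<Sum>i<n. if ?anc (\<kappa> i) p \<in> G' i then m N p else 0)"
              using j(2) i(1) m(1) by (intro member_le_sum) auto
            finally show ?thesis .
          next
            case False
            then show ?thesis using m(1) by (intro order.trans[OF _ sum_nonneg]) (auto simp: not_less)
          qed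
        qed
        also have "\<dots> = (\<Sum>i<n. \<Sum>p\<in>labels N. if ?anc (\<kappa> i) p \<in> G' i then m N p else 0)"
          by (rule sum.swap)
        also have "\<dots> = (\<Sum>i<n. X i)"
        proof (intro sum.cong refl)
          fix i assume "i \<in> {..<n}"
          then have "X i = (\<Sum>q | q \<in> labels N \<and> ?anc (\<kappa> i) q \<in> G' i. m N q)"
            unfolding X_def using \<kappa>_le m(2) by (intro additive_sum) (auto simp: G'_def G_def)
          then show "(\<Sum>p\<in>labels N. if ?anc (\<kappa> i) p \<in> G' i then m N p else 0) = X i"
            using finite_lab by (simp add: sum.inter_filter)
        qed
        finally show ?thesis .
      qed
      \<comment> \<open>In units of 2^-k a closed cell has diameter at most 2 and \<open>V i\<close>
        at most 3. Passing from a sample point to a point with image in \<open>V i\<close> costs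
        \<open>2 * Lip\<close> on either side, whence \<open>4 * Lip + 3\<close>.\<close>
      have squares: "(\<Sum>i | i < n \<and> \<kappa> i = k. (X i)\<^sup>2) \<le> correlation m z h (4 * Lip + 3) k" for k
      proof -
        let ?I = "{i. i < n \<and> \<kappa> i = k}"
        have finG: "finite (G' i)" for i using finite_lab by (auto simp: G'_def G_def)
        have "(\<Sum>i\<in>?I. (X i)\<^sup>2) = (\<Sum>i\<in>?I. \<Sum>(p, q)\<in>G' i \<times> G' i. m k p * m k q)"
          by (intro sum.cong refl) (auto simp: X_def power2_eq_square sum_product sum.cartesian_product)
        also have "\<dots> = (\<Sum>(p, q)\<in>(\<Union>i\<in>?I. G' i \<times> G' i). m k p * m k q)"
        proof (rule sum.UNION_disjoint[symmetric])
          have "G' i \<inter> G' j = {}" if "i < j" "\<kappa> i = k" "\<kappa> j = k" for i j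
            using that by (auto simp: G'_def)
          then have "G' i \<inter> G' j = {}" if "i \<noteq> j" "\<kappa> i = k" "\<kappa> j = k" for i j
            using that by (cases i j rule: linorder_cases) (auto simp: Int_commute)
          then show "\<forall>i\<in>?I. \<forall>j\<in>?I. i \<noteq> j \<longrightarrow> (G' i \<times> G' i) \<inter> (G' j \<times> G' j) = {}"
            by (auto simp: Times_Int_Times)
        qed (use finG in auto)
        also have "\<dots> \<le> correlation m z h (4 * Lip + 3) k"
          unfolding correlation_def
        proof (rule sum_mono2)
          have "close_pairs m z h (4 * Lip + 3) k \<subseteq> labels k \<times> labels k" by (auto simp: close_pairs_def)
          then show "finite (close_pairs m z h (4 * Lip + 3) k)" using finite_lab finite_subset by blast
          show "(\<Union>i\<in>?I. G' i \<times> G' i) \<subseteq> close_pairs m z h (4 * Lip + 3) k"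
          proof safe
            fix i p q assume i: "i < n" "k = \<kappa> i" and pq: "p \<in> G' i" "q \<in> G' i"
            have near: "\<exists>y. h y \<in> V i \<and> 2 ^ \<kappa> i * \<bar>h (z (\<kappa> i) p) - h y\<bar> \<le> 2 * Lip" if p: "p \<in> G i" for p
            proof -
              obtain y where y: "y \<in> closed_cell (\<kappa> i) p" "y \<in> K" "h y \<in> V i"
                using p by (auto simp: G_def)
              have zp: "z (\<kappa> i) p \<in> closed_cell (\<kappa> i) p" "z (\<kappa> i) p \<in> K" using z p by (auto simp: G_def)
              let ?d = "dist (z (\<kappa> i) p) y"
              have *: "\<bar>h (z (\<kappa> i) p) - h y\<bar> \<le> Lip * ?d" using Lip y zp by blast
              have "2 ^ \<kappa> i * \<bar>h (z (\<kappa> i) p) - h y\<bar> \<le> Lip * (2 ^ \<kappa> i * ?d)"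
                using mult_left_mono[OF *, of "2 ^ \<kappa> i"] by (simp add: mult_ac)
              also have "\<dots> \<le> 2 * Lip"
                using mult_left_mono[OF dist_closed_cell[OF zp(1) y(1)] Lip_nonneg] by simp
              finally show ?thesis using y(3) by blast
            qed
            obtain y y' where y: "h y \<in> V i" "2 ^ \<kappa> i * \<bar>h (z (\<kappa> i) p) - h y\<bar> \<le> 2 * Lip"
              "h y' \<in> V i" "2 ^ \<kappa> i * \<bar>h (z (\<kappa> i) q) - h y'\<bar> \<le> 2 * Lip"
              using near pq by (metis (no_types, lifting) G'_def mem_Collect_eq)
            have "\<bar>h (z (\<kappa> i) p) - h (z (\<kappa> i) q)\<bar>
                \<le> \<bar>h (z (\<kappa> i) p) - h y\<bar> + \<bar>h y - h y'\<bar> + \<bar>h (z (\<kappa> i) q) - h y'\<bar>" by linarith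
            then have "2 ^ \<kappa> i * \<bar>h (z (\<kappa> i) p) - h (z (\<kappa> i) q)\<bar>
                \<le> 2 ^ \<kappa> i * \<bar>h (z (\<kappa> i) p) - h y\<bar> + 2 ^ \<kappa> i * \<bar>h y - h y'\<bar> + 2 ^ \<kappa> i * \<bar>h (z (\<kappa> i) q) - h y'\<bar>"
              by (simp flip: distrib_left)
            also have "\<dots> \<le> 2 * Lip + 3 + 2 * Lip"
              using y V_diam by (intro add_mono) auto
            finally show "(p, q) \<in> close_pairs m z h (4 * Lip + 3) (\<kappa> i)"
              using pq by (auto simp: close_pairs_def G'_def G_def)
          qed
          show "0 \<le> (case x of (p, q) \<Rightarrow> m k p * m k q)" for x using m(1) by (auto split: prod.split)
        qed
        finally show ?thesis .
      qed
      have AM_GM: "X i \<le> a * 2 powr (- v * real (\<kappa> i)) / 2 + (X i)\<^sup>2 * 2 powr (v * real (\<kappa> i)) / (2 * a)" for i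
      proof -
        let ?w = "a * 2 powr (- v * real (\<kappa> i))"
        have w: "0 < ?w" using pos by simp
        have "X i \<le> ?w / 2 + (X i)\<^sup>2 / (2 * ?w)" using w by (rule le_half_plus_square)
        also have "(X i)\<^sup>2 / (2 * ?w) = (X i)\<^sup>2 * 2 powr (v * real (\<kappa> i)) / (2 * a)"
          by (simp add: powr_minus field_simps)
        finally show ?thesis by simp
      qed
      have "M \<le> (\<Sum>i<n. a * 2 powr (- v * real (\<kappa> i)) / 2 + (X i)\<^sup>2 * 2 powr (v * real (\<kappa> i)) / (2 * a))"
        using mass AM_GM by (meson order.trans sum_mono)
      also have "\<dots> = a / 2 * (\<Sum>i<n. 2 powr (- v * real (\<kappa> i))) + (\<Sum>i<n. (X i)\<^sup>2 * 2 powr (v * real (\<kappa> i)) / (2 * a))"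
        by (simp add: sum.distrib sum_distrib_left)
      also have "a / 2 * (\<Sum>i<n. 2 powr (- v * real (\<kappa> i))) \<le> a / 2 * C"
        using U(4)[of n] pos unfolding C_def by (intro mult_left_mono) auto
      also have "a / 2 * C = M / 2" using pos by (simp add: a_def)
      also have "(\<Sum>i<n. (X i)\<^sup>2 * 2 powr (v * real (\<kappa> i)) / (2 * a))
          = (\<Sum>k\<in>\<kappa> ` {..<n}. \<Sum>i | i < n \<and> \<kappa> i = k. (X i)\<^sup>2 * 2 powr (v * real (\<kappa> i)) / (2 * a))"
        using sum.group[of "{..<n}" "\<kappa> ` {..<n}" \<kappa> "\<lambda>i. (X i)\<^sup>2 * 2 powr (v * real (\<kappa> i)) / (2 * a)"] by simp
      also have "\<dots> = (\<Sum>k\<in>\<kappa> ` {..<n}. 2 powr (v * real k) / (2 * a) * (\<Sum>i | i < n \<and> \<kappa> i = k. (X i)\<^sup>2))"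
        unfolding sum_distrib_left by (intro sum.cong refl) auto
      also have "\<dots> \<le> (\<Sum>k\<in>\<kappa> ` {..<n}. 2 powr (v * real k) / (2 * a) * (c * 2 powr (- \<beta> * real k)))"
      proof (intro sum_mono mult_left_mono)
        fix k assume "k \<in> \<kappa> ` {..<n}"
        then have "k0 \<le> k" using U(2) by auto
        then show "(\<Sum>i | i < n \<and> \<kappa> i = k. (X i)\<^sup>2) \<le> c * 2 powr (- \<beta> * real k)"
          using squares[of k] small[of k] by linarith
      qed (use pos in auto)
      also have "\<dots> = (\<Sum>k\<in>\<kappa> ` {..<n}. c / (2 * a) * \<rho> ^ k)"
      proof (intro sum.cong refl)
        fix k
        have "2 powr (v * real k) * 2 powr (- \<beta> * real k) = \<rho> ^ k"
          by (simp add: \<rho>_def powr_powr algebra_simps flip: powr_add powr_realpow)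
        then show "2 powr (v * real k) / (2 * a) * (c * 2 powr (- \<beta> * real k)) = c / (2 * a) * \<rho> ^ k"
          by (metis (no_types, lifting) mult.commute mult.left_commute times_divide_eq_left)
      qed
      also have "\<dots> = c / (2 * a) * (\<Sum>k\<in>\<kappa> ` {..<n}. \<rho> ^ k)" by (simp add: sum_distrib_left)
      also have "\<dots> \<le> c / (2 * a) * S" using geometric pos by (intro mult_left_mono) auto
      also have "c / (2 * a) * S = M / 4" using pos by (simp add: c_def)
      finally show False using pos by simp
    qed
  qed
qed

end

section \<open>Hausdorff null sets and the exceptional set\<close>

lemma diameter_le_dist:
  assumes "0 \<le> \<delta>" "\<And>x y. x \<in> S \<Longrightarrow> y \<in> S \<Longrightarrow> dist x y \<le> \<delta>"
  shows "diameter S \<le> (\<delta> :: real)"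
  using assms by (auto simp: diameter_def intro!: cSUP_least)

lemma hausdorff_null_cover:
  assumes "hausdorff_measure s A = 0" "0 < \<delta>" "0 < e"
  shows "\<exists>U :: nat \<Rightarrow> 'a::metric_space set. A \<subseteq> (\<Union>i. U i) \<and>
    (\<forall>i. bounded (U i) \<and> diameter (U i) \<le> \<delta>) \<and> (\<Sum>i. diam_weight s (U i)) \<le> ennreal e"
proof -
  have "hausdorff_premeasure s \<delta> A < ennreal e"
    using assms by (simp add: hausdorff_measure_null_iff)
  then obtain U :: "nat \<Rightarrow> 'a set" where "A \<subseteq> (\<Union>i. U i)"
    "\<And>i. bounded (U i)" "\<And>i. diameter (U i) \<le> \<delta>" "(\<Sum>i. diam_weight s (U i)) < ennreal e"
    by (rule hausdorff_premeasure_cover) blast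
  then show ?thesis by (intro exI[of _ U]) auto
qed

lemma hausdorff_null_UN:
  fixes A :: "nat \<Rightarrow> 'a::metric_space set"
  assumes "\<And>n. hausdorff_measure s (A n) = 0"
  shows "hausdorff_measure s (\<Union>n. A n) = 0"
proof (rule hausdorff_nullI)
  fix \<delta> e :: real assume \<delta>: "0 < \<delta>" and e: "0 < e"
  have "\<forall>n. \<exists>U :: nat \<Rightarrow> 'a set. A n \<subseteq> (\<Union>i. U i) \<and> (\<forall>i. bounded (U i) \<and> diameter (U i) \<le> \<delta>) \<and>
      (\<Sum>i. diam_weight s (U i)) \<le> ennreal (e * (1/2) ^ Suc n)"
    using hausdorff_null_cover[OF assms \<delta>] e by simp
  from choice[OF this] obtain U :: "nat \<Rightarrow> nat \<Rightarrow> 'a set" where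
    *: "\<forall>n. A n \<subseteq> (\<Union>i. U n i) \<and> (\<forall>i. bounded (U n i) \<and> diameter (U n i) \<le> \<delta>) \<and>
      (\<Sum>i. diam_weight s (U n i)) \<le> ennreal (e * (1/2) ^ Suc n)" ..
  have U: "A n \<subseteq> (\<Union>i. U n i)" "bounded (U n i)" "diameter (U n i) \<le> \<delta>"
    "(\<Sum>i. diam_weight s (U n i)) \<le> ennreal (e * (1/2) ^ Suc n)" for n i
    using *[THEN spec, of n] by iprover+
  let ?V = "\<lambda>i. case prod_decode i of (n, j) \<Rightarrow> U n j"
  have "(\<Union>n. A n) \<subseteq> (\<Union>i. ?V i)"
  proof
    fix x assume "x \<in> (\<Union>n. A n)"
    then obtain n j where "x \<in> U n j" using U(1) by blast
    then have "x \<in> ?V (prod_encode (n, j))" by simp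
    then show "x \<in> (\<Union>i. ?V i)" by (rule UN_I[OF UNIV_I])
  qed
  moreover have "bounded (?V i) \<and> diameter (?V i) \<le> \<delta>" for i
    using U(2,3) by (simp split: prod.split)
  moreover have "(\<Sum>i. diam_weight s (?V i)) \<le> ennreal e"
  proof -
    have "(\<Sum>i. diam_weight s (?V i)) = (\<Sum>i. case_prod (\<lambda>n j. diam_weight s (U n j)) (prod_decode i))"
      by (auto intro!: arg_cong[where f = suminf] split: prod.split)
    also have "\<dots> = (\<Sum>n. \<Sum>j. diam_weight s (U n j))"
      by (rule suminf_ennreal_2dimen) simp
    also have "\<dots> \<le> (\<Sum>n. ennreal (e * (1/2) ^ Suc n))"
      using U(4) by (intro suminf_le) auto
    also have "\<dots> = ennreal e"
      using sums_mult[OF power_half_series, of e] e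
      by (intro suminf_ennreal_eq) (auto simp: power_Suc)
    finally show ?thesis .
  qed
  ultimately show "\<exists>U :: nat \<Rightarrow> 'a set. (\<Union>n. A n) \<subseteq> (\<Union>i. U i) \<and>
      (\<forall>i. bounded (U i) \<and> diameter (U i) \<le> \<delta>) \<and> (\<Sum>i. diam_weight s (U i)) \<le> ennreal e"
    by (intro exI[of _ ?V]) blast
qed

lemma hausdorff_null_Un:
  assumes "hausdorff_measure s A = 0" "hausdorff_measure s B = 0"
  shows "hausdorff_measure s (A \<union> B) = 0"
proof -
  have "hausdorff_measure s (\<Union>n::nat. if n = 0 then A else B) = 0"
    using assms by (intro hausdorff_null_UN) auto
  moreover have "A \<union> B \<subseteq> (\<Union>n::nat. if n = 0 then A else B)" by (auto split: if_splits)
  ultimately show ?thesis by (rule hausdorff_null_subset)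
qed

lemma hausdorff_null_mono_exponent:
  assumes "hausdorff_measure s A = 0" "0 \<le> s" "s \<le> t"
  shows "hausdorff_measure t A = 0"
proof (rule hausdorff_nullI)
  fix \<delta> e :: real assume "0 < \<delta>" "0 < e"
  then obtain U where U: "A \<subseteq> (\<Union>i. U i)" "\<forall>i. bounded (U i) \<and> diameter (U i) \<le> min \<delta> 1"
    "(\<Sum>i. diam_weight s (U i)) \<le> ennreal e"
    using hausdorff_null_cover[OF assms(1), of "min \<delta> 1" e] by auto
  have "diam_weight t (U i) \<le> diam_weight s (U i)" for i
  proof -
    have "0 \<le> diameter (U i)" "diameter (U i) \<le> 1" using U(2) diameter_ge_0 by auto
    then have "diameter (U i) powr t \<le> diameter (U i) powr s" using assms by (intro powr_mono') auto
    \<comment> \<open>Covers the case \<open>s = 0\<close>, where a nonempty set has weight 1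
      whatever its diameter.\<close>
    moreover have "diameter (U i) powr t \<le> 1"
      using powr_mono2[of t "diameter (U i)" 1] \<open>0 \<le> diameter (U i)\<close> \<open>diameter (U i) \<le> 1\<close> assms by simp
    ultimately show ?thesis using assms by (auto simp: diam_weight_def)
  qed
  then have "(\<Sum>i. diam_weight t (U i)) \<le> (\<Sum>i. diam_weight s (U i))" by (intro suminf_le) auto
  then have "(\<Sum>i. diam_weight t (U i)) \<le> ennreal e" using U(3) by (rule order.trans)
  then show "\<exists>U :: nat \<Rightarrow> 'a set. A \<subseteq> (\<Union>i. U i) \<and>
      (\<forall>i. bounded (U i) \<and> diameter (U i) \<le> \<delta>) \<and> (\<Sum>i. diam_weight t (U i)) \<le> ennreal e"
    using U by (intro exI[of _ U]) auto
qed

lemma hausdorff_null_lipschitz_image: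
  fixes f :: "'a::metric_space \<Rightarrow> 'b::metric_space"
  assumes null: "hausdorff_measure s A = 0" and s: "0 < s" and L: "0 < L"
    and lip: "\<And>x y. x \<in> A \<Longrightarrow> y \<in> A \<Longrightarrow> dist (f x) (f y) \<le> L * dist x y"
  shows "hausdorff_measure s (f ` A) = 0"
proof (rule hausdorff_nullI)
  fix \<delta> e :: real assume "0 < \<delta>" "0 < e"
  then have "0 < \<delta> / L" "0 < e / L powr s" using L by auto
  from hausdorff_null_cover[OF null this] obtain U where U: "A \<subseteq> (\<Union>i. U i)"
    "\<forall>i. bounded (U i) \<and> diameter (U i) \<le> \<delta> / L" "(\<Sum>i. diam_weight s (U i)) \<le> ennreal (e / L powr s)"
    by blast
  let ?V = "\<lambda>i. f ` (A \<inter> U i)"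
  have dist_V: "dist x y \<le> L * diameter (U i)" if "x \<in> ?V i" "y \<in> ?V i" for x y i
  proof -
    from that obtain a b where ab: "a \<in> A \<inter> U i" "b \<in> A \<inter> U i" "x = f a" "y = f b" by blast
    then have "dist x y \<le> L * dist a b" using lip by blast
    also have "\<dots> \<le> L * diameter (U i)"
      using L ab U(2) by (intro mult_left_mono diameter_bounded_bound) auto
    finally show ?thesis .
  qed
  have diam: "diameter (?V i) \<le> L * diameter (U i)" for i
    using dist_V[of _ i] L U(2) by (intro diameter_le_dist) (auto simp: diameter_ge_0)
  have bdd: "bounded (?V i)" for i
    using dist_V[of _ i] unfolding bounded_two_points by blast
  have "diam_weight s (?V i) \<le> ennreal (L powr s) * diam_weight s (U i)" for i
  proof -
    have "diameter (?V i) powr s \<le> (L * diameter (U i)) powr s"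
      using diam s bdd by (intro powr_mono2) (auto intro: diameter_ge_0)
    also have "\<dots> = L powr s * diameter (U i) powr s"
      using L U(2) by (simp add: powr_mult diameter_ge_0)
    finally show ?thesis using s by (simp add: diam_weight_pos flip: ennreal_mult)
  qed
  then have "(\<Sum>i. diam_weight s (?V i)) \<le> (\<Sum>i. ennreal (L powr s) * diam_weight s (U i))"
    by (intro suminf_le) auto
  also have "\<dots> \<le> ennreal (L powr s) * ennreal (e / L powr s)"
    using U(3) by (simp add: mult_left_mono)
  also have "\<dots> = ennreal e" using L \<open>0 < e\<close> by (simp flip: ennreal_mult)
  finally have "(\<Sum>i. diam_weight s (?V i)) \<le> ennreal e" .
  moreover have "f ` A \<subseteq> (\<Union>i. ?V i)" using U(1) by blast
  moreover have "diameter (?V i) \<le> \<delta>" for i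
  proof -
    have "L * diameter (U i) \<le> L * (\<delta> / L)" using U(2) L by (intro mult_left_mono) auto
    then show ?thesis using diam[of i] L by simp
  qed
  ultimately show "\<exists>V :: nat \<Rightarrow> 'b set. f ` A \<subseteq> (\<Union>i. V i) \<and>
      (\<forall>i. bounded (V i) \<and> diameter (V i) \<le> \<delta>) \<and> (\<Sum>i. diam_weight s (V i)) \<le> ennreal e"
    using bdd by (intro exI[of _ ?V]) blast
qed

lemma hausdorff_dim_le: "0 \<le> s \<Longrightarrow> hausdorff_measure s A = 0 \<Longrightarrow> hausdorff_dim A \<le> ennreal s"
  unfolding hausdorff_dim_def by (auto intro!: Inf_lower)

lemma hausdorff_dim_less:
  assumes "hausdorff_dim A < ennreal u"
  obtains s where "0 \<le> s" "s < u" "hausdorff_measure s A = 0"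
  using assms unfolding hausdorff_dim_def Inf_less_iff by (auto simp: ennreal_less_iff)

section \<open>The exceptional set of directions\<close>

context dyadic_square
begin

text \<open>Hausdorff measure takes its covers as sequences; one enumeration of all labels converts
  every label cover at once.\<close>

lemma cost_suminf:
  obtains e :: "nat \<Rightarrow> nat \<times> int \<times> int" where "bij e"
    "\<And>U. cost U = (\<Sum>i. ennreal (dyadic_weight u (e i)) * indicator U (e i))"
proof
  let ?e = "from_nat_into (UNIV :: (nat \<times> int \<times> int) set)"
  have "infinite (UNIV :: (nat \<times> int \<times> int) set)" by (simp add: finite_prod)
  then show bij: "bij ?e" by (intro bij_betw_from_nat_into) auto
  show "cost U = (\<Sum>i. ennreal (dyadic_weight u (?e i)) * indicator U (?e i))" for U
    unfolding cost_indicator nn_integral_bij_count_space[OF bij, symmetric] nn_integral_count_space_nat ..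
qed

text \<open>Content does not restrict the size of cells, but a cover of total weight below \<delta>
  powr u contains no cell of side \<delta> or more. Zero content thus already gives zero measure;
  first coordinates turn squares into intervals no longer than the side.\<close>

lemma hausdorff_null_of_content:
  assumes "content B = 0"
  shows "hausdorff_measure u (fst ` B) = 0"
proof (rule hausdorff_nullI)
  fix \<delta> \<epsilon> :: real assume \<delta>: "0 < \<delta>" and \<epsilon>: "0 < \<epsilon>"
  define \<epsilon>' where "\<epsilon>' = min \<epsilon> (\<delta> powr u)"
  have "content B < ennreal \<epsilon>'" using assms \<delta> \<epsilon> by (simp add: \<epsilon>'_def)
  then obtain U where U: "covers U B" "cost U < ennreal \<epsilon>'" by (rule content_near)
  obtain e where e: "bij e" "\<And>U. cost U = (\<Sum>i. ennreal (dyadic_weight u (e i)) * indicator U (e i))"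
    using cost_suminf by blast
  define V where "V i = (if e i \<in> U then {x::real. \<lfloor>2 ^ fst (e i) * x\<rfloor> = fst (snd (e i))} else {})" for i
  have V_dist: "dist x y \<le> 1 / 2 ^ fst (e i)" if "x \<in> V i" "y \<in> V i" for x y i
  proof -
    let ?p = "2 ^ fst (e i) :: real"
    have "\<lfloor>?p * x\<rfloor> = \<lfloor>?p * y\<rfloor>" using that by (auto simp: V_def split: if_splits)
    then have "\<bar>?p * x - ?p * y\<bar> \<le> 1" by linarith
    then have "?p * \<bar>x - y\<bar> \<le> 1" by (simp add: scale_abs_diff)
    then show ?thesis by (simp add: dist_real_def pos_le_divide_eq mult.commute)
  qed
  have V_bdd: "bounded (V i)" for i using V_dist unfolding bounded_two_points by blast
  have V_diam: "diameter (V i) \<le> 1 / 2 ^ fst (e i)" for i using V_dist by (intro diameter_le_dist) auto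
  have V_weight: "diam_weight u (V i) \<le> ennreal (dyadic_weight u (e i)) * indicator U (e i)" for i
  proof (cases "e i \<in> U")
    case True
    have "diameter (V i) powr u \<le> (1 / 2 ^ fst (e i)) powr u"
      using V_diam V_bdd u_pos by (intro powr_mono2) (auto intro: diameter_ge_0)
    also have "1 / 2 ^ fst (e i) = 2 powr (- real (fst (e i)))"
      by (simp add: powr_minus powr_realpow divide_inverse)
    finally have "diameter (V i) powr u \<le> dyadic_weight u (e i)"
      by (simp add: dyadic_weight_def powr_powr mult.commute)
    then show ?thesis using True u_pos by (simp add: diam_weight_pos ennreal_leI)
  qed (simp add: V_def diam_weight_def)
  have "fst ` B \<subseteq> (\<Union>i. V i)"
  proof
    fix x assume "x \<in> fst ` B"
    then obtain z where z: "z \<in> B" "x = fst z" by blast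
    then obtain k where k: "dyadic_label k z \<in> U" using U(1) by (auto simp: covers_def)
    obtain i where "e i = dyadic_label k z" using e(1) by (metis bij_pointE)
    then have "x \<in> V i" using k z by (simp add: V_def dyadic_label_def)
    then show "x \<in> (\<Union>i. V i)" by blast
  qed
  moreover have "diameter (V i) \<le> \<delta>" for i
  proof (cases "e i \<in> U")
    case True
    have "ennreal (dyadic_weight u (e i)) = cost {e i}" by (simp add: cost_finite)
    also have "\<dots> \<le> cost U" using True by (intro cost_mono) auto
    also have "\<dots> < ennreal (\<delta> powr u)" using U(2) by (rule less_le_trans) (simp add: \<epsilon>'_def ennreal_leI)
    finally have "dyadic_weight u (e i) < \<delta> powr u" by (simp add: ennreal_less_iff w_nonneg)
    then have "(2 powr (- real (fst (e i)))) powr u < \<delta> powr u"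
      by (simp add: dyadic_weight_def powr_powr mult.commute)
    then have "2 powr (- real (fst (e i))) < \<delta>"
      using u_pos \<delta> by (meson less_eq_real_def not_less powr_mono2 powr_ge_zero)
    moreover have "1 / 2 ^ fst (e i) = 2 powr (- real (fst (e i)))"
      by (simp add: powr_minus powr_realpow divide_inverse)
    ultimately show ?thesis using V_diam[of i] by simp
  qed (use \<delta> in \<open>simp add: V_def\<close>)
  moreover have "(\<Sum>i. diam_weight u (V i)) \<le> ennreal \<epsilon>"
  proof -
    have "(\<Sum>i. diam_weight u (V i)) \<le> cost U"
      unfolding e(2) using V_weight by (intro suminf_le) auto
    also have "\<dots> \<le> ennreal \<epsilon>" using U(2) by (rule less_imp_le[THEN order.trans]) (simp add: \<epsilon>'_def ennreal_leI)
    finally show ?thesis .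
  qed
  ultimately show "\<exists>U :: nat \<Rightarrow> real set. fst ` B \<subseteq> (\<Union>i. U i) \<and>
      (\<forall>i. bounded (U i) \<and> diameter (U i) \<le> \<delta>) \<and> (\<Sum>i. diam_weight u (U i)) \<le> ennreal \<epsilon>"
    using V_bdd by (intro exI[of _ V]) blast
qed

text \<open>The weight lives on a compact part \<open>K\<close> of \<open>B\<close>, and an image of
  \<open>K\<close> is null whenever that of \<open>B\<close> is. Each exceptional \<open>t\<close>
  then has a large correlation at arbitrarily fine scales, while the contents of the sets
  \<open>E k\<close> are summable.\<close>

lemma exceptional_set_null:
  assumes B: "suslin B" "B \<subseteq> {0..b} \<times> {0..b}" "0 < content B"
    and I: "I \<subseteq> {0..1}" and C: "0 \<le> C"
    and trans: "\<And>t t' y y'. t \<in> I \<Longrightarrow> t' \<in> I \<Longrightarrow> y \<in> B \<Longrightarrow> y' \<in> B \<Longrightarrow>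
      \<bar>t - t'\<bar> * dist y y' \<le> C * max \<bar>g t y - g t y'\<bar> \<bar>g t' y - g t' y'\<bar>"
    and Lip: "\<And>t y y'. t \<in> I \<Longrightarrow> y \<in> B \<Longrightarrow> y' \<in> B \<Longrightarrow> \<bar>g t y - g t y'\<bar> \<le> C * dist y y'"
    and v: "0 < v" "v < u"
  shows "hausdorff_measure u {t\<in>I. hausdorff_measure v (g t ` B) = 0} = 0" (is "hausdorff_measure u ?T = 0")
proof -
  obtain m K where m: "\<And>k l. 0 \<le> m k l" "\<And>k l. m k l \<le> dyadic_weight u l" "\<And>k. additive m k"
    "\<And>k l. 0 < m k l \<Longrightarrow> closed_cell k l \<inter> K \<noteq> {}" and K: "compact K" "K \<subseteq> B"
    and mass: "0 < (\<Sum>l\<in>labels 0. m 0 l)"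
    using suslin_frostman[OF B] by blast
  have "\<forall>k l. \<exists>y. 0 < m k l \<longrightarrow> y \<in> closed_cell k l \<inter> K" using m(4) by blast
  then obtain z where z: "\<And>k l. 0 < m k l \<Longrightarrow> z k l \<in> closed_cell k l \<inter> K" by metis
  \<comment> \<open>The midpoint leaves room on both sides: v < \<beta> for the lower bound on
    correlations and \<beta> < u for the summability of the contents.\<close>
  define \<beta> where "\<beta> = (u + v) / 2"
  have \<beta>: "v < \<beta>" "\<beta> < u" using v by (auto simp: \<beta>_def)
  define \<Lambda> where "\<Lambda> = 4 * C + 3"
  have "0 \<le> \<Lambda>" using C by (simp add: \<Lambda>_def)
  have transK: "\<bar>t - t'\<bar> * dist y y' \<le> C * max \<bar>g t y - g t y'\<bar> \<bar>g t' y - g t' y'\<bar>"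
    if "t \<in> I" "t' \<in> I" "y \<in> K" "y' \<in> K" for t t' y y'
    using trans that K(2) by blast
  obtain D where D: "0 \<le> D" "\<And>k S c. S \<subseteq> I \<Longrightarrow> 0 < c \<Longrightarrow>
      (\<And>t. t \<in> S \<Longrightarrow> c \<le> correlation m z (g t) \<Lambda> k) \<Longrightarrow>
      content (S \<times> {0}) \<le> ennreal (D * (real k + 1) * 2 powr (- u * real k) / c)"
    by (rule energy_bound[OF m(1-3) z I transK C \<open>0 \<le> \<Lambda>\<close>]) (assumption+, rule that, assumption, blast)
  obtain c where c: "0 < c" "\<And>h k0. (\<And>y y'. y \<in> K \<Longrightarrow> y' \<in> K \<Longrightarrow> \<bar>h y - h y'\<bar> \<le> C * dist y y') \<Longrightarrow>
      hausdorff_measure v (h ` K) = 0 \<Longrightarrow>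
      \<exists>k\<ge>k0. c * 2 powr (- \<beta> * real k) \<le> correlation m z h (4 * C + 3) k"
    by (rule correlation_lower_bound[OF m(1,3) mass z K(1) v(1) \<beta>(1) C])
      (assumption+, rule that, assumption, blast)
  define E where "E k = {t\<in>I. c * 2 powr (- \<beta> * real k) \<le> correlation m z (g t) \<Lambda> k}" for k
  have T_sub: "?T \<subseteq> (\<Union>k. E (k + k0))" for k0
  proof
    fix t assume t: "t \<in> ?T"
    then have "hausdorff_measure v (g t ` K) = 0"
      using K(2) hausdorff_null_subset[of v "g t ` B" "g t ` K"] by auto
    then obtain k where "k \<ge> k0" "c * 2 powr (- \<beta> * real k) \<le> correlation m z (g t) (4 * C + 3) k"
      using c(2)[of "g t" k0] Lip[of t] t K(2) by blast
    then have "t \<in> E ((k - k0) + k0)" using t by (simp add: E_def \<Lambda>_def)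
    then show "t \<in> (\<Union>k. E (k + k0))" by blast
  qed
  define r where "r = 2 powr (\<beta> - u)"
  have r: "0 < r" "r < 1" using powr_less_mono[of "\<beta> - u" 0 2] \<beta> by (auto simp: r_def)
  define f where "f k = D / c * (real (Suc k) * r ^ k)" for k
  have f_nonneg: "0 \<le> f k" for k using D(1) c(1) r by (auto simp: f_def)
  have "summable f"
    unfolding f_def using geometric_deriv_sums[of r] r
    by (intro summable_mult) (auto simp: sums_iff)
  have content_E: "content (E k \<times> {0}) \<le> ennreal (f k)" for k
  proof -
    have "content (E k \<times> {0}) \<le> ennreal (D * (real k + 1) * 2 powr (- u * real k) / (c * 2 powr (- \<beta> * real k)))"
      using c(1) by (intro D(2)) (auto simp: E_def)
    also have "D * (real k + 1) * 2 powr (- u * real k) / (c * 2 powr (- \<beta> * real k))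
        = D / c * ((real k + 1) * (2 powr (- u * real k) / 2 powr (- \<beta> * real k)))" by simp
    also have "2 powr (- u * real k) / 2 powr (- \<beta> * real k) = r ^ k"
      by (simp add: r_def powr_powr algebra_simps flip: powr_diff powr_realpow)
    finally show ?thesis by (simp add: f_def add.commute)
  qed
  have "content (?T \<times> {0}) \<le> 0"
  proof (rule ennreal_le_epsilon)
    fix e :: real assume "0 < e"
    then obtain N where N: "norm (\<Sum>i. f (i + N)) < e"
      using suminf_exist_split[OF _ \<open>summable f\<close>] by blast
    have "content (?T \<times> {0}) \<le> content (\<Union>k. E (k + N) \<times> {0})"
      using T_sub[of N] by (intro content_mono) blast
    also have "\<dots> \<le> (\<Sum>k. content (E (k + N) \<times> {0}))" by (rule content_UN)
    also have "\<dots> \<le> (\<Sum>k. ennreal (f (k + N)))" using content_E by (intro suminf_le) auto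
    also have "\<dots> = ennreal (\<Sum>k. f (k + N))"
      using f_nonneg \<open>summable f\<close> by (intro suminf_ennreal2) (auto simp: summable_iff_shift)
    also have "\<dots> \<le> ennreal e" using N by (intro ennreal_leI) simp
    finally show "content (?T \<times> {0}) \<le> 0 + ennreal e" by simp
  qed
  then have "hausdorff_measure u (fst ` (?T \<times> {0::real})) = 0"
    by (intro hausdorff_null_of_content) simp
  then show ?thesis by (simp add: fst_image_times)
qed

end

section \<open>Transversality on the cone over a curve\<close>

text \<open>Constant norm makes velocity and position orthogonal. The velocity is nonzero because in
  dimension at least 2 it is a column of the matrix with nonzero determinant.\<close>

lemma nondegenerate_curveD:
  fixes \<gamma> :: "real \<Rightarrow> real ^ 'n"
  assumes nd: "nondegenerate_curve \<gamma>" and n: "2 \<le> CARD('n)"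
  defines "\<gamma>' \<equiv> curve_deriv (Suc 0) \<gamma>"
  shows "\<And>t. t \<in> {0..1} \<Longrightarrow> (\<gamma> has_vector_derivative \<gamma>' t) (at t within {0..1})"
    and "continuous_on {0..1} \<gamma>'"
    and "\<And>t. t \<in> {0..1} \<Longrightarrow> norm (\<gamma> t) = 1"
    and "\<And>t. t \<in> {0..1} \<Longrightarrow> \<gamma> t \<bullet> \<gamma>' t = 0"
    and "\<And>t. t \<in> {0..1} \<Longrightarrow> \<gamma>' t \<noteq> 0"
proof -
  have diff: "curve_deriv k \<gamma> differentiable_on {0..1}" for k
    using nd by (auto simp: nondegenerate_curve_def smooth_curve_def)
  show der: "(\<gamma> has_vector_derivative \<gamma>' t) (at t within {0..1})" if "t \<in> {0..1}" for t
    using diff[of 0] that unfolding \<gamma>'_def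
    by (simp add: differentiable_on_def vector_derivative_works)
  show "continuous_on {0..1} \<gamma>'"
    unfolding \<gamma>'_def by (rule differentiable_imp_continuous_on[OF diff])
  show norm1: "norm (\<gamma> t) = 1" if "t \<in> {0..1}" for t
    using nd that by (auto simp: nondegenerate_curve_def)
  show "\<gamma> t \<bullet> \<gamma>' t = 0" if t: "t \<in> {0..1}" for t
  proof -
    have "((\<lambda>t. \<gamma> t \<bullet> \<gamma> t) has_vector_derivative (\<gamma> t \<bullet> \<gamma>' t + \<gamma>' t \<bullet> \<gamma> t)) (at t within {0..1})"
      using bounded_bilinear.has_vector_derivative[OF bounded_bilinear_inner der[OF t] der[OF t]] .
    moreover have "((\<lambda>t. \<gamma> t \<bullet> \<gamma> t) has_vector_derivative 0) (at t within {0..1})"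
    proof (rule has_vector_derivative_transform[OF t])
      show "\<gamma> s \<bullet> \<gamma> s = 1" if "s \<in> {0..1}" for s
        using norm1[OF that] by (simp add: norm_eq_1)
    qed (rule has_vector_derivative_const)
    ultimately have "\<gamma> t \<bullet> \<gamma>' t + \<gamma>' t \<bullet> \<gamma> t = 0"
      by (rule vector_derivative_unique_within[rotated])
        (use t in \<open>simp add: trivial_limit_within islimpt_Icc\<close>)
    then show ?thesis by (simp add: inner_commute)
  qed
  show "\<gamma>' t \<noteq> 0" if t: "t \<in> {0..1}" for t
  proof
    assume zero: "\<gamma>' t = 0"
    let ?M = "\<chi> i j. curve_deriv (to_nat_on (UNIV :: 'n set) j) \<gamma> t $ i"
    have "bij_betw (to_nat_on (UNIV :: 'n set)) UNIV {..<CARD('n)}" by (rule to_nat_on_finite) simp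
    moreover have "1 \<in> {..<CARD('n)}" using n by simp
    ultimately obtain j :: 'n where "to_nat_on (UNIV :: 'n set) j = 1" by (metis bij_betw_imp_surj_on imageE)
    then have "column j ?M = 0" using zero by (simp add: column_def \<gamma>'_def vec_eq_iff)
    then have "det ?M = 0" by (rule det_zero_column)
    then show False using nd t by (auto simp: nondegenerate_curve_def)
  qed
qed

text \<open>
  On a short arc, \<open>r *\<^sub>R \<gamma> s - r' *\<^sub>R \<gamma> s'\<close> lies nearly in the span of \<open>\<gamma> t\<close> and \<open>\<gamma>' t\<close>. This
  gives transversality with one derivative only.
\<close>
lemma cone_local_transversality:
  fixes \<gamma> :: "real \<Rightarrow> 'a::real_inner"
  assumes der: "\<And>t. t \<in> {0..1} \<Longrightarrow> (\<gamma> has_vector_derivative \<gamma>' t) (at t within {0..1})"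
    and cont: "continuous_on {0..1} \<gamma>'"
    and norm1: "\<And>t. t \<in> {0..1} \<Longrightarrow> norm (\<gamma> t) = 1"
    and orth: "\<And>t. t \<in> {0..1} \<Longrightarrow> \<gamma> t \<bullet> \<gamma>' t = 0"
    and nz: "\<And>t. t \<in> {0..1} \<Longrightarrow> \<gamma>' t \<noteq> 0"
    and \<rho>: "0 < \<rho>" "\<rho> \<le> R"
  obtains \<eta> C where "0 < \<eta>" "0 < C" "\<And>p q t t' s s' r r'. 0 \<le> p \<Longrightarrow> q \<le> 1 \<Longrightarrow> q - p < \<eta> \<Longrightarrow>
    {t, t', s, s'} \<subseteq> {p..q} \<Longrightarrow> {r, r'} \<subseteq> {\<rho>..R} \<Longrightarrow>
    \<bar>t - t'\<bar> * dist (s, r) (s', r') \<le> C * max \<bar>\<gamma> t \<bullet> (r *\<^sub>R \<gamma> s - r' *\<^sub>R \<gamma> s')\<bar> \<bar>\<gamma> t' \<bullet> (r *\<^sub>R \<gamma> s - r' *\<^sub>R \<gamma> s')\<bar> \<and>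
    \<bar>\<gamma> t \<bullet> (r *\<^sub>R \<gamma> s - r' *\<^sub>R \<gamma> s')\<bar> \<le> C * dist (s, r) (s', r') \<and>
    \<bar>s - s'\<bar> \<le> C * norm (r *\<^sub>R \<gamma> s - r' *\<^sub>R \<gamma> s')"
proof -
  have cont\<gamma>: "continuous_on {0..1} \<gamma>"
    using der by (meson continuous_on_eq_continuous_within has_vector_derivative_continuous)
  have contn: "continuous_on {0..1} (\<lambda>t. norm (\<gamma>' t))" by (intro continuous_intros cont)
  obtain tm where tm: "tm \<in> {0..1}" "\<And>t. t \<in> {0..1} \<Longrightarrow> norm (\<gamma>' tm) \<le> norm (\<gamma>' t)"
    using continuous_attains_inf[OF _ _ contn] by auto
  obtain tM where tM: "tM \<in> {0..1}" "\<And>t. t \<in> {0..1} \<Longrightarrow> norm (\<gamma>' t) \<le> norm (\<gamma>' tM)"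
    using continuous_attains_sup[OF _ _ contn] by auto
  define b where "b = (norm (\<gamma>' tm))\<^sup>2"
  define G where "G = norm (\<gamma>' tM)"
  have b: "0 < b" "\<And>t. t \<in> {0..1} \<Longrightarrow> b \<le> \<gamma>' t \<bullet> \<gamma>' t"
    using nz[OF tm(1)] tm(2) by (auto simp: b_def power2_norm_eq_inner[symmetric] intro: power_mono)
  have G: "0 \<le> G" "\<And>t. t \<in> {0..1} \<Longrightarrow> norm (\<gamma>' t) \<le> G" using tM(2) by (auto simp: G_def)
  have R: "0 < R" using \<rho> by simp
  \<comment> \<open>For the ideal frame, \<open>\<gamma> x\<close> detects \<open>r - r'\<close>
    with factor 1 and \<open>\<gamma>' x\<close> detects \<open>s - s'\<close> with factor at least
    \<open>\<rho> * b\<close>. Half of each is kept, the other half is left to the errors of size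
    \<epsilon>.\<close>
  define c where "c = min (1/2) (\<rho> * b / 2)"
  have c: "0 < c" "c \<le> 1/2" "c \<le> \<rho> * b / 2" using \<rho> b by (auto simp: c_def)
  define L where "L = 1 + R * (G + 1)"
  have L: "1 \<le> L" using R G by (simp add: L_def)
  \<comment> \<open>The middle entries keep those errors within their halves. The last one, with
    \<open>L\<close> the Lipschitz constant of the cone map, lets the slope of the projection of
    \<open>e\<close> vary by at most \<open>c * D / 4\<close> along the arc.\<close>
  define \<epsilon> where "\<epsilon> = min 1 (min (1 / (2 * (1 + G))) (min (\<rho> * b / (2 * R * (1 + G))) (c / (4 * L))))"
  have \<epsilon>: "0 < \<epsilon>" "\<epsilon> \<le> 1" "\<epsilon> * (1 + G) \<le> 1/2" "R * \<epsilon> * (1 + G) \<le> \<rho> * b / 2" "\<epsilon> * L \<le> c / 4"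
  proof -
    have "0 < 1 + G" using G by simp
    then show "0 < \<epsilon>" using R \<rho> b c L by (auto simp: \<epsilon>_def intro!: divide_pos_pos mult_pos_pos)
    show "\<epsilon> \<le> 1" by (simp add: \<epsilon>_def)
    have "\<epsilon> \<le> 1 / (2 * (1 + G))" by (simp add: \<epsilon>_def)
    then show "\<epsilon> * (1 + G) \<le> 1/2" using \<open>0 < 1 + G\<close> by (simp add: pos_le_divide_eq algebra_simps)
    have "\<epsilon> \<le> \<rho> * b / (2 * R * (1 + G))" by (simp add: \<epsilon>_def)
    moreover have "0 < 2 * R * (1 + G)" using \<open>0 < 1 + G\<close> R by simp
    ultimately have "\<epsilon> * (2 * R * (1 + G)) \<le> \<rho> * b" by (simp only: pos_le_divide_eq)
    then show "R * \<epsilon> * (1 + G) \<le> \<rho> * b / 2" by (simp add: algebra_simps)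
    have "\<epsilon> \<le> c / (4 * L)" by (simp add: \<epsilon>_def)
    then show "\<epsilon> * L \<le> c / 4" using L by (simp add: pos_le_divide_eq algebra_simps)
  qed
  have uc: "uniformly_continuous_on {0..1} \<gamma>" "uniformly_continuous_on {0..1} \<gamma>'"
    using cont cont\<gamma> by (auto intro: compact_uniformly_continuous)
  obtain \<eta>1 where \<eta>1: "0 < \<eta>1"
    "\<And>t t'. t \<in> {0..1} \<Longrightarrow> t' \<in> {0..1} \<Longrightarrow> dist t' t < \<eta>1 \<Longrightarrow> dist (\<gamma> t') (\<gamma> t) < \<epsilon>"
    using uniformly_continuous_onE[OF uc(1) \<epsilon>(1)] by metis
  obtain \<eta>2 where \<eta>2: "0 < \<eta>2"
    "\<And>t t'. t \<in> {0..1} \<Longrightarrow> t' \<in> {0..1} \<Longrightarrow> dist t' t < \<eta>2 \<Longrightarrow> dist (\<gamma>' t') (\<gamma>' t) < \<epsilon>"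
    using uniformly_continuous_onE[OF uc(2) \<epsilon>(1)] by metis
  note \<eta> = \<eta>1(1) \<eta>2(1) \<eta>1(2) \<eta>2(2)
  \<comment> \<open>One entry for each estimate: \<open>8 / c\<close> for transversality,
    \<open>2 * L\<close> for the Lipschitz bound, \<open>(1 + G) / c\<close> for recovering
    \<open>s\<close> from the point.\<close>
  define C where "C = max (8 / c) (max (2 * L) ((1 + G) / c))"
  show thesis
  proof
    show "0 < min \<eta>1 \<eta>2" using \<eta> by simp
    show "0 < C" using c(1) by (simp add: C_def less_max_iff_disj)
    fix p q t t' s s' r r' :: real
    assume pq: "0 \<le> p" "q \<le> 1" "q - p < min \<eta>1 \<eta>2"
      and I: "{t, t', s, s'} \<subseteq> {p..q}" and r: "{r, r'} \<subseteq> {\<rho>..R}"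
    have sub: "{p..q} \<subseteq> {0..1}" using pq by auto
    have near: "norm (\<gamma> x - \<gamma> y) \<le> \<epsilon>" "norm (\<gamma>' x - \<gamma>' y) \<le> \<epsilon>" if "x \<in> {p..q}" "y \<in> {p..q}" for x y
      using \<eta>(3)[of y x] \<eta>(4)[of y x] that sub pq by (auto simp: dist_norm intro!: less_imp_le)
    have der_pq: "(\<gamma> has_vector_derivative \<gamma>' x) (at x within {p..q})" if "x \<in> {p..q}" for x
      using der[of x] that sub by (auto intro: has_vector_derivative_within_subset)
    have seg: "closed_segment x y \<subseteq> {p..q}" if "x \<in> {p..q}" "y \<in> {p..q}" for x y
      using that by (intro closed_segment_subset) auto
    have lin: "norm (\<gamma> s - \<gamma> s' - (s - s') *\<^sub>R \<gamma>' x) \<le> \<bar>s - s'\<bar> * \<epsilon>" if "x \<in> {p..q}" for x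
      using vector_differentiable_bound_linearization[OF der_pq seg[of s' s] near(2) that] I that by auto
    define e where "e = r *\<^sub>R \<gamma> s - r' *\<^sub>R \<gamma> s'"
    define D where "D = \<bar>r - r'\<bar> + \<bar>s - s'\<bar>"
    have D: "0 \<le> D" "dist (s, r) (s', r') \<le> D" "D \<le> 2 * dist (s, r) (s', r')"
      using dist_prod_le[of "(s, r)" "(s', r')"]
        dist_fst_le[of "(s, r)" "(s', r')"] dist_snd_le[of "(s, r)" "(s', r')"]
      by (auto simp: D_def dist_real_def)
    have r01: "0 \<le> r'" "\<rho> \<le> r'" "r' \<le> R" using r \<rho> by auto
    have e_eq: "e = (r - r') *\<^sub>R \<gamma> s + r' *\<^sub>R (\<gamma> s - \<gamma> s')" by (simp add: e_def algebra_simps)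
    have ds: "norm (\<gamma> s - \<gamma> s') \<le> (G + 1) * \<bar>s - s'\<bar>"
    proof -
      have "norm (\<gamma> s - \<gamma> s') \<le> norm ((s - s') *\<^sub>R \<gamma>' s) + norm (\<gamma> s - \<gamma> s' - (s - s') *\<^sub>R \<gamma>' s)"
        using norm_triangle_ineq[of "(s - s') *\<^sub>R \<gamma>' s" "\<gamma> s - \<gamma> s' - (s - s') *\<^sub>R \<gamma>' s"] by simp
      also have "\<dots> \<le> \<bar>s - s'\<bar> * G + \<bar>s - s'\<bar> * 1"
        using I sub G(2)[of s] \<epsilon>(2)
        by (intro add_mono order.trans[OF lin] mult_left_mono) (auto intro!: mult_left_mono)
      finally show ?thesis by (simp add: algebra_simps)
    qed
    have norm_e: "norm e \<le> L * D"
    proof -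
      have "norm e \<le> \<bar>r - r'\<bar> * 1 + r' * norm (\<gamma> s - \<gamma> s')"
        unfolding e_eq using norm1[of s] I sub r01
        by (intro order.trans[OF norm_triangle_ineq]) auto
      also have "\<dots> \<le> L * \<bar>r - r'\<bar> + R * ((G + 1) * \<bar>s - s'\<bar>)"
      proof (rule add_mono)
        show "\<bar>r - r'\<bar> * 1 \<le> L * \<bar>r - r'\<bar>"
          using mult_right_mono[OF L, of "\<bar>r - r'\<bar>"] by simp
        show "r' * norm (\<gamma> s - \<gamma> s') \<le> R * ((G + 1) * \<bar>s - s'\<bar>)"
          using ds r01 R by (intro mult_mono) auto
      qed
      also have "R * ((G + 1) * \<bar>s - s'\<bar>) \<le> L * \<bar>s - s'\<bar>"
        by (simp add: L_def algebra_simps)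
      finally show ?thesis by (simp add: D_def algebra_simps)
    qed
    \<comment> \<open>At every \<open>x\<close> of the arc, \<open>e\<close> is (r - r') times
      \<open>\<gamma> s\<close> plus r' (s - s') times \<open>\<gamma>' x\<close> up to a small
      error. It is tested against the orthogonal vectors \<open>\<gamma> x\<close> and
      \<open>\<gamma>' x\<close>.\<close>
    have lower: "c * D \<le> \<bar>\<gamma> x \<bullet> e\<bar> + \<bar>\<gamma>' x \<bullet> e\<bar>" if x: "x \<in> {p..q}" for x
    proof -
      have x01: "x \<in> {0..1}" "s \<in> {0..1}" using x I sub by auto
      define h where "h = \<gamma> s - \<gamma> s' - (s - s') *\<^sub>R \<gamma>' x"
      have h: "norm h \<le> \<bar>s - s'\<bar> * \<epsilon>" using lin[OF x] by (simp add: h_def)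
      have e_h: "e = (r - r') *\<^sub>R \<gamma> s + (r' * (s - s')) *\<^sub>R \<gamma>' x + r' *\<^sub>R h"
        by (simp add: e_def h_def algebra_simps)
      have ga: "\<gamma> x \<bullet> e = (r - r') * (\<gamma> x \<bullet> \<gamma> s) + r' * (\<gamma> x \<bullet> h)"
        unfolding e_h using orth[OF x01(1)] by (simp add: inner_add_right)
      have gb: "\<gamma>' x \<bullet> e = (r - r') * (\<gamma>' x \<bullet> \<gamma> s) + r' * (s - s') * (\<gamma>' x \<bullet> \<gamma>' x) + r' * (\<gamma>' x \<bullet> h)"
        unfolding e_h by (simp add: inner_add_right)
      have 1: "1 - \<epsilon> \<le> \<bar>\<gamma> x \<bullet> \<gamma> s\<bar>"
      proof -
        have "\<gamma> x \<bullet> \<gamma> s = 1 - \<gamma> x \<bullet> (\<gamma> x - \<gamma> s)"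
          using norm1[OF x01(1)] by (simp add: inner_diff_right norm_eq_1)
        moreover have "\<bar>\<gamma> x \<bullet> (\<gamma> x - \<gamma> s)\<bar> \<le> 1 * \<epsilon>"
          using Cauchy_Schwarz_ineq2[of "\<gamma> x" "\<gamma> x - \<gamma> s"] norm1[OF x01(1)] near(1)[of x s] x I by auto
        ultimately show ?thesis by linarith
      qed
      have 2: "\<bar>\<gamma> x \<bullet> h\<bar> \<le> \<bar>s - s'\<bar> * \<epsilon>"
        using Cauchy_Schwarz_ineq2[of "\<gamma> x" h] norm1[OF x01(1)] h by simp
      have 3: "\<bar>\<gamma>' x \<bullet> \<gamma> s\<bar> \<le> G * \<epsilon>"
      proof -
        have "\<gamma>' x \<bullet> \<gamma> s = \<gamma>' x \<bullet> (\<gamma> s - \<gamma> x)"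
          using orth[OF x01(1)] by (simp add: inner_diff_right inner_commute)
        also have "\<bar>\<dots>\<bar> \<le> norm (\<gamma>' x) * norm (\<gamma> s - \<gamma> x)" by (rule Cauchy_Schwarz_ineq2)
        also have "\<dots> \<le> G * \<epsilon>" using G x01 near(1)[of s x] x I by (intro mult_mono) auto
        finally show ?thesis .
      qed
      have 4: "\<bar>\<gamma>' x \<bullet> h\<bar> \<le> G * (\<bar>s - s'\<bar> * \<epsilon>)"
        using Cauchy_Schwarz_ineq2[of "\<gamma>' x" h] h G x01
        by (intro order.trans[OF Cauchy_Schwarz_ineq2] mult_mono) auto
      have "\<bar>r - r'\<bar> * (1 - \<epsilon>) - R * (\<bar>s - s'\<bar> * \<epsilon>) \<le> \<bar>\<gamma> x \<bullet> e\<bar>"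
      proof -
        have "\<bar>r - r'\<bar> * (1 - \<epsilon>) \<le> \<bar>(r - r') * (\<gamma> x \<bullet> \<gamma> s)\<bar>"
          unfolding abs_mult using 1 by (intro mult_left_mono) auto
        moreover have "\<bar>r' * (\<gamma> x \<bullet> h)\<bar> \<le> R * (\<bar>s - s'\<bar> * \<epsilon>)"
          unfolding abs_mult using 2 r01 by (intro mult_mono) auto
        ultimately show ?thesis unfolding ga by linarith
      qed
      moreover have "\<rho> * \<bar>s - s'\<bar> * b - \<bar>r - r'\<bar> * (G * \<epsilon>) - R * (G * (\<bar>s - s'\<bar> * \<epsilon>)) \<le> \<bar>\<gamma>' x \<bullet> e\<bar>"
      proof -
        have "\<rho> * \<bar>s - s'\<bar> * b \<le> \<bar>r' * (s - s') * (\<gamma>' x \<bullet> \<gamma>' x)\<bar>"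
          unfolding abs_mult using b(2)[OF x01(1)] r01 \<rho> b(1) by (intro mult_mono) auto
        moreover have "\<bar>(r - r') * (\<gamma>' x \<bullet> \<gamma> s)\<bar> \<le> \<bar>r - r'\<bar> * (G * \<epsilon>)"
          unfolding abs_mult using 3 by (intro mult_left_mono) auto
        moreover have "\<bar>r' * (\<gamma>' x \<bullet> h)\<bar> \<le> R * (G * (\<bar>s - s'\<bar> * \<epsilon>))"
          unfolding abs_mult using 4 r01 by (intro mult_mono) auto
        ultimately show ?thesis unfolding gb by linarith
      qed
      ultimately have "\<bar>r - r'\<bar> * (1 - \<epsilon> * (1 + G)) + \<bar>s - s'\<bar> * (\<rho> * b - R * \<epsilon> * (1 + G)) \<le> \<bar>\<gamma> x \<bullet> e\<bar> + \<bar>\<gamma>' x \<bullet> e\<bar>"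
        by (simp add: algebra_simps)
      moreover have "\<bar>r - r'\<bar> * c \<le> \<bar>r - r'\<bar> * (1 - \<epsilon> * (1 + G))"
        using \<epsilon>(3) c(2) by (intro mult_left_mono) auto
      moreover have "\<bar>s - s'\<bar> * c \<le> \<bar>s - s'\<bar> * (\<rho> * b - R * \<epsilon> * (1 + G))"
        using \<epsilon>(4) c(3) by (intro mult_left_mono) auto
      ultimately show ?thesis by (simp add: D_def algebra_simps)
    qed
    have t: "t \<in> {p..q}" "t' \<in> {p..q}" using I by auto
    let ?max = "max \<bar>\<gamma> t \<bullet> e\<bar> \<bar>\<gamma> t' \<bullet> e\<bar>"
    have trans: "\<bar>t - t'\<bar> * D \<le> 8 / c * ?max"
    \<comment> \<open>Either one of the two projections is large, and \<bar>t - t'\<bar> \<le> 1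
      suffices; or the slope at \<open>t\<close> is at least \<open>c * D / 2\<close> and stays
      nearly constant, so that the projections at \<open>t\<close> and \<open>t'\<close> differ by
      at least \<bar>t - t'\<bar> * c * D / 4 and one of them is at least half as large.\<close>
    proof (cases "c * D / 2 \<le> ?max")
      case True
      have "\<bar>t - t'\<bar> * D \<le> 1 * D" using t pq D by (intro mult_right_mono) auto
      also have "\<dots> \<le> 8 / c * (c * D / 2)" using c(1) D by simp
      also have "\<dots> \<le> 8 / c * ?max" using True c(1) by (intro mult_left_mono) auto
      finally show ?thesis .
    next
      case False
      then have big: "c * D / 2 \<le> \<bar>\<gamma>' t \<bullet> e\<bar>" using lower[OF t(1)] by (simp add: max_def split: if_splits)
      have "norm (\<gamma> t' \<bullet> e - \<gamma> t \<bullet> e - (t' - t) *\<^sub>R (\<gamma>' t \<bullet> e)) \<le> norm (t' - t) * (c * D / 4)"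
      proof (rule vector_differentiable_bound_linearization[where S = "{p..q}" and f' = "\<lambda>x. \<gamma>' x \<bullet> e"])
        show "((\<lambda>x. \<gamma> x \<bullet> e) has_vector_derivative \<gamma>' x \<bullet> e) (at x within {p..q})" if "x \<in> {p..q}" for x
          using bounded_linear.has_vector_derivative[OF bounded_linear_inner_left der_pq[OF that]] .
        show "norm (\<gamma>' x \<bullet> e - \<gamma>' t \<bullet> e) \<le> c * D / 4" if x: "x \<in> {p..q}" for x
        proof -
          have "norm (\<gamma>' x \<bullet> e - \<gamma>' t \<bullet> e) \<le> norm (\<gamma>' x - \<gamma>' t) * norm e"
            using Cauchy_Schwarz_ineq2[of "\<gamma>' x - \<gamma>' t" e] by (simp add: inner_diff_left)
          also have "\<dots> \<le> \<epsilon> * (L * D)" using near(2)[OF x t(1)] norm_e \<epsilon>(1) by (intro mult_mono) auto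
          also have "\<dots> \<le> c / 4 * D" using mult_right_mono[OF \<epsilon>(5) D(1)] by (simp add: mult.assoc)
          finally show ?thesis by simp
        qed
      qed (use t seg in auto)
      then have "\<bar>t' - t\<bar> * \<bar>\<gamma>' t \<bullet> e\<bar> - \<bar>t' - t\<bar> * (c * D / 4) \<le> \<bar>\<gamma> t' \<bullet> e - \<gamma> t \<bullet> e\<bar>"
        unfolding abs_mult[symmetric] real_norm_def real_scaleR_def by linarith
      moreover have "\<bar>t' - t\<bar> * (c * D / 2) \<le> \<bar>t' - t\<bar> * \<bar>\<gamma>' t \<bullet> e\<bar>"
        using big by (intro mult_left_mono) auto
      ultimately have "\<bar>t' - t\<bar> * (c * D / 4) \<le> 2 * ?max"
        by (simp add: max_def algebra_simps split: if_splits) linarith+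
      then show ?thesis using c(1) by (simp add: field_simps abs_minus_commute)
    qed
    have "\<bar>t - t'\<bar> * dist (s, r) (s', r') \<le> \<bar>t - t'\<bar> * D" using D by (intro mult_left_mono) auto
    also have "\<dots> \<le> C * ?max" using trans by (rule order.trans) (intro mult_right_mono, auto simp: C_def)
    finally have A: "\<bar>t - t'\<bar> * dist (s, r) (s', r') \<le> C * ?max" .
    have "\<bar>\<gamma> t \<bullet> e\<bar> \<le> 1 * norm e"
      using Cauchy_Schwarz_ineq2[of "\<gamma> t" e] norm1[of t] t sub by auto
    also have "\<dots> \<le> L * (2 * dist (s, r) (s', r'))"
      using norm_e D(3) L by (auto intro: order.trans mult_left_mono)
    also have "\<dots> \<le> C * dist (s, r) (s', r')"
      by (simp only: mult.assoc[symmetric] mult.commute[of L 2]) (intro mult_right_mono, auto simp: C_def)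
    finally have B: "\<bar>\<gamma> t \<bullet> e\<bar> \<le> C * dist (s, r) (s', r')" .
    have "c * \<bar>s - s'\<bar> \<le> c * D" using c(1) by (intro mult_left_mono) (auto simp: D_def)
    also have "\<dots> \<le> \<bar>\<gamma> t \<bullet> e\<bar> + \<bar>\<gamma>' t \<bullet> e\<bar>" by (rule lower[OF t(1)])
    also have "\<dots> \<le> 1 * norm e + G * norm e"
      using norm1[of t] G(2)[of t] t sub
      by (intro add_mono order.trans[OF Cauchy_Schwarz_ineq2 mult_right_mono]) auto
    finally have "\<bar>s - s'\<bar> \<le> (1 + G) / c * norm e" using c(1) by (simp add: field_simps)
    also have "\<dots> \<le> C * norm e" by (intro mult_right_mono) (auto simp: C_def)
    finally show "\<bar>t - t'\<bar> * dist (s, r) (s', r') \<le> C * max \<bar>\<gamma> t \<bullet> (r *\<^sub>R \<gamma> s - r' *\<^sub>R \<gamma> s')\<bar> \<bar>\<gamma> t' \<bullet> (r *\<^sub>R \<gamma> s - r' *\<^sub>R \<gamma> s')\<bar> \<and>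
      \<bar>\<gamma> t \<bullet> (r *\<^sub>R \<gamma> s - r' *\<^sub>R \<gamma> s')\<bar> \<le> C * dist (s, r) (s', r') \<and>
      \<bar>s - s'\<bar> \<le> C * norm (r *\<^sub>R \<gamma> s - r' *\<^sub>R \<gamma> s')"
      using A B unfolding e_def by blast
  qed
qed

section \<open>Projections of the set\<close>

text \<open>The preimage is taken on the closed rectangle, as the curve is known to be continuous on
  [0,1] only.\<close>

lemma cone_parameters_borel:
  fixes \<gamma> :: "real \<Rightarrow> real ^ 'n"
  assumes "A \<in> sets borel" "continuous_on {0..1} \<gamma>" "0 \<le> p" "q \<le> 1"
  shows "{z \<in> {p..q} \<times> {\<rho>..R}. x + snd z *\<^sub>R \<gamma> (fst z) \<in> A} \<in> sets borel"
proof -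
  let ?S = "{p..q} \<times> {\<rho>..R}"
  have S: "?S \<in> sets borel" by (intro borel_closed closed_Times) auto
  have "continuous_on (fst ` ?S) \<gamma>"
    using assms(2) by (rule continuous_on_subset) (use assms in auto)
  then have "continuous_on ?S (\<lambda>z. \<gamma> (fst z))"
    by (rule continuous_on_compose2) (auto intro: continuous_intros)
  then have "continuous_on ?S (\<lambda>z. x + snd z *\<^sub>R \<gamma> (fst z))" by (intro continuous_intros)
  then have "(\<lambda>z. x + snd z *\<^sub>R \<gamma> (fst z)) \<in> borel_measurable (restrict_space borel ?S)"
    by (rule borel_measurable_continuous_on_restrict)
  from measurable_sets[OF this assms(1)]
  have "(\<lambda>z. x + snd z *\<^sub>R \<gamma> (fst z)) -` A \<inter> ?S \<in> sets (restrict_space borel ?S)"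
    by (simp add: space_restrict_space)
  then have "(\<lambda>z. x + snd z *\<^sub>R \<gamma> (fst z)) -` A \<inter> ?S \<in> sets borel"
    using S by (simp add: sets_restrict_space_iff)
  moreover have "(\<lambda>z. x + snd z *\<^sub>R \<gamma> (fst z)) -` A \<inter> ?S = {z \<in> ?S. x + snd z *\<^sub>R \<gamma> (fst z) \<in> A}" by auto
  ultimately show ?thesis by simp
qed

text \<open>Transversality needs radii bounded away from 0 and infinity. Countably many annuli
  exhaust the punctured space, so one of them retains a non-null set of directions.\<close>

lemma localise_directions:
  fixes \<gamma> :: "real \<Rightarrow> real ^ 'n"
  assumes dim: "ennreal u < hausdorff_dim {t \<in> {0..1}. \<gamma> t \<in> radial_proj_set x A}" and u: "0 < u"
  obtains \<rho> R :: real where "0 < \<rho>" "\<rho> \<le> R" "1 \<le> R"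
    "hausdorff_measure u {t \<in> {0..1}. \<exists>r\<in>{\<rho>..R}. x + r *\<^sub>R \<gamma> t \<in> A} \<noteq> 0"
proof -
  let ?T = "{t \<in> {0..1}. \<gamma> t \<in> radial_proj_set x A}"
  define T where "T k = {t \<in> {0..1}. \<exists>r\<in>{1 / (real k + 1)..real k + 1}. x + r *\<^sub>R \<gamma> t \<in> A}" for k
  have "?T \<subseteq> (\<Union>k. T k)"
  proof
    fix t assume "t \<in> ?T"
    then obtain a where a: "t \<in> {0..1}" "a \<in> A" "a \<noteq> x" "\<gamma> t = (a - x) /\<^sub>R norm (a - x)"
      by (auto simp: radial_proj_set_def radial_proj_def)
    let ?r = "norm (a - x)"
    have r: "0 < ?r" "x + ?r *\<^sub>R \<gamma> t = a" using a by auto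
    obtain k where k: "max ?r (1 / ?r) \<le> real k" using real_arch_simple by blast
    then have "1 / ?r \<le> real k + 1" by simp
    then have "1 \<le> (real k + 1) * ?r" using r(1) by (simp add: pos_divide_le_eq)
    then have "1 / (real k + 1) \<le> ?r" by (simp add: pos_divide_le_eq mult.commute)
    moreover have "?r \<le> real k + 1" using k by simp
    ultimately have "t \<in> T k" using a r by (auto simp: T_def intro!: bexI[of _ ?r])
    then show "t \<in> (\<Union>k. T k)" by blast
  qed
  moreover have "hausdorff_measure u ?T \<noteq> 0"
    using hausdorff_dim_le[of u ?T] u dim by auto
  ultimately obtain k where "hausdorff_measure u (T k) \<noteq> 0"
    using hausdorff_null_UN[of u T] hausdorff_null_subset by blast
  moreover have "1 / (real k + 1) \<le> real k + 1" by (rule order.trans[of _ 1]) auto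
  ultimately show thesis using that[of "1 / (real k + 1)" "real k + 1"] by (auto simp: T_def)
qed

lemma localise_arc:
  fixes T :: "real set"
  assumes "hausdorff_measure u T \<noteq> 0" "T \<subseteq> {0..1}" "0 < \<eta>"
  obtains p q where "0 \<le> p" "q \<le> 1" "q - p < \<eta>" "hausdorff_measure u (T \<inter> {p..q}) \<noteq> 0"
proof -
  obtain N :: nat where N: "0 < N" "1 / real N < \<eta>"
    using reals_Archimedean[OF assms(3)] by (metis inverse_eq_divide zero_less_Suc)
  let ?I = "\<lambda>j::nat. {real j / real N..min 1 ((real j + 1) / real N)}"
  have "T \<subseteq> (\<Union>j. T \<inter> ?I j)"
  proof
    fix t assume t: "t \<in> T"
    then have t01: "0 \<le> t" "t \<le> 1" using assms(2) by auto
    have "real (nat \<lfloor>t * N\<rfloor>) \<le> t * N" "t * N \<le> real (nat \<lfloor>t * N\<rfloor>) + 1"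
      using t01 by (auto simp: of_nat_nat)
    then have "t \<in> ?I (nat \<lfloor>t * N\<rfloor>)" using N t01 by (simp add: pos_divide_le_eq pos_le_divide_eq)
    then show "t \<in> (\<Union>j. T \<inter> ?I j)" using t by blast
  qed
  then obtain j where j: "hausdorff_measure u (T \<inter> ?I j) \<noteq> 0"
    using hausdorff_null_UN[of u "\<lambda>j. T \<inter> ?I j"] hausdorff_null_subset assms(1) by blast
  show thesis
  proof (rule that[OF _ _ _ j])
    have "(real j + 1) / real N - real j / real N = 1 / real N" by (simp flip: diff_divide_distrib)
    then show "min 1 ((real j + 1) / real N) - real j / real N < \<eta>" using N(2) by linarith
  qed auto
qed

theorem proposition1p10:
  fixes A :: "(real ^ 'n) set" and x :: "real ^ 'n" and u :: real
  assumes "CARD('n) \<ge> 2"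
    and "A \<in> sets borel"
    and "0 < u" and "ennreal u \<le> min (hausdorff_dim A) 1"
    and "\<exists>\<gamma>. nondegenerate_curve \<gamma> \<and>
           hausdorff_dim {t \<in> {0..1}. \<gamma> t \<in> radial_proj_set x A} > ennreal u"
  shows "\<exists>A\<^sub>x. A\<^sub>x \<subseteq> A \<and> hausdorff_dim A\<^sub>x \<ge> ennreal u \<and>
           (\<forall>a\<in>A\<^sub>x. hausdorff_dim (Pi_proj x a A) \<ge> ennreal u)"
proof -
  obtain \<gamma> where \<gamma>: "nondegenerate_curve \<gamma>"
    and dim: "ennreal u < hausdorff_dim {t \<in> {0..1}. \<gamma> t \<in> radial_proj_set x A}"
    using assms(5) by blast
  note curve = nondegenerate_curveD[OF \<gamma> assms(1)]
  obtain \<rho> R where \<rho>: "0 < \<rho>" "\<rho> \<le> R" "1 \<le> R"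
    and T: "hausdorff_measure u {t \<in> {0..1}. \<exists>r\<in>{\<rho>..R}. x + r *\<^sub>R \<gamma> t \<in> A} \<noteq> 0"
    by (rule localise_directions[OF dim \<open>0 < u\<close>])
  obtain \<eta> C where \<eta>: "0 < \<eta>" and C: "0 < C"
    and geometry: "\<And>p q t t' s s' r r'. 0 \<le> p \<Longrightarrow> q \<le> 1 \<Longrightarrow> q - p < \<eta> \<Longrightarrow>
      {t, t', s, s'} \<subseteq> {p..q} \<Longrightarrow> {r, r'} \<subseteq> {\<rho>..R} \<Longrightarrow>
      \<bar>t - t'\<bar> * dist (s, r) (s', r') \<le> C * max \<bar>\<gamma> t \<bullet> (r *\<^sub>R \<gamma> s - r' *\<^sub>R \<gamma> s')\<bar> \<bar>\<gamma> t' \<bullet> (r *\<^sub>R \<gamma> s - r' *\<^sub>R \<gamma> s')\<bar> \<and>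
      \<bar>\<gamma> t \<bullet> (r *\<^sub>R \<gamma> s - r' *\<^sub>R \<gamma> s')\<bar> \<le> C * dist (s, r) (s', r') \<and>
      \<bar>s - s'\<bar> \<le> C * norm (r *\<^sub>R \<gamma> s - r' *\<^sub>R \<gamma> s')"
    by (rule cone_local_transversality[OF curve \<rho>(1,2)]) (assumption+, rule that, assumption+)
  obtain p q where pq: "0 \<le> p" "q \<le> 1" "q - p < \<eta>"
    and T_pq: "hausdorff_measure u ({t \<in> {0..1}. \<exists>r\<in>{\<rho>..R}. x + r *\<^sub>R \<gamma> t \<in> A} \<inter> {p..q}) \<noteq> 0"
    by (rule localise_arc[OF T _ \<eta>]) blast+
  define B where "B = {z \<in> {p..q} \<times> {\<rho>..R}. x + snd z *\<^sub>R \<gamma> (fst z) \<in> A}"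
  \<comment> \<open>The projection along \<open>\<gamma> t\<close> of the point with parameters
    \<open>z\<close>, taken relative to \<open>x\<close>; for the points of \<open>A\<close> it
    differs from the required projection by an affine map only.\<close>
  define g where "g t z = \<gamma> t \<bullet> (snd z *\<^sub>R \<gamma> (fst z))" for t and z :: "real \<times> real"
  have fst_B: "fst ` B = {t \<in> {0..1}. \<exists>r\<in>{\<rho>..R}. x + r *\<^sub>R \<gamma> t \<in> A} \<inter> {p..q}"
    using pq by (force simp: B_def image_iff)
  have T_B: "hausdorff_measure u (fst ` B) \<noteq> 0" using T_pq unfolding fst_B .
  interpret dyadic_square u R using \<open>0 < u\<close> \<rho>(3) by unfold_locales
  have cont: "continuous_on {0..1} \<gamma>"
    using curve(1) by (meson continuous_on_eq_continuous_within has_vector_derivative_continuous)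
  have B_suslin: "suslin B"
    unfolding B_def by (intro borel_imp_suslin cone_parameters_borel assms(2) cont pq(1,2))
  have B_sub: "B \<subseteq> {0..R} \<times> {0..R}" using pq \<rho> by (auto simp: B_def)
  have B_pos: "0 < content B" using T_B hausdorff_null_of_content[of B] by (auto simp: zero_less_iff_neq_zero)
  \<comment> \<open>Exponents increasing to \<open>u\<close>; the summand 2 makes the first one u /
    2 and thus positive.\<close>
  define v where "v n = u * (1 - 1 / (real n + 2))" for n :: nat
  have v: "0 < v n" "v n < u" for n using \<open>0 < u\<close> by (auto simp: v_def intro!: mult_pos_pos)
  have null: "hausdorff_measure u {t\<in>{p..q}. hausdorff_measure (v n) (g t ` B) = 0} = 0" for n
  proof (rule exceptional_set_null[OF B_suslin B_sub B_pos _ _ _ _ v])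
    show "{p..q} \<subseteq> {0..1}" using pq by auto
    show "0 \<le> C" using C by simp
    fix t t' y y' assume *: "t \<in> {p..q}" "y \<in> B" "y' \<in> B"
    have **: "{fst y, fst y'} \<subseteq> {p..q}" "{snd y, snd y'} \<subseteq> {\<rho>..R}" using * by (auto simp: B_def)
    have g_diff: "g s y - g s y' = \<gamma> s \<bullet> (snd y *\<^sub>R \<gamma> (fst y) - snd y' *\<^sub>R \<gamma> (fst y'))" for s
      by (simp add: g_def inner_diff_right)
    show "\<bar>g t y - g t y'\<bar> \<le> C * dist y y'"
      using geometry[OF pq, of t t "fst y" "fst y'" "snd y" "snd y'"] * ** by (simp add: g_diff)
    show "\<bar>t - t'\<bar> * dist y y' \<le> C * max \<bar>g t y - g t y'\<bar> \<bar>g t' y - g t' y'\<bar>" if "t' \<in> {p..q}"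
      using geometry[OF pq, of t t' "fst y" "fst y'" "snd y" "snd y'"] * ** that by (simp add: g_diff)
  qed
  define E where "E = (\<Union>n. {t\<in>{p..q}. hausdorff_measure (v n) (g t ` B) = 0})"
  have E_null: "hausdorff_measure u E = 0" unfolding E_def by (intro hausdorff_null_UN null)
  define T' where "T' = fst ` B - E"
  have T'_pos: "hausdorff_measure u T' \<noteq> 0"
    using hausdorff_null_subset[OF hausdorff_null_Un[OF _ E_null, of T'], of "fst ` B"] T_B
    by (auto simp: T'_def)
  define Ax where "Ax = (\<lambda>z. x + snd z *\<^sub>R \<gamma> (fst z)) ` {z \<in> B. fst z \<in> T'}"
  have "ennreal u \<le> hausdorff_dim Ax"
  proof (rule ccontr)
    assume "\<not> ?thesis"
    then obtain s where s: "0 \<le> s" "s < u" "hausdorff_measure s Ax = 0"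
      using hausdorff_dim_less[of Ax u] by (auto simp: not_le)
    \<comment> \<open>The exponent \<open>s\<close> may be 0, while the Lipschitz image lemma asks
      for a positive one.\<close>
    define s' where "s' = max s (u / 2)"
    have s': "0 < s'" "s \<le> s'" "s' \<le> u" using s \<open>0 < u\<close> by (auto simp: s'_def)
    define Y where "Y z = x + snd z *\<^sub>R \<gamma> (fst z)" for z
    have "\<forall>a\<in>Ax. \<exists>z\<in>B. fst z \<in> T' \<and> Y z = a" unfolding Ax_def Y_def by blast
    then obtain h where h: "\<And>a. a \<in> Ax \<Longrightarrow> h a \<in> B \<and> fst (h a) \<in> T' \<and> Y (h a) = a" by metis
    have Y_dist: "\<bar>fst z - fst z'\<bar> \<le> C * dist (Y z) (Y z')" if "z \<in> B" "z' \<in> B" for z z'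
      using geometry[OF pq, of "fst z" "fst z" "fst z" "fst z'" "snd z" "snd z'"] that
      by (auto simp: B_def Y_def dist_norm)
    \<comment> \<open>The parameter \<open>s\<close> is a Lipschitz function of the point on the
      cone, by the third estimate of \<open>geometry\<close>. A null \<open>Ax\<close> would
      therefore have a null set \<open>T'\<close> of directions.\<close>
    have "hausdorff_measure s' ((fst \<circ> h) ` Ax) = 0"
    proof (rule hausdorff_null_lipschitz_image[OF hausdorff_null_mono_exponent[OF s(3,1) s'(2)] s'(1) C])
      show "dist ((fst \<circ> h) a) ((fst \<circ> h) a') \<le> C * dist a a'" if "a \<in> Ax" "a' \<in> Ax" for a a'
        using Y_dist[of "h a" "h a'"] h[OF that(1)] h[OF that(2)] by (simp add: dist_real_def)
    qed
    moreover have "T' \<subseteq> (fst \<circ> h) ` Ax"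
    proof
      fix t assume t: "t \<in> T'"
      then obtain z where z: "z \<in> B" "fst z = t" by (auto simp: T'_def)
      then have a: "Y z \<in> Ax" using t by (auto simp: Ax_def Y_def)
      have "\<bar>fst (h (Y z)) - fst z\<bar> \<le> C * dist (Y (h (Y z))) (Y z)" using h[OF a] z(1) by (intro Y_dist) auto
      also have "Y (h (Y z)) = Y z" using h[OF a] by blast
      finally have "t = (fst \<circ> h) (Y z)" using z(2) by simp
      then show "t \<in> (fst \<circ> h) ` Ax" using a by (rule image_eqI)
    qed
    ultimately have "hausdorff_measure s' T' = 0" by (rule hausdorff_null_subset)
    then have "hausdorff_measure u T' = 0"
      by (rule hausdorff_null_mono_exponent) (use s' in auto)
    with T'_pos show False ..
  qed
  moreover have "ennreal u \<le> hausdorff_dim (Pi_proj x a A)" if a: "a \<in> Ax" for a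
  proof (rule ccontr)
    assume "\<not> ?thesis"
    then obtain s where s: "0 \<le> s" "s < u" "hausdorff_measure s (Pi_proj x a A) = 0"
      using hausdorff_dim_less[of "Pi_proj x a A" u] by (auto simp: not_le)
    obtain t r where tr: "t \<in> T'" "r \<in> {\<rho>..R}" "a = x + r *\<^sub>R \<gamma> t"
      using a by (auto simp: Ax_def B_def)
    have r: "0 < r" using tr(2) \<rho> by auto
    obtain n :: nat where n: "u / (u - s) \<le> real n" using real_arch_simple by blast
    have "u \<le> real n * (u - s)" using n s(2) by (simp add: pos_divide_le_eq)
    also have "\<dots> \<le> (real n + 2) * (u - s)" using s(2) by (intro mult_right_mono) auto
    finally have "u / (real n + 2) \<le> u - s" by (simp add: pos_divide_le_eq mult.commute)
    then have sv: "s \<le> v n" by (simp add: v_def algebra_simps)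
    \<comment> \<open>Since \<open>a - x\<close> is \<open>r\<close> times
      \<open>\<gamma> t\<close>, this affine map takes the product of \<open>a - x\<close> and
      \<open>y\<close> to that of \<open>\<gamma> t\<close> and \<open>y - x\<close>, which is
      \<open>g t\<close> at the parameters of \<open>y\<close>.\<close>
    define f where "f \<alpha> = (\<alpha> - r * (\<gamma> t \<bullet> x)) / r" for \<alpha>
    have "hausdorff_measure (v n) (f ` Pi_proj x a A) = 0"
    proof (rule hausdorff_null_lipschitz_image[OF hausdorff_null_mono_exponent[OF s(3,1) sv] v(1)])
      show "0 < 1 / r" using r by simp
      show "dist (f \<alpha>) (f \<beta>) \<le> 1 / r * dist \<alpha> \<beta>" for \<alpha> \<beta>
        using r by (simp add: f_def dist_real_def flip: diff_divide_distrib)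
    qed
    moreover have "g t ` B \<subseteq> f ` Pi_proj x a A"
    proof
      fix \<beta> assume "\<beta> \<in> g t ` B"
      then obtain z where z: "z \<in> B" "\<beta> = g t z" by blast
      let ?y = "x + snd z *\<^sub>R \<gamma> (fst z)"
      have "(a - x) \<bullet> ?y \<in> Pi_proj x a A" using z by (auto simp: Pi_proj_def B_def)
      moreover have "f ((a - x) \<bullet> ?y) = \<beta>"
        using r tr(3) z by (simp add: f_def g_def inner_add_right distrib_left)
      ultimately show "\<beta> \<in> f ` Pi_proj x a A" by blast
    qed
    ultimately have "hausdorff_measure (v n) (g t ` B) = 0" by (rule hausdorff_null_subset)
    moreover have "t \<in> {p..q}" using tr(1) by (auto simp: T'_def B_def)
    ultimately have "t \<in> E" by (auto simp: E_def)
    then show False using tr(1) by (simp add: T'_def)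
  qed
  moreover have "Ax \<subseteq> A" by (auto simp: Ax_def B_def)
  ultimately show ?thesis by blast
qed

end
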